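(* Let $\alpha$ be a finite ordinal and let $\mathbb B$ be the boolean algebra of clopen subsets of $[1,\omega^\alpha]$ (order topology). Then $\mathbb B$ has the small index property: every subgroup $H$ of the automorphism group $G$ of $\mathbb B$ with $|G:H|<2^{\aleph_0}$ contains the pointwise stabilizer $G_A=\{g\in G: g(a)=a \text{ for all } a\in A\}$ of some finite set $A\subseteq\mathbb B$.
   Context: Ordinal exponentiation is meant. *)

theory Defs
  imports "HOL-Algebra.Bij" "HOL-Algebra.Coset" "HOL-Analysis.Function_Topology"
begin

unbundle cardinal_syntax

text \<open>Ordinals are represented by well-order relations, as in the cardinals library.\<close>

definition ord_zero :: "'a rel \<Rightarrow> 'a" where
  "ord_zero r = wo_rel.minim r (Field r)"

definition ord_one :: "'a rel \<Rightarrow> 'a" where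
  "ord_one r = wo_rel.suc r {ord_zero r}"

text \<open>Ordinal (not cardinal) exponentiation \<open>r\<^sup>s\<close>: functions from \<open>s\<close> to \<open>r\<close> with finite
  support (all but finitely many values are the least element of \<open>r\<close>), compared at the
  \<open>s\<close>-greatest argument where they differ.\<close>

definition fin_supp_funcs :: "'a rel \<Rightarrow> 'b rel \<Rightarrow> ('b \<Rightarrow> 'a) set" where
  "fin_supp_funcs r s =
     {f \<in> Func (Field s) (Field r). finite {b \<in> Field s. f b \<noteq> ord_zero r}}"

definition ord_exp :: "'a rel \<Rightarrow> 'b rel \<Rightarrow> ('b \<Rightarrow> 'a) rel" where
  "ord_exp r s =
     {(f, g). f \<in> fin_supp_funcs r s \<and> g \<in> fin_supp_funcs r s \<and>
        (f = g \<or>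
         (\<exists>b \<in> Field s. (f b, g b) \<in> r - Id \<and> (\<forall>c. (b, c) \<in> s - Id \<longrightarrow> f c = g c)))}"

text \<open>The ordinal \<open>r + 1\<close>, whose elements are the ordinals \<open>\<le> r\<close>; the ordinal \<open>r\<close> itself
  is the new greatest element \<open>None\<close>.\<close>

definition ord_succ :: "'a rel \<Rightarrow> 'a option rel" where
  "ord_succ r = {(Some x, Some y) | x y. (x, y) \<in> r} \<union> {(Some x, None) | x. x \<in> Field r} \<union>
     {(None, None)}"

text \<open>The interval \<open>[1, r]\<close> of ordinals.\<close>

definition ord_interval_one :: "'a rel \<Rightarrow> 'a option set" where
  "ord_interval_one r = above (ord_succ r) (ord_one (ord_succ r))"

text \<open>The open rays of \<open>X\<close> form a subbase; \<open>X\<close> itself is added because a one-point order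
  has only empty rays.\<close>

definition order_topology_on :: "'a set \<Rightarrow> 'a rel \<Rightarrow> 'a topology" where
  "order_topology_on X r = topology_generated_by
     (insert X ({{x \<in> X. (x, a) \<in> r - Id} | a. a \<in> X} \<union> {{x \<in> X. (a, x) \<in> r - Id} | a. a \<in> X}))"

definition interval_topology :: "'a rel \<Rightarrow> 'a option topology" where
  "interval_topology r = order_topology_on (ord_interval_one r) (ord_succ r)"

definition clopens :: "'a topology \<Rightarrow> 'a set set" where
  "clopens T = {U. openin T U \<and> closedin T U}"

text \<open>A boolean algebra is given here as a field of sets \<open>B\<close> with top element \<open>X\<close>; its
  automorphisms are kept extensional outside \<open>B\<close>, as in \<^const>\<open>BijGroup\<close>.\<close>

definition boolean_auts :: "'a set \<Rightarrow> 'a set set \<Rightarrow> ('a set \<Rightarrow> 'a set) set" where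
  "boolean_auts X B =
     {g \<in> Bij B. g {} = {} \<and> g X = X \<and> (\<forall>U\<in>B. g (X - U) = X - g U) \<and>
        (\<forall>U\<in>B. \<forall>V\<in>B. g (U \<inter> V) = g U \<inter> g V \<and> g (U \<union> V) = g U \<union> g V)}"

definition boolean_aut_group :: "'a set \<Rightarrow> 'a set set \<Rightarrow> ('a set \<Rightarrow> 'a set) monoid" where
  "boolean_aut_group X B = BijGroup B \<lparr>carrier := boolean_auts X B\<rparr>"

definition pointwise_stabilizer :: "('a \<Rightarrow> 'a, 'b) monoid_scheme \<Rightarrow> 'a set \<Rightarrow> ('a \<Rightarrow> 'a) set" where
  "pointwise_stabilizer G A = {g \<in> carrier G. \<forall>a\<in>A. g a = a}"

definition small_index_property :: "'a set \<Rightarrow> 'a set set \<Rightarrow> bool" where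
  "small_index_property X B \<longleftrightarrow>
     (\<forall>H. subgroup H (boolean_aut_group X B) \<and>
          |rcosets\<^bsub>boolean_aut_group X B\<^esub> H| <o ctwo ^c natLeq \<longrightarrow>
          (\<exists>A. finite A \<and> A \<subseteq> B \<and> pointwise_stabilizer (boolean_aut_group X B) A \<subseteq> H))"

end

theory Submission
  imports Defs
begin

text \<open>
  By Stone duality \<open>G\<close> is the homeomorphism group of \<open>X = [1, \<omega>\<^sup>\<alpha>]\<close>. For \<open>\<alpha> > 0\<close> the space \<open>X\<close>
  without its top point is a topological sum of clopen copies \<open>Y\<^sub>0, Y\<^sub>1, \<dots>\<close> of \<open>[1, \<omega>\<^sup>\<alpha>\<^sup>-\<^sup>1]\<close>,
  and one argues by induction on \<open>\<alpha>\<close>, following Dixon, Neumann and Thomas's proof for the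
  symmetric group of \<open>\<nat>\<close> (the case \<open>\<alpha> = 1\<close>). A diagonal argument over countable products and a
  commutator trick show that \<open>H\<close> contains all homeomorphisms supported in the union of some
  infinite coinfinite set of the \<open>Y\<^sub>i\<close>. An almost disjoint family of size continuum then gives
  two conjugates of such subgroups whose supports together cover all but finitely many \<open>Y\<^sub>i\<close>,
  and these conjugates generate all homeomorphisms of the union of the supports: any two clopen
  subsets of \<open>\<Union>\<^sub>i Y\<^sub>i\<close> with infinitely many points of maximal rank are homeomorphic. The
  remaining finitely many \<open>Y\<^sub>i\<close> are handled by the induction hypothesis.
\<close>

section \<open>Rings of sets and their automorphisms\<close>

text \<open>A permutation of \<nat> carries subsets to subsets, but for larger \<alpha> a
  homeomorphism need not carry a union of pieces to a union of pieces. So two notions share the role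
  of the subsets of \<nat>: unions of pieces, on which the diagonal arguments run, and arbitrary
  clopen subsets of the non-compact union, of which one records only whether they contain infinitely
  many top points of pieces. Homeomorphisms respect this because top points are recognised by their
  Cantor-Bendixson rank, and it decides the homeomorphism type because sets of lower rank can be
  absorbed. The induction never changes the ambient group: homeomorphisms are permutations of one
  type that are the identity off their support, and topology enters only through one ring
  \<open>C\<close> of compact open sets. Hence the same \<open>C\<close> and the same
  \<open>H\<close> serve a space and all its pieces.\<close>

abbreviation (input) finv :: "('a \<Rightarrow> 'b) \<Rightarrow> 'b \<Rightarrow> 'a" where
  "finv f \<equiv> inv_into UNIV f"

locale set_ring =
  fixes C :: "'a set set"
  assumes empty_C [simp, intro]: "{} \<in> C"
    and Un_C: "U \<in> C \<Longrightarrow> V \<in> C \<Longrightarrow> U \<union> V \<in> C"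
    and Diff_C: "U \<in> C \<Longrightarrow> V \<in> C \<Longrightarrow> U - V \<in> C"
begin

lemma Int_C: "U \<in> C \<Longrightarrow> V \<in> C \<Longrightarrow> U \<inter> V \<in> C"
  using Diff_C[of U "U - V"] Diff_C[of U V] by (simp add: Diff_Diff_Int)

lemma UN_C: "finite I \<Longrightarrow> (\<And>i. i \<in> I \<Longrightarrow> V i \<in> C) \<Longrightarrow> (\<Union>i\<in>I. V i) \<in> C"
  by (induction I rule: finite_induct) (auto intro: Un_C)

text \<open>\<open>V\<close> and \<open>W\<close> need not belong to \<open>C\<close>. In the spaces
  below, the members of \<open>C\<close> are compact open sets forming a base, so respecting
  membership in \<open>C\<close> in both directions amounts to being a homeomorphism.\<close>

definition homeo :: "'a set \<Rightarrow> 'a set \<Rightarrow> ('a \<Rightarrow> 'a) \<Rightarrow> bool" where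
  "homeo V W f \<longleftrightarrow> bij_betw f V W \<and> (\<forall>U. U \<subseteq> V \<longrightarrow> (U \<in> C \<longleftrightarrow> f ` U \<in> C))"

lemma homeo_bij: "homeo V W f \<Longrightarrow> bij_betw f V W"
  by (simp add: homeo_def)

lemma homeo_image: "homeo V W f \<Longrightarrow> f ` V = W"
  by (simp add: homeo_def bij_betw_def)

lemma homeo_C: "homeo V W f \<Longrightarrow> U \<subseteq> V \<Longrightarrow> f ` U \<in> C \<longleftrightarrow> U \<in> C"
  by (simp add: homeo_def)

lemma homeo_id: "homeo V V (\<lambda>x. x)"
  by (simp add: homeo_def bij_betw_def)

lemma homeo_comp:
  assumes "homeo U V f" "homeo V W g" shows "homeo U W (g \<circ> f)"
  unfolding homeo_def
proof (intro conjI allI impI)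
  show "bij_betw (g \<circ> f) U W" using assms by (meson bij_betw_trans homeo_bij)
  fix A assume A: "A \<subseteq> U"
  then have "f ` A \<subseteq> V" using assms(1) by (auto simp: homeo_def bij_betw_def)
  then show "A \<in> C \<longleftrightarrow> (g \<circ> f) ` A \<in> C"
    using assms A homeo_C unfolding image_comp[symmetric] by metis
qed

lemma homeo_inv:
  assumes "homeo V W f" shows "homeo W V (inv_into V f)"
  unfolding homeo_def
proof (intro conjI allI impI)
  show "bij_betw (inv_into V f) W V" using assms by (simp add: bij_betw_inv_into homeo_bij)
  fix U assume U: "U \<subseteq> W"
  then have "inv_into V f ` U \<subseteq> V" "f ` (inv_into V f ` U) = U"
    using assms by (auto simp: homeo_def bij_betw_def inv_into_into image_inv_into_cancel)
  then show "U \<in> C \<longleftrightarrow> inv_into V f ` U \<in> C" using assms homeo_C by metis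
qed

lemma homeo_restrict:
  assumes "homeo V W f" "U \<subseteq> V" shows "homeo U (f ` U) f"
  using assms unfolding homeo_def by (auto simp: bij_betw_def inj_on_subset)

lemma homeo_cong:
  assumes "\<And>x. x \<in> V \<Longrightarrow> f x = g x" shows "homeo V W f \<longleftrightarrow> homeo V W g"
proof -
  have "f ` U = g ` U" if "U \<subseteq> V" for U using that assms by (auto intro!: image_cong)
  then show ?thesis unfolding homeo_def using assms by (metis bij_betw_cong)
qed

section \<open>Gluing homeomorphisms along topological sums\<close>

text \<open>The union is the topological sum of the \<open>P i\<close>: a compact open set meets
  only finitely many summands, each in a compact open set. The summands themselves may be
  non-compact.\<close>

definition locally_finite :: "('i \<Rightarrow> 'a set) \<Rightarrow> bool" where
  "locally_finite P \<longleftrightarrow> disjoint_family P \<and>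
     (\<forall>U\<in>C. U \<subseteq> (\<Union>i. P i) \<longrightarrow> (\<forall>i. U \<inter> P i \<in> C) \<and> finite {i. U \<inter> P i \<noteq> {}})"

text \<open>Local finiteness on both sides lets membership in \<open>C\<close> be tested piecewise,
  since a compact open set is the union of its finitely many nonempty traces.\<close>

lemma homeo_glue:
  assumes P: "locally_finite P" and Q: "locally_finite Q"
    and f: "\<And>i. homeo (P i) (Q i) (f i)"
  obtains g where "homeo (\<Union>i. P i) (\<Union>i. Q i) g" "\<And>i x. x \<in> P i \<Longrightarrow> g x = f i x"
proof -
  define g where "g x = f (SOME i. x \<in> P i) x" for x
  have dP: "disjoint_family P" and dQ: "disjoint_family Q"
    using P Q by (auto simp: locally_finite_def)
  have g: "g x = f i x" if "x \<in> P i" for i x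
  proof -
    have "x \<in> P (SOME i. x \<in> P i)" using that by (rule someI)
    then have "(SOME i. x \<in> P i) = i" using dP that by (auto simp: disjoint_family_on_def)
    then show ?thesis by (simp add: g_def)
  qed
  have gi: "homeo (P i) (Q i) g" for i using f[of i] homeo_cong[of "P i" g "f i"] g by simp
  have giQ: "g x \<in> Q i" if "x \<in> P i" for i x using homeo_image[OF gi[of i]] that by auto
  have same: "i = j" if "x \<in> Q i" "x \<in> Q j" for x i j
    using that dQ by (auto simp: disjoint_family_on_def)
  have bij: "bij_betw g (\<Union>i. P i) (\<Union>i. Q i)"
    unfolding bij_betw_def
  proof
    show "inj_on g (\<Union>i. P i)"
    proof (rule inj_onI)
      fix x y assume "x \<in> (\<Union>i. P i)" "y \<in> (\<Union>i. P i)" and eq: "g x = g y"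
      then obtain i j where ij: "x \<in> P i" "y \<in> P j" by auto
      then have "i = j" using giQ eq same by metis
      then show "x = y" using ij eq homeo_bij[OF gi[of i]] by (auto simp: bij_betw_def inj_on_def)
    qed
    show "g ` (\<Union>i. P i) = (\<Union>i. Q i)" using homeo_image[OF gi] by (simp add: image_UN)
  qed
  have "U \<in> C \<longleftrightarrow> g ` U \<in> C" if U: "U \<subseteq> (\<Union>i. P i)" for U
  proof -
    have Ueq: "U = (\<Union>i\<in>{i. U \<inter> P i \<noteq> {}}. (U \<inter> P i))" using U by blast
    show ?thesis
    proof
      assume "U \<in> C"
      with P U have fin: "finite {i. U \<inter> P i \<noteq> {}}" and UP: "\<And>i. U \<inter> P i \<in> C"
        by (auto simp: locally_finite_def)
      have "g ` U = (\<Union>i\<in>{i. U \<inter> P i \<noteq> {}}. g ` (U \<inter> P i))"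
        unfolding image_UN[symmetric] using Ueq by simp
      moreover have "\<dots> \<in> C" using fin by (rule UN_C) (use UP homeo_C[OF gi] in \<open>meson inf_le2\<close>)
      ultimately show "g ` U \<in> C" by simp
    next
      assume gU: "g ` U \<in> C"
      have sub: "g ` U \<subseteq> (\<Union>i. Q i)" using U giQ by blast
      have eq: "g ` U \<inter> Q i = g ` (U \<inter> P i)" for i using giQ same U by blast
      have fin: "finite {i. U \<inter> P i \<noteq> {}}" and UP: "\<And>i. g ` (U \<inter> P i) \<in> C"
        using Q gU sub by (auto simp: locally_finite_def eq)
      have "U = (\<Union>i\<in>{i. U \<inter> P i \<noteq> {}}. (U \<inter> P i))" using Ueq .
      moreover have "\<dots> \<in> C" using fin by (rule UN_C) (use UP homeo_C[OF gi] in \<open>meson inf_le2\<close>)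
      ultimately show "U \<in> C" by simp
    qed
  qed
  with bij have "homeo (\<Union>i. P i) (\<Union>i. Q i) g" by (auto simp: homeo_def)
  then show thesis using g that by blast
qed

text \<open>Indexing by \<open>bool\<close> makes gluing two maps an instance of gluing a family.
  One trace condition suffices: the trace of \<open>U\<close> on \<open>W\<close> is what remains of
  \<open>U\<close> without its trace on \<open>V\<close>.\<close>

lemma locally_finite_bool:
  assumes "V \<inter> W = {}" "\<And>U. U \<in> C \<Longrightarrow> U \<subseteq> V \<union> W \<Longrightarrow> U \<inter> V \<in> C"
  shows "locally_finite (\<lambda>b. if b then V else W)"
proof -
  have "U \<inter> W \<in> C" if "U \<in> C" "U \<subseteq> V \<union> W" for U
  proof -
    have "U \<inter> W = U - (U \<inter> V)" using that assms(1) by auto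
    then show ?thesis using that assms(2) Diff_C by simp
  qed
  then show ?thesis using assms by (auto simp: locally_finite_def disjoint_family_on_def)
qed

lemma UN_bool: "(\<Union>b. if b then V else W) = V \<union> W"
  by (auto split: if_splits)

lemma homeo_glue2:
  assumes "homeo V V' f" "homeo W W' g" "V \<inter> W = {}" "V' \<inter> W' = {}"
    and "\<And>U. U \<in> C \<Longrightarrow> U \<subseteq> V \<union> W \<Longrightarrow> U \<inter> V \<in> C"
    and "\<And>U. U \<in> C \<Longrightarrow> U \<subseteq> V' \<union> W' \<Longrightarrow> U \<inter> V' \<in> C"
  obtains h where "homeo (V \<union> W) (V' \<union> W') h" "\<And>x. x \<in> V \<Longrightarrow> h x = f x" "\<And>x. x \<in> W \<Longrightarrow> h x = g x"
proof -
  have f: "homeo (if b then V else W) (if b then V' else W') (if b then f else g)" for b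
    using assms by simp
  obtain h where "homeo (\<Union>b. if b then V else W) (\<Union>b. if b then V' else W') h"
     and h: "\<And>b x. x \<in> (if b then V else W) \<Longrightarrow> h x = (if b then f else g) x"
    using homeo_glue[OF locally_finite_bool[of V W] locally_finite_bool[of V' W'] f] assms by blast
  then show thesis using that h[of _ True] h[of _ False] unfolding UN_bool by simp
qed

section \<open>Groups of homeomorphisms with given support\<close>

text \<open>Permutations of the whole type rather than maps on \<open>V\<close>: the groups for
  different \<open>V\<close> then lie in one common group and can be compared with a single
  \<open>H\<close>.\<close>

definition Aut :: "'a set \<Rightarrow> ('a \<Rightarrow> 'a) set" where
  "Aut V = {f. bij f \<and> (\<forall>x. x \<notin> V \<longrightarrow> f x = x) \<and> (\<forall>U. U \<subseteq> V \<longrightarrow> (U \<in> C \<longleftrightarrow> f ` U \<in> C))}"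

lemma Aut_bij: "f \<in> Aut V \<Longrightarrow> bij f"
  and Aut_out: "f \<in> Aut V \<Longrightarrow> x \<notin> V \<Longrightarrow> f x = x"
  and Aut_C: "f \<in> Aut V \<Longrightarrow> U \<subseteq> V \<Longrightarrow> f ` U \<in> C \<longleftrightarrow> U \<in> C"
  by (auto simp: Aut_def)

lemma Aut_inj: "f \<in> Aut V \<Longrightarrow> f x = f y \<longleftrightarrow> x = y"
  using Aut_bij bij_is_inj inj_eq by metis

lemma Aut_mem: assumes "f \<in> Aut V" shows "f x \<in> V \<longleftrightarrow> x \<in> V"
proof
  assume fx: "f x \<in> V"
  show "x \<in> V"
  proof (rule ccontr)
    assume "x \<notin> V" then show False using fx Aut_out[OF assms, of x] by simp
  qed
next
  assume x: "x \<in> V"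
  show "f x \<in> V"
  proof (rule ccontr)
    assume fx: "f x \<notin> V"
    then have "f (f x) = f x" using Aut_out[OF assms] by blast
    then show False using Aut_inj[OF assms] x fx by metis
  qed
qed

lemma Aut_image: assumes "f \<in> Aut V" shows "f ` V = V"
proof -
  have "x \<in> f ` V" if "x \<in> V" for x
    using Aut_mem[OF assms, of "finv f x"] that bij_inv_eq_iff[OF Aut_bij[OF assms]]
    by (metis imageI)
  then show ?thesis using Aut_mem[OF assms] by auto
qed

lemma Aut_homeo: "f \<in> Aut V \<Longrightarrow> homeo V V f"
  using Aut_image[of f V] Aut_bij[of f V]
  by (auto simp: homeo_def Aut_C bij_betw_def bij_def intro: inj_on_subset)

lemma id_Aut: "id \<in> Aut V" "(\<lambda>x. x) \<in> Aut V"
  by (auto simp: Aut_def bij_id[unfolded id_def])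

lemma comp_Aut:
  assumes "f \<in> Aut V" "g \<in> Aut V" shows "f \<circ> g \<in> Aut V"
proof -
  have "homeo V V (f \<circ> g)" using assms homeo_comp Aut_homeo by blast
  then show ?thesis using assms by (auto simp: Aut_def homeo_def bij_comp)
qed

lemma inv_Aut:
  assumes f: "f \<in> Aut V" shows "finv f \<in> Aut V"
proof -
  have b: "bij f" using Aut_bij f .
  have "finv f x = x" if "x \<notin> V" for x
    using b Aut_out[OF f that] by (metis bij_inv_eq_iff)
  moreover have "U \<in> C \<longleftrightarrow> finv f ` U \<in> C" if "U \<subseteq> V" for U
  proof -
    have "finv f ` U \<subseteq> V" using that Aut_mem[OF f] b by (auto simp: bij_inv_eq_iff) (metis bij_inv_eq_iff subsetD)
    then show ?thesis using Aut_C[OF f, of "finv f ` U"] b by (simp add: image_f_inv_f bij_is_surj)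
  qed
  ultimately show ?thesis using b by (auto simp: Aut_def bij_imp_bij_inv)
qed

lemma homeo_Aut:
  assumes "homeo V V f"
  shows "(\<lambda>x. if x \<in> V then f x else x) \<in> Aut V" (is "?g \<in> _")
proof -
  have "bij_betw ?g (V \<union> - V) (V \<union> - V)"
  proof (rule bij_betw_combine)
    show "bij_betw ?g V V" using homeo_bij[OF assms] by (simp cong: bij_betw_cong)
    have "bij_betw (\<lambda>x. x) (-V) (-V)" by (simp add: bij_betw_def)
    then show "bij_betw ?g (-V) (-V)" by (rule iffD1[OF bij_betw_cong, rotated]) auto
  qed auto
  moreover have "?g ` U = f ` U" if "U \<subseteq> V" for U using that by (auto intro!: image_cong)
  ultimately show ?thesis using assms by (auto simp: Aut_def homeo_def)
qed

text \<open>\<open>V\<close> is relatively clopen in \<open>W\<close>, so a compact open set splits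
  into its trace on \<open>V\<close>, which \<open>f\<close> sends to a member of \<open>C\<close>,
  and a rest that \<open>f\<close> fixes.\<close>

lemma Aut_mono:
  assumes f: "f \<in> Aut V" and VW: "V \<subseteq> W" and VC: "\<And>U. U \<in> C \<Longrightarrow> U \<subseteq> W \<Longrightarrow> U \<inter> V \<in> C"
  shows "f \<in> Aut W"
proof -
  have *: "g ` U \<in> C" if g: "g \<in> Aut V" and U: "U \<subseteq> W" "U \<in> C" for U g
  proof -
    have UV: "U \<inter> V \<in> C" using VC U by blast
    have "U - V = U - (U \<inter> V)" by auto
    then have "U - V \<in> C" using UV U Diff_C by simp
    moreover have "g ` U = (U - V) \<union> g ` (U \<inter> V)"
    proof -
      have "g ` (U - V) = id ` (U - V)" using Aut_out[OF g] by (intro image_cong) auto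
      then have "g ` (U - V) = U - V" by simp
      then show ?thesis by (metis Diff_partition Int_Diff_Un Un_commute image_Un)
    qed
    ultimately show ?thesis using Un_C UV Aut_C[OF g] by (metis inf_le2)
  qed
  have "U \<in> C \<longleftrightarrow> f ` U \<in> C" if U: "U \<subseteq> W" for U
  proof
    assume fU: "f ` U \<in> C"
    have "f x \<in> W" if "x \<in> U" for x
      using U VW that Aut_out[OF f, of x] Aut_mem[OF f, of x] by (cases "x \<in> V") auto
    then have "f ` U \<subseteq> W" by blast
    then have "finv f ` f ` U \<in> C" using *[OF inv_Aut[OF f]] fU by blast
    then show "U \<in> C" using Aut_bij[OF f] by (simp add: image_inv_f_f bij_is_inj)
  qed (use *[OF f] U in blast)
  then show ?thesis using f VW by (auto simp: Aut_def)
qed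

lemma Aut_conj:
  assumes g: "g \<in> Aut L" and f: "f \<in> Aut (g ` V)" and V: "V \<subseteq> L"
  shows "finv g \<circ> f \<circ> g \<in> Aut V"
proof -
  have b: "bij g" using Aut_bij g .
  have iv: "homeo V (g ` V) g" using homeo_restrict[OF Aut_homeo[OF g] V] .
  have "homeo V V (inv_into V g \<circ> (f \<circ> g))"
    using homeo_comp[OF homeo_comp[OF iv Aut_homeo[OF f]] homeo_inv[OF iv]] .
  moreover have "(inv_into V g \<circ> (f \<circ> g)) x = (finv g \<circ> f \<circ> g) x" if "x \<in> V" for x
  proof -
    have "f (g x) \<in> g ` V" using Aut_mem[OF f] that by blast
    then obtain y where "y \<in> V" "f (g x) = g y" by auto
    then show ?thesis using b by (simp add: bij_is_inj inj_on_subset[OF bij_is_inj])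
  qed
  ultimately have "homeo V V (finv g \<circ> f \<circ> g)"
    using homeo_cong[of V "inv_into V g \<circ> (f \<circ> g)" "finv g \<circ> f \<circ> g"] by blast
  moreover have "(finv g \<circ> f \<circ> g) x = x" if "x \<notin> V" for x
  proof -
    have "g x \<notin> g ` V" using that b by (simp add: bij_is_inj inj_image_mem_iff)
    then show ?thesis using Aut_out[OF f] b by (simp add: bij_is_inj)
  qed
  moreover have "bij (finv g \<circ> f \<circ> g)"
    using b Aut_bij[OF f] by (intro bij_comp bij_imp_bij_inv)
  ultimately show ?thesis unfolding Aut_def homeo_def by blast
qed

end

section \<open>The spaces \<open>[1, \<omega>\<^sup>n]\<close>\<close>

context set_ring
begin

text \<open>\<open>layer p X Y\<close>: \<open>X\<close> is the one-point compactification by \<open>p\<close> of the topological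
  sum of the \<open>Y i\<close>, as seen by the clopen sets.\<close>

definition layer :: "'a \<Rightarrow> 'a set \<Rightarrow> (nat \<Rightarrow> 'a set) \<Rightarrow> bool" where
  "layer p X Y \<longleftrightarrow> disjoint_family Y \<and> p \<notin> (\<Union>i. Y i) \<and> X = insert p (\<Union>i. Y i) \<and>
     (\<forall>i. Y i \<in> C) \<and>
     (\<forall>U. U \<subseteq> X \<longrightarrow> (U \<in> C \<longleftrightarrow> (\<forall>i. U \<inter> Y i \<in> C) \<and>
        (\<exists>k. \<forall>i\<ge>k. if p \<in> U then Y i \<subseteq> U else U \<inter> Y i = {})))"

text \<open>\<open>X\<close> with its top point \<open>p\<close> is a copy of \<open>[1, \<omega>\<^sup>n]\<close>.\<close>

fun omega_power :: "nat \<Rightarrow> 'a \<Rightarrow> 'a set \<Rightarrow> bool" where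
  "omega_power 0 p X \<longleftrightarrow> X = {p} \<and> {p} \<in> C"
| "omega_power (Suc n) p X \<longleftrightarrow> (\<exists>Y q. layer p X Y \<and> (\<forall>i. omega_power n (q i) (Y i)))"

lemma layer_disj: "layer p X Y \<Longrightarrow> x \<in> Y i \<Longrightarrow> x \<in> Y j \<Longrightarrow> i = j"
  by (auto simp: layer_def disjoint_family_on_def)

lemma layer_Y: "layer p X Y \<Longrightarrow> Y i \<in> C" "layer p X Y \<Longrightarrow> Y i \<subseteq> X" "layer p X Y \<Longrightarrow> p \<notin> Y i"
  and layer_eq: "layer p X Y \<Longrightarrow> X - {p} = (\<Union>i. Y i)"
  and layer_p: "layer p X Y \<Longrightarrow> p \<in> X"
  by (auto simp: layer_def)

lemma layer_X: assumes "layer p X Y" shows "X \<in> C"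
proof -
  have "X \<inter> Y i = Y i" for i using layer_Y(2)[OF assms] by auto
  then have "(\<forall>i. X \<inter> Y i \<in> C) \<and> (\<exists>k. \<forall>i\<ge>k. if p \<in> X then Y i \<subseteq> X else X \<inter> Y i = {})"
    using layer_Y[OF assms] layer_p[OF assms] by auto
  then show ?thesis using assms unfolding layer_def by blast
qed

lemma layer_tail:
  assumes "layer p X Y" "U \<in> C" "U \<subseteq> X" "p \<in> U" obtains k where "\<And>i. i \<ge> k \<Longrightarrow> Y i \<subseteq> U"
  using assms unfolding layer_def by metis

lemma layer_bounded:
  assumes "layer p X Y" "U \<in> C" "U \<subseteq> (\<Union>i. Y i)" obtains k where "\<And>i. i \<ge> k \<Longrightarrow> U \<inter> Y i = {}"
proof -
  have "U \<subseteq> X" "p \<notin> U" using assms unfolding layer_def by auto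
  then show thesis using assms that unfolding layer_def by metis
qed

lemma layer_finite:
  assumes "layer p X Y" "U \<in> C" "U \<subseteq> (\<Union>i. Y i)" shows "finite {i. U \<inter> Y i \<noteq> {}}"
proof -
  obtain k where "\<And>i. i \<ge> k \<Longrightarrow> U \<inter> Y i = {}" using layer_bounded[OF assms] by blast
  then have "{i. U \<inter> Y i \<noteq> {}} \<subseteq> {..<k}" by (metis (mono_tags, lifting) lessThan_iff mem_Collect_eq not_less subsetI)
  then show ?thesis using finite_subset by blast
qed

lemma omega_power_C: "omega_power n p X \<Longrightarrow> X \<in> C"
  and omega_power_top: "omega_power n p X \<Longrightarrow> p \<in> X"
  by (cases n; auto intro: layer_X layer_p)+

text \<open>The top is separated from a point by removing the piece of that point, points of
  different pieces by one of the pieces, points of one piece by induction. Hence \<open>C\<close>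
  determines the points.\<close>

lemma omega_power_separated:
  "omega_power n p X \<Longrightarrow> x \<in> X \<Longrightarrow> y \<in> X \<Longrightarrow> x \<noteq> y \<Longrightarrow> \<exists>U\<in>C. U \<subseteq> X \<and> x \<in> U \<and> y \<notin> U"
proof (induction n arbitrary: p X x y)
  case (Suc n)
  then obtain Y q where l: "layer p X Y" and Y: "\<And>i. omega_power n (q i) (Y i)" by auto
  show ?case
  proof (cases "x = p")
    case True
    then obtain i where i: "y \<in> Y i" using Suc.prems l by (auto simp: layer_def)
    have "X - Y i \<in> C" using l layer_X layer_Y Diff_C by blast
    then show ?thesis using True i layer_Y(3)[OF l] layer_p[OF l] by blast
  next
    case False
    then obtain i where i: "x \<in> Y i" using Suc.prems l by (auto simp: layer_def)
    show ?thesis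
    proof (cases "y \<in> Y i")
      case True
      then show ?thesis using Suc.IH[OF Y[of i] i True] Suc.prems layer_Y(2)[OF l, of i] by blast
    next
      case False
      then show ?thesis using i layer_Y[OF l, of i] by blast
    qed
  qed
qed auto

text \<open>Topological invariance of the Cantor-Bendixson rank of the top point: if \<open>f p\<close> lay
  in some \<open>Y' i\<close>, then \<open>f\<close> would embed two of the \<open>Y j\<close> disjointly into \<open>Y' i\<close>, and both
  images would contain its top point.\<close>

lemma top_invariant:
  "omega_power n p X \<Longrightarrow> omega_power n p' X' \<Longrightarrow> U \<subseteq> X \<Longrightarrow> U \<in> C \<Longrightarrow> p \<in> U \<Longrightarrow>
   homeo U W f \<Longrightarrow> W \<subseteq> X' \<Longrightarrow> W \<in> C \<Longrightarrow> p' \<in> W"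
proof (induction n arbitrary: p X p' X' U W f)
  case 0
  then have "f p \<in> W" using homeo_image by blast
  then show ?case using 0 by auto
next
  case (Suc n)
  obtain Y q where l: "layer p X Y" and Y: "\<And>i. omega_power n (q i) (Y i)" using Suc.prems(1) by auto
  obtain Y' q' where l': "layer p' X' Y'" and Y': "\<And>i. omega_power n (q' i) (Y' i)"
    using Suc.prems(2) by auto
  note f = Suc.prems(6)
  show ?case
  proof (rule ccontr)
    assume "p' \<notin> W"
    moreover have "f p \<in> W" using f Suc.prems(5) homeo_image by blast
    ultimately obtain i where i: "f p \<in> Y' i" using l' Suc.prems(7) by (auto simp: layer_def)
    define A where "A = {x\<in>U. f x \<in> Y' i}"
    have "f ` A = W \<inter> Y' i" using homeo_image[OF f] by (auto simp: A_def)
    moreover have "W \<inter> Y' i \<in> C" using Suc.prems(8) layer_Y(1)[OF l'] Int_C by blast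
    ultimately have A: "A \<in> C" "p \<in> A" "A \<subseteq> X" "A \<subseteq> U"
      using homeo_C[OF f, of A] i Suc.prems(3,5) by (auto simp: A_def)
    then obtain k where k: "\<And>j. j \<ge> k \<Longrightarrow> Y j \<subseteq> A" using layer_tail[OF l] by blast
    have *: "q' i \<in> f ` Y j" if "j \<ge> k" for j
    proof -
      have s: "Y j \<subseteq> U" "Y j \<subseteq> A" using k that A by auto
      have "f ` Y j \<in> C" using homeo_C[OF f s(1)] layer_Y(1)[OF l] by blast
      moreover have "f ` Y j \<subseteq> Y' i" using s by (auto simp: A_def)
      ultimately show ?thesis
        by (intro Suc.IH[OF Y Y' subset_refl layer_Y(1)[OF l] omega_power_top[OF Y] homeo_restrict[OF f s(1)]])
    qed
    obtain x y where xy: "x \<in> Y k" "y \<in> Y (Suc k)" "f x = f y"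
      using *[of k] *[of "Suc k"] by (auto simp: image_iff)
    moreover have "x \<in> U" "y \<in> U" using xy k[of k] k[of "Suc k"] A by auto
    ultimately have "x = y"
      using inj_onD[OF bij_betw_imp_inj_on[OF homeo_bij[OF f]], of x y] by blast
    then show False using layer_disj[OF l xy(1)] xy(2) by (metis n_not_Suc_n)
  qed
qed

text \<open>\<open>regular Y V\<close>: \<open>V\<close> is clopen in \<open>\<Union>Y\<close>. \<open>big q V\<close>, for the top points \<open>q i\<close> of the \<open>Y i\<close>:
  the top point of \<open>X\<close> has maximal rank in the closure of \<open>V\<close>.\<close>

definition regular :: "(nat \<Rightarrow> 'a set) \<Rightarrow> 'a set \<Rightarrow> bool" where
  "regular Y V \<longleftrightarrow> V \<subseteq> (\<Union>i. Y i) \<and> (\<forall>i. V \<inter> Y i \<in> C)"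

definition big :: "(nat \<Rightarrow> 'a) \<Rightarrow> 'a set \<Rightarrow> bool" where
  "big q V \<longleftrightarrow> infinite {i. q i \<in> V}"

text \<open>Being compact, \<open>U\<close> meets only finitely many \<open>Y i\<close>, so its
  trace on \<open>V\<close> is a finite union of members of \<open>C\<close>.\<close>

lemma regular_Int:
  assumes l: "layer p X Y" and V: "regular Y V" and U: "U \<in> C" "U \<subseteq> (\<Union>i. Y i)"
  shows "U \<inter> V \<in> C"
proof -
  have "U \<inter> V = (\<Union>i\<in>{i. U \<inter> Y i \<noteq> {}}. U \<inter> (V \<inter> Y i))" using U by blast
  moreover have "\<dots> \<in> C" using layer_finite[OF l U]
    by (rule UN_C) (use V U Int_C in \<open>auto simp: regular_def\<close>)
  ultimately show ?thesis by simp
qed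

text \<open>A \<open>P k\<close> may spread over infinitely many \<open>Y i\<close>. It is enough
  that each \<open>Y i\<close> meets finitely many \<open>P k\<close>, because a compact set meets
  finitely many \<open>Y i\<close>.\<close>

lemma locally_finite_layer:
  assumes l: "layer p X Y" and d: "disjoint_family P" and r: "\<And>k. regular Y (P k)"
    and fin: "\<And>i. finite {k. P k \<inter> Y i \<noteq> {}}"
  shows "locally_finite P"
  unfolding locally_finite_def
proof (intro conjI ballI impI allI)
  fix U assume U: "U \<in> C" "U \<subseteq> (\<Union>k. P k)"
  then have UY: "U \<subseteq> (\<Union>i. Y i)" using r unfolding regular_def by blast
  show "U \<inter> P i \<in> C" for i using regular_Int[OF l r U(1) UY] .
  have "{k. U \<inter> P k \<noteq> {}} \<subseteq> (\<Union>i\<in>{i. U \<inter> Y i \<noteq> {}}. {k. P k \<inter> Y i \<noteq> {}})" using UY by blast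
  then show "finite {k. U \<inter> P k \<noteq> {}}" using layer_finite[OF l U(1) UY] fin
    by (meson finite_UN_I finite_subset)
qed (use d in simp)

lemma regular_Y: "layer p X Y \<Longrightarrow> regular Y (Y i)"
  using layer_Y(1)[of p X Y] layer_Y(1) Int_C by (auto simp: regular_def)

lemma locally_finite_Y: assumes "layer p X Y" shows "locally_finite Y"
proof (rule locally_finite_layer[OF assms])
  show "disjoint_family Y" using assms by (simp add: layer_def)
  show "finite {k. Y k \<inter> Y i \<noteq> {}}" for i
  proof -
    have "{k. Y k \<inter> Y i \<noteq> {}} \<subseteq> {i}" using layer_disj[OF assms] by auto
    then show ?thesis by (meson finite.emptyI finite.insertI finite_subset)
  qed
qed (use assms regular_Y in blast)

text \<open>A piece \<open>W\<close> missing its top point is absorbed by \<open>Y'\<close>: a copy of \<open>W\<close> can be removed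
  from \<open>Y'\<close> without changing its type.\<close>

lemma absorb:
  assumes A: "\<And>p X p' X' U. omega_power n p X \<Longrightarrow> omega_power n p' X' \<Longrightarrow> U \<subseteq> X \<Longrightarrow> U \<in> C \<Longrightarrow>
        p \<in> U \<Longrightarrow> \<exists>f. homeo U X' f"
    and Y: "omega_power n q Y" "U \<subseteq> Y" "q \<in> U" "U \<in> C"
    and Y2: "omega_power n q2 Y2" "W \<subseteq> Y2" "q2 \<notin> W" "W \<in> C" and d: "U \<inter> W = {}"
    and Y': "omega_power n q' Y'"
  shows "\<exists>f. homeo (U \<union> W) Y' f"
proof -
  obtain g where g: "homeo Y2 Y' g"
    using A[OF Y2(1) Y', of Y2] omega_power_C[OF Y2(1)] omega_power_top[OF Y2(1)] by auto
  have gW: "g ` W \<in> C" "g ` W \<subseteq> Y'" using homeo_C[OF g Y2(2)] Y2 homeo_image[OF g] by auto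
  \<comment> \<open>\<open>Y2 - W\<close> is a clopen neighbourhood of the top of \<open>Y2\<close>,
    so its image contains the top \<open>q'\<close>, and the copy of \<open>W\<close> under
    \<open>g\<close> misses it.\<close>
  have "q' \<in> g ` (Y2 - W)"
  proof (rule top_invariant[OF Y2(1) Y'])
    show *: "Y2 - W \<subseteq> Y2" "Y2 - W \<in> C" "q2 \<in> Y2 - W"
      using Y2 omega_power_top omega_power_C Diff_C by auto
    show "homeo (Y2 - W) (g ` (Y2 - W)) g" using homeo_restrict[OF g *(1)] .
    show "g ` (Y2 - W) \<in> C" using homeo_C[OF g *(1)] * by blast
    show "g ` (Y2 - W) \<subseteq> Y'" using homeo_image[OF g] by auto
  qed
  moreover have "g ` (Y2 - W) \<inter> g ` W = {}"
    using homeo_bij[OF g] Y2(2) by (auto simp: bij_betw_def inj_on_def)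
  ultimately have q': "q' \<in> Y' - g ` W" using omega_power_top[OF Y'] by blast
  have C': "Y' - g ` W \<in> C" using gW omega_power_C[OF Y'] Diff_C by blast
  obtain f1 where f1: "homeo U Y' f1" using A[OF Y(1) Y' Y(2,4,3)] by blast
  obtain f2 where f2: "homeo (Y' - g ` W) Y' f2" using A[OF Y' Y' _ C' q'] by blast
  \<comment> \<open>\<open>U\<close> is mapped onto \<open>Y'\<close> without the copy of
    \<open>W\<close>, a set that still has the type of all of \<open>Y'\<close>; the gap is then
    filled by \<open>W\<close>.\<close>
  have f3: "homeo U (Y' - g ` W) (inv_into (Y' - g ` W) f2 \<circ> f1)"
    using homeo_comp[OF f1 homeo_inv[OF f2]] .
  obtain h where "homeo (U \<union> W) ((Y' - g ` W) \<union> g ` W) h"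
    by (rule homeo_glue2[OF f3 homeo_restrict[OF g Y2(2)] d])
       (use C' Y Int_C in auto)
  moreover have "(Y' - g ` W) \<union> g ` W = Y'" using gW by auto
  ultimately show ?thesis by auto
qed

section \<open>Homeomorphism types of clopen sets with infinitely many top points\<close>

text \<open>\<open>A\<close> is the rank \<open>n\<close> case of \<open>top_nbhd_homeo\<close>,
  passed as a hypothesis because the next case of that lemma is derived from this one.
  \<open>V\<close> is recut into sets \<open>P k\<close>, each made of one trace containing a top
  point and one possibly empty trace lacking it. By \<open>absorb\<close>, \<open>P k\<close> is a
  copy of \<open>Y' k\<close>, and the copies are glued.\<close>

lemma big_homeo_step:
  assumes A: "\<And>p X p' X' U. omega_power n p X \<Longrightarrow> omega_power n p' X' \<Longrightarrow> U \<subseteq> X \<Longrightarrow> U \<in> C \<Longrightarrow>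
        p \<in> U \<Longrightarrow> \<exists>f. homeo U X' f"
    and l: "layer p X Y" and Y: "\<And>i. omega_power n (q i) (Y i)"
    and l': "layer p' X' Y'" and Y': "\<And>i. omega_power n (q' i) (Y' i)"
    and V: "regular Y V" "big q V"
  shows "\<exists>f. homeo V (\<Union>i. Y' i) f"
proof -
  define I where "I = {i. q i \<in> V}"
  define e where "e = enumerate I"
  have I: "infinite I" using V(2) by (simp add: big_def I_def)
  have e: "e k \<in> I" for k unfolding e_def using I by (rule enumerate_in_set)
  have einj: "inj e" unfolding e_def using I strict_mono_enumerate strict_mono_imp_inj_on by blast
  have erange: "range e = I" unfolding e_def using I range_enumerate by blast
  define W where "W k = (if k \<in> I then {} else V \<inter> Y k)" for k
  \<comment> \<open>The \<open>k\<close>-th trace with a top point is paired with the leftover at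
    index \<open>k\<close> itself. So \<open>Y i\<close> meets \<open>P k\<close> only if
    \<open>k = i\<close> or \<open>e k = i\<close>, which gives local finiteness.\<close>
  define P where "P k = (V \<inter> Y (e k)) \<union> W k" for k
  have VC: "V \<inter> Y i \<in> C" for i using V(1) by (simp add: regular_def)
  have WC: "W k \<in> C" for k using VC by (simp add: W_def)
  have disj: "V \<inter> Y (e k) \<inter> W k' = {}" for k k'
    using layer_disj[OF l] e[of k] by (auto simp: W_def)
  have PY: "x \<in> Y i \<Longrightarrow> x \<in> P k \<longleftrightarrow> x \<in> V \<and> (if i \<in> I then i = e k else i = k)" for x i k
    using layer_disj[OF l] e[of k] by (auto simp: P_def W_def split: if_splits)
  have "\<exists>f. homeo (P k) (Y' k) f" for k unfolding P_def
  proof (rule absorb[OF A Y _ _ _ Y _ _ _ disj Y'])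
    have "q (e k) \<in> V" using e by (simp add: I_def)
    then show "q (e k) \<in> V \<inter> Y (e k)" using omega_power_top[OF Y] by auto
    show "W k \<subseteq> Y k" "q k \<notin> W k" by (auto simp: W_def I_def)
  qed (use VC WC in auto)
  then obtain f where f: "\<And>k. homeo (P k) (Y' k) (f k)" by metis
  have PL: "P k \<subseteq> (\<Union>i. Y i)" for k by (auto simp: P_def W_def split: if_splits)
  have "locally_finite P"
  proof (rule locally_finite_layer[OF l])
    show "disjoint_family P"
      unfolding disjoint_family_on_def
    proof (intro ballI impI)
      fix m k :: nat assume "m \<noteq> k"
      have False if x: "x \<in> P m" "x \<in> P k" for x
      proof -
        obtain i where "x \<in> Y i" using PL[of m] x(1) by blast
        then have "if i \<in> I then e m = e k else m = k" using PY[of x i] x by (auto split: if_splits)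
        then show False using \<open>m \<noteq> k\<close> injD[OF einj, of m k] by (auto split: if_splits)
      qed
      then show "P m \<inter> P k = {}" by blast
    qed
    show "regular Y (P k)" for k
    proof -
      have "P k \<inter> Y i = (if (if i \<in> I then i = e k else i = k) then V \<inter> Y i else {})" for i
        using PY[of _ i k] by auto
      then show ?thesis using PL VC by (simp add: regular_def)
    qed
    show "finite {k. P k \<inter> Y i \<noteq> {}}" for i
    proof -
      have "{k. P k \<inter> Y i \<noteq> {}} \<subseteq> {i} \<union> {k. e k = i}" using PY[of _ i] by (auto split: if_splits)
      moreover have "finite {k. e k = i}"
        using einj finite_vimageI[of "{i}" e] by (simp add: vimage_def)
      ultimately show ?thesis by (meson finite.emptyI finite.insertI finite_UnI finite_subset)
    qed
  qed
  then obtain g where "homeo (\<Union>k. P k) (\<Union>k. Y' k) g"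
    using homeo_glue[OF _ locally_finite_Y[OF l'] f] by blast
  moreover have "(\<Union>k. P k) = V"
  proof
    show "V \<subseteq> (\<Union>k. P k)"
    proof
      fix x assume x: "x \<in> V"
      then obtain i where i: "x \<in> Y i" using V(1) by (auto simp: regular_def)
      have "\<exists>k. if i \<in> I then i = e k else i = k" using erange by auto
      then show "x \<in> (\<Union>k. P k)" using PY[OF i] x by auto
    qed
  qed (auto simp: P_def W_def split: if_splits)
  ultimately show ?thesis by auto
qed

lemma layer_C_compl:
  assumes l: "layer p X Y" and U: "U \<subseteq> X" "p \<in> U"
  shows "U \<in> C \<longleftrightarrow> X - U \<in> C"
  using Diff_C[of X U] Diff_C[of X "X - U"] layer_X[OF l] U by (auto simp: double_diff)

text \<open>Only sets containing \<open>p\<close> need care: such a set is in \<open>C\<close> iff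
  its complement in \<open>U\<close> is, and that complement avoids \<open>p\<close>, so
  \<open>f\<close> applies to it.\<close>

lemma homeo_extend_top:
  assumes l: "layer p X Y" and l': "layer p' X' Y'" and U: "U \<subseteq> X" "U \<in> C" "p \<in> U"
    and f: "homeo (U - {p}) (X' - {p'}) f"
  shows "\<exists>g. homeo U X' g"
proof -
  define g where "g x = (if x = p then p' else f x)" for x
  have gf: "g ` A = f ` A" if "A \<subseteq> U - {p}" for A using that by (auto simp: g_def intro!: image_cong)
  have b: "bij_betw g U X'"
  proof -
    have "bij_betw g ({p} \<union> (U - {p})) ({p'} \<union> (X' - {p'}))"
    proof (rule bij_betw_combine)
      show "bij_betw g (U - {p}) (X' - {p'})"
        by (rule iffD2[OF bij_betw_cong homeo_bij[OF f]]) (auto simp: g_def)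
    qed (auto simp: g_def)
    moreover have "{p} \<union> (U - {p}) = U" "{p'} \<union> (X' - {p'}) = X'" using U layer_p[OF l'] by auto
    ultimately show ?thesis by simp
  qed
  have "A \<in> C \<longleftrightarrow> g ` A \<in> C" if A: "A \<subseteq> U" for A
  proof (cases "p \<in> A")
    case False
    then have "A \<subseteq> U - {p}" using A by auto
    then show ?thesis using gf homeo_C[OF f] by simp
  next
    case True
    have sub: "U - A \<subseteq> U - {p}" using True by auto
    have "A \<in> C \<longleftrightarrow> U - A \<in> C" using Diff_C[of U A] Diff_C[of U "U - A"] U A by (auto simp: double_diff)
    also have "\<dots> \<longleftrightarrow> g ` (U - A) \<in> C" using gf[OF sub] homeo_C[OF f sub] by simp
    also have "g ` (U - A) = X' - g ` A"
      using b A by (auto simp: bij_betw_def inj_on_def)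
    also have "\<dots> \<in> C \<longleftrightarrow> g ` A \<in> C"
    proof (rule layer_C_compl[OF l', symmetric])
      show "g ` A \<subseteq> X'" using b A by (auto simp: bij_betw_def)
      show "p' \<in> g ` A" using True by (auto simp: g_def image_iff)
    qed
    finally show ?thesis .
  qed
  then show ?thesis using b by (auto simp: homeo_def)
qed

text \<open>A clopen neighbourhood of the top contains all but finitely many pieces, hence
  infinitely many of their tops. So \<open>U - {p}\<close> is a copy of the whole union, and the top
  is added back. With \<open>U = X\<close>, the rank determines the space.\<close>

lemma top_nbhd_homeo:
  "omega_power n p X \<Longrightarrow> omega_power n p' X' \<Longrightarrow> U \<subseteq> X \<Longrightarrow> U \<in> C \<Longrightarrow> p \<in> U \<Longrightarrow> \<exists>f. homeo U X' f"
proof (induction n arbitrary: p X p' X' U)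
  case 0
  then have "U = {p}" "X' = {p'}" by auto
  then have "homeo U X' (\<lambda>_. p')" using 0 by (auto simp: homeo_def bij_betw_def subset_singleton_iff)
  then show ?case by blast
next
  case (Suc n)
  obtain Y q where l: "layer p X Y" and Y: "\<And>i. omega_power n (q i) (Y i)" using Suc.prems(1) by auto
  obtain Y' q' where l': "layer p' X' Y'" and Y': "\<And>i. omega_power n (q' i) (Y' i)"
    using Suc.prems(2) by auto
  have "\<exists>f. homeo (U - {p}) (\<Union>i. Y' i) f"
  proof (rule big_homeo_step[OF Suc.IH l Y l' Y'])
    have "(U - {p}) \<inter> Y i = U \<inter> Y i" for i using layer_Y(3)[OF l] by auto
    then show "regular Y (U - {p})"
      using layer_eq[OF l] Suc.prems layer_Y(1)[OF l] Int_C by (auto simp: regular_def)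
    obtain k where k: "\<And>i. i \<ge> k \<Longrightarrow> Y i \<subseteq> U" using layer_tail[OF l] Suc.prems by blast
    have "{k..} \<subseteq> {i. q i \<in> U - {p}}"
    proof
      fix i assume "i \<in> {k..}"
      then show "i \<in> {i. q i \<in> U - {p}}"
        using k[of i] omega_power_top[OF Y, of i] layer_Y(3)[OF l, of i] by auto
    qed
    then show "big q (U - {p})" unfolding big_def using infinite_Ici infinite_super by blast
  qed
  then show ?case using homeo_extend_top[OF l l' Suc.prems(3,4,5)] layer_eq[OF l'] by auto
qed

end

section \<open>Subgroups of small index\<close>

definition perm_group :: "('a \<Rightarrow> 'a) set \<Rightarrow> bool" where
  "perm_group H \<longleftrightarrow> id \<in> H \<and> (\<forall>f\<in>H. bij f \<and> finv f \<in> H) \<and> (\<forall>f\<in>H. \<forall>g\<in>H. f \<circ> g \<in> H)"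

text \<open>This follows from \<open>H\<close> having fewer than continuum many cosets in \<open>A\<close>, and it is
  inherited by subgroups of \<open>A\<close>.\<close>

definition small_index :: "('a \<Rightarrow> 'a) set \<Rightarrow> ('a \<Rightarrow> 'a) set \<Rightarrow> bool" where
  "small_index H A \<longleftrightarrow> (\<forall>F :: nat set \<Rightarrow> 'a \<Rightarrow> 'a. (\<forall>S. F S \<in> A) \<longrightarrow>
     (\<exists>S T h. S \<noteq> T \<and> h \<in> H \<and> F T = F S \<circ> h))"

lemma perm_group_cancel:
  assumes "perm_group H" "k \<in> H" "bij k" "k \<circ> g \<in> H" shows "g \<in> H"
proof -
  have "finv k \<circ> (k \<circ> g) \<in> H" using assms by (simp add: perm_group_def)
  moreover have "finv k \<circ> (k \<circ> g) = g" using assms(3) by (simp add: fun_eq_iff bij_is_inj)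
  ultimately show ?thesis by simp
qed

text \<open>The set is the conjugate \<open>g H g^-1\<close>, expressed through membership in
  \<open>H\<close>.\<close>

lemma perm_group_conj:
  fixes g :: "'a \<Rightarrow> 'a"
  assumes H: "perm_group H" and g: "bij g"
  shows "perm_group {f. bij f \<and> finv g \<circ> f \<circ> g \<in> H}"
proof -
  have gg: "g (finv g x) = x" "finv g (g x) = x" for x
    using g by (simp_all add: bij_is_surj surj_f_inv_f bij_is_inj)
  have "finv g \<circ> id \<circ> g = id" using gg by (simp add: fun_eq_iff)
  moreover have "finv g \<circ> finv f \<circ> g \<in> H" if f: "bij f" "finv g \<circ> f \<circ> g \<in> H" for f
  proof -
    have "finv g \<circ> finv f \<circ> g = finv (finv g \<circ> f \<circ> g)"
    proof (rule inv_unique_comp[symmetric])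
      show "finv g \<circ> f \<circ> g \<circ> (finv g \<circ> finv f \<circ> g) = id"
        using gg f(1) by (simp add: fun_eq_iff bij_is_surj surj_f_inv_f)
      show "finv g \<circ> finv f \<circ> g \<circ> (finv g \<circ> f \<circ> g) = id"
        using gg f(1) by (simp add: fun_eq_iff bij_is_inj)
    qed
    then show ?thesis using H f(2) by (simp add: perm_group_def)
  qed
  moreover have "finv g \<circ> (f \<circ> f') \<circ> g \<in> H" if "finv g \<circ> f \<circ> g \<in> H" "finv g \<circ> f' \<circ> g \<in> H" for f f'
  proof -
    have "finv g \<circ> (f \<circ> f') \<circ> g = (finv g \<circ> f \<circ> g) \<circ> (finv g \<circ> f' \<circ> g)" using gg by (simp add: fun_eq_iff)
    then show ?thesis using H that by (simp add: perm_group_def)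
  qed
  ultimately show ?thesis using H by (simp add: perm_group_def bij_imp_bij_inv bij_comp)
qed

lemma small_indexD:
  fixes F :: "nat set \<Rightarrow> 'a \<Rightarrow> 'a"
  assumes "small_index H A" "\<And>S. F S \<in> A"
  obtains S T h where "S \<noteq> T" "h \<in> H" "F T = F S \<circ> h"
proof -
  have "\<exists>S T h. S \<noteq> T \<and> h \<in> H \<and> F T = F S \<circ> h"
    using assms(1)[unfolded small_index_def, rule_format, of F] assms(2) by simp
  then show thesis by (elim exE conjE) (rule that)
qed

section \<open>Combinatorics of infinite sets of natural numbers\<close>

text \<open>The pairing function gives infinitely many disjoint infinite rows, which are transported
  along the enumeration of \<open>I\<close>. The index type stays open because a grid, the integers
  and a pair are all needed.\<close>

lemma infinite_split:
  fixes I :: "nat set"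
  assumes "infinite I"
  obtains J :: "'j::countable \<Rightarrow> nat set"
  where "disjoint_family J" "\<And>j. infinite (J j)" "\<And>j. J j \<subseteq> I"
proof
  define c where "c j l = enumerate I (prod_encode (to_nat (j::'j), l))" for j l
  have inj: "c j l = c j' l' \<longleftrightarrow> j = j' \<and> l = l'" for j l j' l'
    using strict_mono_imp_inj_on[OF strict_mono_enumerate[OF assms]]
    by (auto simp: c_def inj_eq)
  show "disjoint_family (\<lambda>j. range (c j))" using inj by (auto simp: disjoint_family_on_def)
  show "infinite (range (c j))" for j using inj by (intro range_inj_infinite) (auto simp: inj_def)
  show "range (c j) \<subseteq> I" for j using enumerate_in_set[OF assms] by (auto simp: c_def)
qed

text \<open>These are the branches of the binary tree: \<open>D S\<close> consists of codes of the
  initial segments of \<open>S\<close>, and distinct sets share only the segments that do not reach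
  a point where they differ. Doubling the codes keeps the odd numbers out of every
  \<open>D S\<close>.\<close>

lemma almost_disjoint_family:
  obtains D :: "nat set \<Rightarrow> nat set"
  where "\<And>S. infinite (D S)" "\<And>S T. S \<noteq> T \<Longrightarrow> finite (D S \<inter> D T)" "\<And>S. D S \<subseteq> Collect even"
proof
  define c where "c S m = 2 * prod_encode (m, set_encode (S \<inter> {..<m}))" for S m
  have c: "c S m = c T m' \<longleftrightarrow> m = m' \<and> S \<inter> {..<m} = T \<inter> {..<m}" for S T m m'
    by (auto simp: c_def set_encode_eq)
  show "infinite (range (c S))" for S using c by (intro range_inj_infinite) (auto simp: inj_def)
  show "range (c S) \<subseteq> Collect even" for S by (auto simp: c_def)
  show "finite (range (c S) \<inter> range (c T))" if "S \<noteq> T" for S T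
  proof -
    obtain k where k: "k \<in> S \<longleftrightarrow> k \<notin> T" using \<open>S \<noteq> T\<close> by blast
    have "range (c S) \<inter> range (c T) \<subseteq> c S ` {..k}"
    proof
      fix x assume "x \<in> range (c S) \<inter> range (c T)"
      then obtain m m' where m: "x = c S m" "x = c T m'" by (metis IntE imageE)
      then have "S \<inter> {..<m} = T \<inter> {..<m}" using c[of S m T m'] by metis
      then have "\<not> k < m" using k by blast
      then show "x \<in> c S ` {..k}" using m by auto
    qed
    then show ?thesis using finite_subset by blast
  qed
qed

section \<open>Unions of pieces and homeomorphisms between them\<close>

locale omega_layer = set_ring C for C :: "'a set set" +
  fixes n :: nat and p :: 'a and X :: "'a set" and Y :: "nat \<Rightarrow> 'a set" and q :: "nat \<Rightarrow> 'a"
  assumes layer: "layer p X Y" and Y: "\<And>i. omega_power n (q i) (Y i)"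
begin

definition part :: "nat set \<Rightarrow> 'a set" where
  "part I = (\<Union>i\<in>I. Y i)"

abbreviation "L \<equiv> part UNIV"

lemma part_mem: "x \<in> Y i \<Longrightarrow> x \<in> part I \<longleftrightarrow> i \<in> I"
  using layer_disj[OF layer] by (auto simp: part_def)

lemma partE: assumes "x \<in> part I" obtains i where "i \<in> I" "x \<in> Y i"
  using assms by (auto simp: part_def)

lemma part_mono: "I \<subseteq> J \<Longrightarrow> part I \<subseteq> part J"
  and part_Un: "part (I \<union> J) = part I \<union> part J"
  and part_UN: "part (\<Union>k\<in>K. R k) = (\<Union>k\<in>K. part (R k))"
  by (auto simp: part_def)

lemma part_Diff: "part (I - J) = part I - part J"
  using layer_disj[OF layer] by (auto simp: part_def)

lemma part_disj:
  assumes "I \<inter> J = {}" shows "part I \<inter> part J = {}"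
proof -
  have "I \<subseteq> - J" using assms by blast
  then have "part I \<subseteq> part (UNIV - J)" by (simp add: part_mono Compl_eq_Diff_UNIV)
  then show ?thesis unfolding part_Diff by blast
qed

lemma regular_part: "regular Y (part I)"
proof -
  have "part I \<inter> Y i = (if i \<in> I then Y i else {})" for i using part_mem by auto
  then show ?thesis using layer_Y(1)[OF layer] by (auto simp: regular_def part_def)
qed

lemma big_part:
  assumes "infinite I" shows "big q (part I)"
proof -
  have "q i \<in> part I \<longleftrightarrow> i \<in> I" for i using part_mem[OF omega_power_top[OF Y]] .
  then show ?thesis unfolding big_def using assms by simp
qed

lemma big_mono:
  assumes "big q V" "V \<subseteq> W" shows "big q W"
proof -
  have "{i. q i \<in> V} \<subseteq> {i. q i \<in> W}" using assms(2) by blast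
  then show ?thesis using assms(1) infinite_super unfolding big_def by blast
qed

lemma big_Un: "big q (V \<union> W) \<Longrightarrow> big q V \<or> big q W"
  unfolding big_def by (auto simp: Collect_disj_eq)

lemma regular_sub: "regular Y V \<Longrightarrow> V \<subseteq> L"
  by (simp add: regular_def part_def)

lemma regular_C: "regular Y V \<Longrightarrow> U \<in> C \<Longrightarrow> U \<subseteq> L \<Longrightarrow> U \<inter> V \<in> C"
  using regular_Int[OF layer] by (simp add: part_def)

lemma regular_Diff: "regular Y V \<Longrightarrow> regular Y W \<Longrightarrow> regular Y (V - W)"
  and regular_inter: "regular Y V \<Longrightarrow> regular Y W \<Longrightarrow> regular Y (V \<inter> W)"
proof -
  assume V: "regular Y V" and W: "regular Y W"
  have "(V - W) \<inter> Y i = (V \<inter> Y i) - (W \<inter> Y i)" "V \<inter> W \<inter> Y i = (V \<inter> Y i) \<inter> (W \<inter> Y i)" for i by auto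
  then show "regular Y (V - W)" "regular Y (V \<inter> W)"
    using V W Diff_C Int_C by (auto simp: regular_def)
qed

text \<open>Regularity refers to traces on the \<open>Y i\<close>, which \<open>f\<close> need not
  respect. The trace of \<open>W\<close> on \<open>Y i\<close> is pulled back to a compact open
  subset of \<open>V\<close>, cut with \<open>N\<close> and pushed forward again.\<close>

lemma homeo_regular:
  assumes f: "homeo V W f" and V: "regular Y V" and W: "regular Y W" and N: "regular Y N" "N \<subseteq> V"
  shows "regular Y (f ` N)"
  unfolding regular_def
proof (intro conjI allI)
  have fN: "f ` N \<subseteq> W" using N homeo_image[OF f] by auto
  then show "f ` N \<subseteq> (\<Union>i. Y i)" using W by (auto simp: regular_def)
  fix i
  define A where "A = {x\<in>V. f x \<in> Y i}"
  have "f ` A = W \<inter> Y i" using homeo_image[OF f] by (auto simp: A_def)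
  then have "f ` A \<in> C" using W by (simp add: regular_def)
  moreover have A: "A \<subseteq> V" by (auto simp: A_def)
  ultimately have "A \<in> C" using homeo_C[OF f] by blast
  then have "A \<inter> N \<in> C" using regular_C[OF N(1)] A regular_sub[OF V] by blast
  then have "f ` (A \<inter> N) \<in> C" using homeo_C[OF f, of "A \<inter> N"] A by blast
  moreover have "f ` N \<inter> Y i = f ` (A \<inter> N)" using N by (auto simp: A_def)
  ultimately show "f ` N \<inter> Y i \<in> C" by simp
qed

lemma Aut_regular: "g \<in> Aut L \<Longrightarrow> regular Y V \<Longrightarrow> regular Y (g ` V)"
  using homeo_regular[OF Aut_homeo regular_part regular_part] regular_sub by blast

lemma Aut_extend: "f \<in> Aut V \<Longrightarrow> V \<subseteq> W \<Longrightarrow> regular Y V \<Longrightarrow> regular Y W \<Longrightarrow> f \<in> Aut W"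
  by (rule Aut_mono) (use regular_C regular_sub in blast)+

lemma Aut_part_mono: "f \<in> Aut (part I) \<Longrightarrow> I \<subseteq> J \<Longrightarrow> f \<in> Aut (part J)"
  using Aut_extend part_mono regular_part by blast

lemma Aut_restrict:
  "f \<in> Aut W \<Longrightarrow> V \<subseteq> W \<Longrightarrow> (\<And>x. x \<in> W \<Longrightarrow> x \<notin> V \<Longrightarrow> f x = x) \<Longrightarrow> f \<in> Aut V"
  unfolding Aut_def by blast

text \<open>If \<open>g (q i)\<close> were another point of \<open>Y j\<close>, some clopen
  \<open>W\<close> around it would miss \<open>q j\<close>. The preimage of \<open>W\<close>, cut
  with \<open>Y i\<close>, is a neighbourhood of \<open>q i\<close>, and
  \<open>top_invariant\<close> puts \<open>q j\<close> into its image, hence into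
  \<open>W\<close>.\<close>

lemma Aut_tops:
  assumes g: "g \<in> Aut L" shows "\<exists>j. g (q i) = q j"
proof -
  have qi: "q i \<in> Y i" using omega_power_top[OF Y] .
  then have "g (q i) \<in> L" using Aut_mem[OF g] by (auto simp: part_def)
  then obtain j where j: "g (q i) \<in> Y j" by (auto simp: part_def)
  have "g (q i) = q j"
  proof (rule ccontr)
    assume "g (q i) \<noteq> q j"
    then obtain W where W: "W \<in> C" "W \<subseteq> Y j" "g (q i) \<in> W" "q j \<notin> W"
      using omega_power_separated[OF Y j omega_power_top[OF Y]] by blast
    define A where "A = {x\<in>L. g x \<in> W}"
    have WL: "W \<subseteq> L" using W(2) by (auto simp: part_def)
    have AL: "A \<subseteq> L" by (auto simp: A_def)
    have gA: "g ` A = W"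
    proof
      show "W \<subseteq> g ` A"
      proof
        fix w assume w: "w \<in> W"
        then have "w \<in> g ` L" using Aut_image[OF g] WL by blast
        then show "w \<in> g ` A" using w by (auto simp: A_def)
      qed
    qed (auto simp: A_def)
    have "A \<in> C" using Aut_C[OF g AL] gA W(1) by simp
    then have AYC: "A \<inter> Y i \<in> C" using Int_C layer_Y(1)[OF layer] by blast
    have sub: "A \<inter> Y i \<subseteq> L" using AL by auto
    have "q i \<in> A \<inter> Y i" using qi W(3) by (auto simp: A_def part_def)
    moreover have "g ` (A \<inter> Y i) \<in> C" using AYC Aut_C[OF g sub] by simp
    ultimately have "q j \<in> g ` (A \<inter> Y i)"
      using top_invariant[OF Y Y _ AYC _ homeo_restrict[OF Aut_homeo[OF g] sub], of i j] gA W(2) by blast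
    then show False using gA W(4) by blast
  qed
  then show ?thesis by blast
qed

lemma Aut_big:
  assumes g: "g \<in> Aut L" and V: "big q V" shows "big q (g ` V)"
proof -
  obtain t where t: "\<And>i. g (q i) = q (t i)" using Aut_tops[OF g] by metis
  have qinj: "q i = q j \<Longrightarrow> i = j" for i j
    using layer_disj[OF layer, of "q i" i j] omega_power_top[OF Y] by metis
  have "inj t" using Aut_inj[OF g] t qinj by (metis injI)
  then have "infinite (t ` {i. q i \<in> V})" using V by (simp add: big_def finite_image_iff inj_on_subset)
  moreover have "t ` {i. q i \<in> V} \<subseteq> {i. q i \<in> g ` V}" by (auto simp: t[symmetric])
  ultimately show ?thesis unfolding big_def using infinite_super by blast
qed

text \<open>Both sets are copies of the whole union, by \<open>big_homeo_step\<close> from the space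
  to itself.\<close>

lemma homeo_big:
  assumes "regular Y V" "big q V" "regular Y W" "big q W"
  obtains f where "homeo V W f"
proof -
  have *: "\<exists>f. homeo U (\<Union>i. Y i) f" if "regular Y U" "big q U" for U
    by (rule big_homeo_step[OF top_nbhd_homeo layer Y layer Y that])
  obtain f g where "homeo V (\<Union>i. Y i) f" "homeo W (\<Union>i. Y i) g"
    using *[OF assms(1,2)] *[OF assms(3,4)] by blast
  then show thesis using that homeo_comp homeo_inv by blast
qed

lemma Aut_glue:
  assumes f: "homeo V W f" "homeo (U - V) (U - W) g" and r: "regular Y V" "regular Y W" "regular Y U"
    and sub: "V \<subseteq> U" "W \<subseteq> U"
  obtains h where "h \<in> Aut U" "\<And>x. x \<in> V \<Longrightarrow> h x = f x" "\<And>x. x \<in> U - V \<Longrightarrow> h x = g x"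
proof -
  have UL: "U \<subseteq> L" using regular_sub r by blast
  have eq: "V \<union> (U - V) = U" "W \<union> (U - W) = U" using sub by auto
  have rC: "A \<inter> V \<in> C" "A \<inter> W \<in> C" if "A \<in> C" "A \<subseteq> U" for A
    using that regular_C[OF r(1)] regular_C[OF r(2)] UL by auto
  obtain h where "homeo (V \<union> (U - V)) (W \<union> (U - W)) h"
      and h: "\<And>x. x \<in> V \<Longrightarrow> h x = f x" "\<And>x. x \<in> U - V \<Longrightarrow> h x = g x"
    using homeo_glue2[OF f Diff_disjoint Diff_disjoint] rC unfolding eq by metis
  then have "homeo U U h" unfolding eq by blast
  then have "(\<lambda>x. if x \<in> U then h x else x) \<in> Aut U" by (rule homeo_Aut)
  then show thesis by (rule that) (use h sub in auto)
qed

lemma locally_finite_part: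
  assumes "disjoint_family R" shows "locally_finite (\<lambda>j. part (R j))"
proof (rule locally_finite_layer[OF layer])
  show "disjoint_family (\<lambda>j. part (R j))"
    using assms part_disj by (auto simp: disjoint_family_on_def)
  show "finite {k. part (R k) \<inter> Y i \<noteq> {}}" for i
  proof -
    have *: "{k. part (R k) \<inter> Y i \<noteq> {}} \<subseteq> {k. i \<in> R k}" using part_mem by blast
    have "{k. i \<in> R k} \<subseteq> {SOME k. i \<in> R k}"
    proof
      fix k assume "k \<in> {k. i \<in> R k}"
      then have "i \<in> R k" "i \<in> R (SOME k. i \<in> R k)" by (auto intro: someI)
      then show "k \<in> {SOME k. i \<in> R k}" using assms by (auto simp: disjoint_family_on_def)
    qed
    then show ?thesis using * by (meson finite.emptyI finite.insertI finite_subset)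
  qed
qed (rule regular_part)

lemma Aut_family:
  assumes d: "disjoint_family R" and d': "disjoint_family R'" and U: "(\<Union>j. R j) = (\<Union>j. R' j)"
    and f: "\<And>j. homeo (part (R j)) (part (R' j)) (f j)"
  obtains g where "g \<in> Aut (part (\<Union>j. R j))" "\<And>j x. x \<in> part (R j) \<Longrightarrow> g x = f j x"
proof -
  obtain g where "homeo (\<Union>j. part (R j)) (\<Union>j. part (R' j)) g"
    and g: "\<And>j x. x \<in> part (R j) \<Longrightarrow> g x = f j x"
    using homeo_glue[OF locally_finite_part[OF d] locally_finite_part[OF d'] f] by blast
  then have "homeo (part (\<Union>j. R j)) (part (\<Union>j. R j)) g" using U by (simp add: part_UN[symmetric])
  then have "(\<lambda>x. if x \<in> part (\<Union>j. R j) then g x else x) \<in> Aut (part (\<Union>j. R j))"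
    by (rule homeo_Aut)
  then show thesis by (rule that) (use g in \<open>auto simp: part_UN\<close>)
qed

text \<open>If the coordinate \<open>k\<close> were bad for every \<open>k\<close>, as witnessed by \<open>a k\<close>, then the products
  of the \<open>a k\<close> over subsets of \<open>\<nat>\<close> would lie in different cosets of \<open>H\<close>.\<close>

lemma full_coordinate:
  fixes R :: "nat \<Rightarrow> nat set"
  assumes H: "perm_group H" and small: "small_index H (Aut L)" and R: "disjoint_family R"
  obtains k where "\<And>a. a \<in> Aut (part (R k)) \<Longrightarrow>
    \<exists>h\<in>H. (\<forall>x\<in>part (R k). h x = a x) \<and> (\<forall>x. x \<notin> part (\<Union>j. R j) \<longrightarrow> h x = x)"
proof (rule ccontr)
  assume "\<not> thesis"
  then have "\<forall>k. \<exists>a. a \<in> Aut (part (R k)) \<and>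
    \<not> (\<exists>h\<in>H. (\<forall>x\<in>part (R k). h x = a x) \<and> (\<forall>x. x \<notin> part (\<Union>j. R j) \<longrightarrow> h x = x))"
    using that by blast
  then obtain a where a: "\<And>k. a k \<in> Aut (part (R k))" and bad: "\<And>k h. h \<in> H \<Longrightarrow>
      (\<And>x. x \<in> part (R k) \<Longrightarrow> h x = a k x) \<Longrightarrow> (\<And>x. x \<notin> part (\<Union>j. R j) \<Longrightarrow> h x = x) \<Longrightarrow> False"
    by metis
  have "\<exists>g. g \<in> Aut (part (\<Union>j. R j)) \<and> (\<forall>k. \<forall>x\<in>part (R k). g x = (if k \<in> S then a k x else x))" for S
  proof -
    have *: "homeo (part (R k)) (part (R k)) (if k \<in> S then a k else (\<lambda>x. x))" for k
      using Aut_homeo[OF a] homeo_id by simp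
    obtain g where "g \<in> Aut (part (\<Union>j. R j))"
      "\<And>k x. x \<in> part (R k) \<Longrightarrow> g x = (if k \<in> S then a k else (\<lambda>x. x)) x"
      by (rule Aut_family[OF R R refl *]) blast
    then show ?thesis by auto
  qed
  then obtain F where F: "\<And>S. F S \<in> Aut (part (\<Union>j. R j))"
    and Fk: "\<And>S k x. x \<in> part (R k) \<Longrightarrow> F S x = (if k \<in> S then a k x else x)" by metis
  \<comment> \<open>\<open>h\<close> is the quotient of \<open>F T\<close> by \<open>F S\<close>. On
    \<open>part (R k)\<close> the map \<open>F S\<close> is the identity and \<open>F T\<close> is
    \<open>a k\<close>, and off the union both are the identity; so \<open>h\<close> is a witness
    that \<open>bad\<close> excludes.\<close>
  have key: False if h: "h \<in> H" "F T = F S \<circ> h" and k: "k \<in> T" "k \<notin> S" for S T h k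
  proof (rule bad[OF h(1), of k])
    have h': "F S (h x) = F T x" for x using h(2) by simp
    show "h x = a k x" if "x \<in> part (R k)" for x
    proof -
      have "a k x \<in> part (R k)" using Aut_mem[OF a] that by blast
      then have "F S (h x) = F S (a k x)" using h' Fk[OF that] Fk[of "a k x" k] k by simp
      then show ?thesis using Aut_inj[OF F] by blast
    qed
    show "h x = x" if "x \<notin> part (\<Union>j. R j)" for x
    proof -
      have "F S (h x) = F S x" using h' Aut_out[OF F that] by simp
      then show ?thesis using Aut_inj[OF F] by blast
    qed
  qed
  have "F S \<in> Aut L" for S using Aut_part_mono[OF F subset_UNIV] .
  then obtain S T h where ST: "S \<noteq> T" "h \<in> H" "F T = F S \<circ> h"
    by (rule small_indexD[OF small])
  \<comment> \<open>The sets may differ only in \<open>S - T\<close>; then the inverse of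
    \<open>h\<close> takes the place of \<open>h\<close>.\<close>
  have "bij h" "finv h \<in> H" using H ST(2) by (auto simp: perm_group_def)
  moreover have "F S = F T \<circ> finv h" using ST(3) \<open>bij h\<close> by (simp add: fun_eq_iff bij_is_surj surj_f_inv_f)
  ultimately show False using key ST by blast
qed

text \<open>With the shift \<open>s\<close> and the product \<open>a\<close> of the conjugates \<open>s\<^sup>k \<circ> g \<circ> s\<^sup>-\<^sup>k\<close>, \<open>k \<ge> 0\<close>,
  \<open>g\<close> is the commutator of \<open>a\<close> and \<open>s\<close>.\<close>

lemma commutator:
  fixes J :: "int \<Rightarrow> nat set"
  assumes d: "disjoint_family J" and inf: "\<And>k. infinite (J k)" and g: "g \<in> Aut (part (J 0))"
  obtains a s where "a \<in> Aut (part (\<Union>k. J k))" "s \<in> Aut (part (\<Union>k. J k))" "a \<circ> s = g \<circ> s \<circ> a"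
proof -
  have d1: "disjoint_family (\<lambda>k. J (k + 1))" using d by (auto simp: disjoint_family_on_def)
  have U1: "(\<Union>k. J k) = (\<Union>k. J (k + 1))"
  proof -
    have "J k \<subseteq> (\<Union>k. J (k + 1))" for k
    proof -
      have "J ((k - 1) + 1) \<subseteq> (\<Union>k. J (k + 1))" by blast
      then show ?thesis by simp
    qed
    then show ?thesis by blast
  qed
  have "\<exists>f. homeo (part (J k)) (part (J (k + 1))) f" for k
    using homeo_big[OF regular_part big_part[OF inf] regular_part big_part[OF inf]] by blast
  then obtain f where f: "\<And>k. homeo (part (J k)) (part (J (k + 1))) (f k)" by metis
  obtain s where s: "s \<in> Aut (part (\<Union>k. J k))" and sf: "\<And>k x. x \<in> part (J k) \<Longrightarrow> s x = f k x"
    using Aut_family[OF d d1 U1 f] by blast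
  have sJ: "s ` part (J k) = part (J (k + 1))" for k
    using homeo_image[OF f[of k]] sf by (auto simp: image_def)
  have inv_s: "finv s ` part (J (k + 1)) = part (J k)" for k
    unfolding sJ[symmetric] using Aut_bij[OF s] by (simp add: image_inv_f_f bij_is_inj)
  \<comment> \<open>\<open>c m\<close> is \<open>g\<close> conjugated by the \<open>m\<close>-th
    power of \<open>s\<close>, hence supported in \<open>part (J (int m))\<close>.\<close>
  define c where "c m = ((\<lambda>b. s \<circ> b \<circ> finv s) ^^ m) g" for m
  have c: "c m \<in> Aut (part (J (int m)))" for m
  proof (induction m)
    case (Suc m)
    have "int (Suc m) = int m + 1" by simp
    then have "c m \<in> Aut (finv s ` part (J (int (Suc m))))" using Suc inv_s by metis
    then have "finv (finv s) \<circ> c m \<circ> finv s \<in> Aut (part (J (int (Suc m))))"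
      by (rule Aut_conj[OF inv_Aut[OF s]]) (rule part_mono, blast)
    then show ?case using Aut_bij[OF s] by (simp add: c_def inv_inv_eq comp_def)
  qed (use g in \<open>simp add: c_def\<close>)
  \<comment> \<open>The product starts at index \<open>0\<close>, with nothing on the negative side,
    so shifting it by \<open>s\<close> loses exactly the factor \<open>g\<close>.\<close>
  define b where "b k = (if k \<ge> 0 then c (nat k) else id)" for k
  have b: "b k \<in> Aut (part (J k))" for k
    using c[of "nat k"] id_Aut by (auto simp: b_def)
  obtain a where a: "a \<in> Aut (part (\<Union>k. J k))" and ab: "\<And>k x. x \<in> part (J k) \<Longrightarrow> a x = b k x"
    using Aut_family[OF d d refl Aut_homeo[OF b]] by blast
  have gout: "g x = x" if "x \<in> part (J k)" "k \<noteq> 0" for x k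
  proof (rule Aut_out[OF g])
    have "J k \<inter> J 0 = {}" using d that by (auto simp: disjoint_family_on_def)
    then show "x \<notin> part (J 0)" using part_disj that by blast
  qed
  have "a (s x) = g (s (a x))" for x
  proof (cases "x \<in> part (\<Union>k. J k)")
    case True
    then obtain k where k: "x \<in> part (J k)" by (auto simp: part_UN)
    have sx: "s x \<in> part (J (k + 1))" unfolding sJ[of k, symmetric] using k by (rule imageI)
    have ax: "a x = b k x" using ab[OF k] .
    have "b k x \<in> part (J k)" using Aut_mem[OF b, of k x] k by simp
    then have sax: "s (a x) \<in> part (J (k + 1))" unfolding ax sJ[of k, symmetric] by (rule imageI)
    have asx: "a (s x) = b (k + 1) (s x)" using ab[OF sx] .
    \<comment> \<open>At \<open>k = -1\<close> the point enters \<open>part (J 0)\<close>: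
      \<open>a\<close> fixes \<open>x\<close> but acts as \<open>g\<close> on \<open>s x\<close>.
      This is where the factor \<open>g\<close> arises; for all other \<open>k\<close> it does not
      move \<open>s (a x)\<close>.\<close>
    consider "k \<ge> 0" | "k = -1" | "k < -1" by linarith
    then show ?thesis
    proof cases
      case 1
      then have "nat (k + 1) = Suc (nat k)" by simp
      then have "b (k + 1) (s x) = s (b k x)"
        using 1 Aut_bij[OF s] by (simp add: b_def c_def bij_is_inj)
      then show ?thesis using asx ax gout[OF sax] 1 by simp
    next
      case 2
      then show ?thesis using asx ax by (simp add: b_def c_def)
    next
      case 3
      then show ?thesis using asx ax gout[OF sax] by (simp add: b_def)
    qed
  next
    case False
    moreover have "g x = x" by (rule Aut_out[OF g]) (use False in \<open>auto simp: part_UN\<close>)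
    ultimately show ?thesis using Aut_out[OF a] Aut_out[OF s] by simp
  qed
  then have "a \<circ> s = g \<circ> s \<circ> a" by auto
  then show thesis using that a s by blast
qed

text \<open>\<open>full_coordinate\<close> controls \<open>h\<close> on one set of a family and off
  the union, but not on the other sets. It is therefore applied twice to a grid: each row
  \<open>n\<close> has a good column \<open>m n\<close>, and on the transversal of the sets
  \<open>R (n, m n)\<close> some \<open>n\<close> is good. Actions on \<open>D = R (n, m n)\<close>
  are then realised in \<open>H\<close> with support in the row and also with support in the
  transversal. These meet only in \<open>D\<close>, so the two realisations commute off
  \<open>D\<close>, and their commutator is the one prescribed on \<open>D\<close>.\<close>

lemma moiety_in_small_index:
  assumes H: "perm_group H" and small: "small_index H (Aut L)"
  obtains J where "infinite J" "infinite (- J)" "Aut (part J) \<subseteq> H"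
proof -
  obtain R :: "nat \<times> nat \<Rightarrow> nat set" where R: "disjoint_family R" "\<And>j. infinite (R j)" "\<And>j. R j \<subseteq> UNIV"
    by (rule infinite_split[where 'j="nat \<times> nat", OF infinite_UNIV_nat]) (rule that)
  have dR: "R j \<inter> R j' = {}" if "j \<noteq> j'" for j j'
    using disjoint_family_onD[OF R(1) UNIV_I UNIV_I that] .
  have "\<exists>m. \<forall>a\<in>Aut (part (R (n, m))). \<exists>h\<in>H. (\<forall>x\<in>part (R (n, m)). h x = a x) \<and>
      (\<forall>x. x \<notin> part (\<Union>m. R (n, m)) \<longrightarrow> h x = x)" for n
  proof -
    have "disjoint_family (\<lambda>m. R (n, m))" using dR by (auto simp: disjoint_family_on_def)
    from this obtain m where "\<And>a. a \<in> Aut (part (R (n, m))) \<Longrightarrow> \<exists>h\<in>H. (\<forall>x\<in>part (R (n, m)). h x = a x) \<and>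
      (\<forall>x. x \<notin> part (\<Union>m. R (n, m)) \<longrightarrow> h x = x)" by (rule full_coordinate[OF H small]) (rule that)
    then show ?thesis by blast
  qed
  then obtain m where m: "\<And>n a. a \<in> Aut (part (R (n, m n))) \<Longrightarrow> \<exists>h\<in>H. (\<forall>x\<in>part (R (n, m n)). h x = a x) \<and>
      (\<forall>x. x \<notin> part (\<Union>k. R (n, k)) \<longrightarrow> h x = x)" by metis
  have "disjoint_family (\<lambda>n. R (n, m n))" using dR by (auto simp: disjoint_family_on_def)
  then obtain n where n: "\<And>a. a \<in> Aut (part (R (n, m n))) \<Longrightarrow> \<exists>h\<in>H. (\<forall>x\<in>part (R (n, m n)). h x = a x) \<and>
      (\<forall>x. x \<notin> part (\<Union>l. R (l, m l)) \<longrightarrow> h x = x)" by (rule full_coordinate[OF H small]) (rule that)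
  define D where "D = R (n, m n)"
  have D: "infinite D" using R by (simp add: D_def)
  have inter: "x \<in> part D" if x: "x \<in> part (\<Union>k. R (n, k))" "x \<in> part (\<Union>l. R (l, m l))" for x
  proof -
    obtain i where i: "x \<in> Y i" "i \<in> (\<Union>k. R (n, k))" using x(1) by (rule partE)
    then have "i \<in> (\<Union>l. R (l, m l))" using x(2) part_mem by blast
    then obtain k l where kl: "i \<in> R (n, k)" "i \<in> R (l, m l)" using i by auto
    then have "(n, k) = (l, m l)" using dR[of "(n, k)" "(l, m l)"] by blast
    then show ?thesis using kl i part_mem by (auto simp: D_def)
  qed
  \<comment> \<open>Integer indices make the shift invertible; \<open>J 1\<close> also shows that
    the complement of \<open>J 0\<close> is infinite.\<close>
  obtain J :: "int \<Rightarrow> nat set" where J: "disjoint_family J" "\<And>k. infinite (J k)" "\<And>k. J k \<subseteq> D"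
    by (rule infinite_split[where 'j=int, OF D]) (rule that)
  have "Aut (part (J 0)) \<subseteq> H"
  proof
    fix g assume g: "g \<in> Aut (part (J 0))"
    obtain a s where a: "a \<in> Aut (part (\<Union>k. J k))" and s: "s \<in> Aut (part (\<Union>k. J k))"
      and as: "a \<circ> s = g \<circ> s \<circ> a" using commutator[OF J(1,2) g] .
    have JD: "(\<Union>k. J k) \<subseteq> D" using J(3) by blast
    have aD: "a \<in> Aut (part D)" and sD: "s \<in> Aut (part D)" using Aut_part_mono[OF a JD] Aut_part_mono[OF s JD] by simp_all
    obtain h1 where h1: "h1 \<in> H" "\<And>x. x \<in> part D \<Longrightarrow> h1 x = a x"
      and o1: "\<And>x. x \<notin> part (\<Union>k. R (n, k)) \<Longrightarrow> h1 x = x" using m[OF aD[unfolded D_def]] unfolding D_def by blast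
    obtain h2 where h2: "h2 \<in> H" "\<And>x. x \<in> part D \<Longrightarrow> h2 x = s x"
      and o2: "\<And>x. x \<notin> part (\<Union>l. R (l, m l)) \<Longrightarrow> h2 x = x" using n[OF sD[unfolded D_def]] unfolding D_def by blast
    have b: "bij h1" "bij h2" using H h1 h2 by (auto simp: perm_group_def)
    have off: "h x \<notin> part D" if h: "bij h" "\<And>x. x \<in> part D \<Longrightarrow> h x = t x" and t: "t \<in> Aut (part D)"
      and x: "x \<notin> part D" for h t x
    proof
      assume hx: "h x \<in> part D"
      then obtain y where y: "y \<in> part D" "t y = h x" using Aut_image[OF t] by (metis imageE)
      then have "h y = h x" using h(2) by simp
      then show False using h(1) x y by (metis bij_is_inj injD)
    qed
    have stay: "h x \<in> Z" if h: "bij h" "\<And>x. x \<notin> Z \<Longrightarrow> h x = x" and x: "x \<in> Z" for h x Z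
    proof (rule ccontr)
      assume "h x \<notin> Z"
      then have "h (h x) = h x" using h(2) by blast
      then have "h x = x" using h(1) by (simp add: bij_is_inj inj_eq)
      then show False using \<open>h x \<notin> Z\<close> x by simp
    qed
    have gout: "g x = x" if "x \<notin> part D" for x
      using Aut_out[OF g, of x] that part_mono[OF J(3), of 0] by blast
    have "h1 (h2 x) = g (h2 (h1 x))" for x
    proof (cases "x \<in> part D")
      case True
      then have "a x \<in> part D" "s x \<in> part D" using Aut_mem[OF aD] Aut_mem[OF sD] by auto
      moreover have "a (s x) = g (s (a x))" using fun_cong[OF as, of x] by simp
      ultimately show ?thesis using h1(2) h2(2) True by simp
    next
      case False
      have h1x: "h1 x \<notin> part D" using off[OF b(1) h1(2) aD False] .
      have h2x: "h2 x \<notin> part D" using off[OF b(2) h2(2) sD False] .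
      have "h2 (h1 x) \<notin> part D" using off[OF b(2) h2(2) sD h1x] .
      then have "g (h2 (h1 x)) = h2 (h1 x)" using gout by blast
      \<comment> \<open>Off \<open>part D\<close>, at most one of \<open>h1\<close> and
        \<open>h2\<close> moves a given point, and it keeps the point where the other is the
        identity.\<close>
      moreover have "h1 (h2 x) = h2 (h1 x)"
      proof (cases "x \<in> part (\<Union>k. R (n, k))")
        case True
        have "h1 x \<in> part (\<Union>k. R (n, k))" by (rule stay[OF b(1) o1 True])
        then have "h2 (h1 x) = h1 x" by (intro o2) (use inter h1x in auto)
        moreover have "h2 x = x" by (rule o2) (use inter True False in auto)
        ultimately show ?thesis by simp
      next
        case nx: False
        show ?thesis
        proof (cases "x \<in> part (\<Union>l. R (l, m l))")
          case True
          have "h2 x \<in> part (\<Union>l. R (l, m l))" by (rule stay[OF b(2) o2 True])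
          then have "h1 (h2 x) = h2 x" by (intro o1) (use inter h2x in auto)
          then show ?thesis using o1[OF nx] by simp
        next
          case False
          then show ?thesis using o1[OF nx] o2[OF False] by simp
        qed
      qed
      ultimately show ?thesis by simp
    qed
    then have "h1 \<circ> h2 = g \<circ> (h2 \<circ> h1)" by auto
    moreover have "(h2 \<circ> h1) \<circ> finv (h2 \<circ> h1) = id"
      using bij_comp[OF b] bij_is_surj surj_iff by blast
    ultimately have "(h1 \<circ> h2) \<circ> finv (h2 \<circ> h1) = g" by (simp add: comp_assoc)
    moreover have "(h1 \<circ> h2) \<circ> finv (h2 \<circ> h1) \<in> H" using H h1(1) h2(1) by (simp add: perm_group_def)
    ultimately show "g \<in> H" by simp
  qed
  moreover have "infinite (- J 0)"
  proof -
    have "J 1 \<inter> J 0 = {}" by (rule disjoint_family_onD[OF J(1)]) auto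
    then have "J 1 \<subseteq> - J 0" by blast
    then show ?thesis using J(2) infinite_super by blast
  qed
  ultimately show thesis using that J(2) by blast
qed

text \<open>Some \<open>k\<^sub>1\<close> supported in \<open>part (I\<^sub>2 \<union> I\<^sub>3)\<close> moves \<open>g ` part I\<^sub>1\<close> into \<open>part (I\<^sub>1 \<union> I\<^sub>2)\<close>, and then
  some \<open>k\<^sub>2\<close> supported in \<open>part (I\<^sub>1 \<union> I\<^sub>2)\<close> moves it back, so that \<open>k\<^sub>2 \<circ> k\<^sub>1 \<circ> g\<close> fixes
  \<open>part I\<^sub>1\<close> pointwise.\<close>

lemma generate_big_case:
  assumes H: "perm_group H" and inf: "infinite I1" "infinite I2" "infinite I3"
    and d: "I1 \<inter> I2 = {}" "I1 \<inter> I3 = {}" "I2 \<inter> I3 = {}"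
    and H12: "Aut (part (I1 \<union> I2)) \<subseteq> H" and H23: "Aut (part (I2 \<union> I3)) \<subseteq> H"
    and g: "g \<in> Aut (part (I1 \<union> I2 \<union> I3))"
    and bg: "big q (part (I2 \<union> I3) - g ` part I1)"
  shows "g \<in> H"
proof -
  \<comment> \<open>Two disjoint infinite subsets of \<open>I2\<close>: \<open>K True\<close>
    receives what has to be moved, \<open>K False\<close> stays free and keeps the complements
    big.\<close>
  obtain K :: "bool \<Rightarrow> nat set" where K: "disjoint_family K" "\<And>b. infinite (K b)" "\<And>b. K b \<subseteq> I2"
    by (rule infinite_split[where 'j=bool, OF inf(2)]) (rule that)
  have KK: "K True \<inter> K False = {}" by (rule disjoint_family_onD[OF K(1)]) auto
  have gL: "g \<in> Aut L" using Aut_part_mono[OF g subset_UNIV] .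
  define N where "N = g ` part I1 \<inter> part (I2 \<union> I3)"
  have rg: "regular Y (g ` part I1)" using Aut_regular[OF gL regular_part] .
  have rN: "regular Y N" unfolding N_def using regular_inter[OF rg regular_part] .
  have inf23: "infinite (I2 \<union> I3)" using inf by simp
  \<comment> \<open>All of \<open>part (I2 \<union> I3)\<close> is compressed into
    \<open>part (K True)\<close>. The restriction to \<open>N\<close> extends to a homeomorphism
    \<open>k1\<close> of \<open>part (I2 \<union> I3)\<close>, because \<open>N\<close> and its
    image both have big complements there.\<close>
  obtain \<psi> where \<psi>: "homeo (part (I2 \<union> I3)) (part (K True)) \<psi>"
    by (rule homeo_big[OF regular_part big_part[OF inf23] regular_part big_part[OF K(2)]])
  have N23: "N \<subseteq> part (I2 \<union> I3)" by (auto simp: N_def)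
  have rpN: "regular Y (\<psi> ` N)" by (rule homeo_regular[OF \<psi> regular_part regular_part rN N23])
  have pN: "\<psi> ` N \<subseteq> part (K True)" using homeo_image[OF \<psi>] N23 by blast
  have K23: "K b \<subseteq> I2 \<union> I3" for b using K(3) by blast
  have pN23: "\<psi> ` N \<subseteq> part (I2 \<union> I3)" using pN part_mono[OF K23] by blast
  have "part (K False) \<inter> part (K True) = {}" using part_disj KK by blast
  then have KF: "part (K False) \<subseteq> part (I2 \<union> I3) - \<psi> ` N" using pN part_mono[OF K23, of False] by blast
  have "part (I2 \<union> I3) - N = part (I2 \<union> I3) - g ` part I1" by (auto simp: N_def)
  then have b1: "big q (part (I2 \<union> I3) - N)" using bg by simp
  have b2: "big q (part (I2 \<union> I3) - \<psi> ` N)" using big_mono[OF big_part[OF K(2)] KF] .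
  obtain f1 where f1: "homeo (part (I2 \<union> I3) - N) (part (I2 \<union> I3) - \<psi> ` N) f1"
    by (rule homeo_big[OF regular_Diff[OF regular_part rN] b1 regular_Diff[OF regular_part rpN] b2])
  obtain k1 where k1: "k1 \<in> Aut (part (I2 \<union> I3))" and k1N: "\<And>x. x \<in> N \<Longrightarrow> k1 x = \<psi> x"
    by (rule Aut_glue[OF homeo_restrict[OF \<psi> N23] f1 rN rpN regular_part N23 pN23]) (rule that)
  have k1L: "k1 \<in> Aut L" using Aut_part_mono[OF k1 subset_UNIV] .
  have cL: "k1 \<circ> g \<in> Aut L" using comp_Aut[OF k1L gL] .
  define M where "M = (k1 \<circ> g) ` part I1"
  have rM: "regular Y M" unfolding M_def using Aut_regular[OF cL regular_part] .
  have d1_23: "part I1 \<inter> part (I2 \<union> I3) = {}" by (rule part_disj) (use d in blast)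
  have M: "M \<subseteq> part I1 \<union> part (K True)"
  proof
    fix y assume "y \<in> M"
    then obtain x where x: "x \<in> part I1" "y = k1 (g x)" by (auto simp: M_def)
    have "x \<in> part (I1 \<union> I2 \<union> I3)" using x(1) by (simp add: part_Un)
    then have "g x \<in> part (I1 \<union> I2 \<union> I3)" using Aut_mem[OF g] by simp
    then consider "g x \<in> part (I2 \<union> I3)" | "g x \<in> part I1" by (auto simp: part_Un)
    then show "y \<in> part I1 \<union> part (K True)"
    proof cases
      case 1
      then have "g x \<in> N" using x by (simp add: N_def)
      then have "y \<in> \<psi> ` N" using k1N x(2) by simp
      then show ?thesis using pN by blast
    next
      case 2
      then have "g x \<notin> part (I2 \<union> I3)" using d1_23 by blast
      then show ?thesis using 2 Aut_out[OF k1] x(2) by simp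
    qed
  qed
  have K12: "K b \<subseteq> I1 \<union> I2" for b using K(3) by blast
  have M12: "M \<subseteq> part (I1 \<union> I2)" using M part_mono[OF K12, of True] by (auto simp: part_Un)
  have "part (K False) \<inter> part (I1 \<union> K True) = {}" by (rule part_disj) (use KK K(3) d in blast)
  then have KM: "part (K False) \<subseteq> part (I1 \<union> I2) - M"
    using M part_mono[OF K12, of False] unfolding part_Un by blast
  have s1: "part I1 \<subseteq> part (I1 \<union> I2)" by (simp add: part_Un)
  have "part I2 \<subseteq> part (I1 \<union> I2) - part I1" using part_disj[OF d(1)] by (auto simp: part_Un)
  then have b4: "big q (part (I1 \<union> I2) - part I1)" using big_mono[OF big_part[OF inf(2)]] by blast
  have b3: "big q (part (I1 \<union> I2) - M)" using big_mono[OF big_part[OF K(2)] KM] .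
  obtain f2 where f2: "homeo (part (I1 \<union> I2) - M) (part (I1 \<union> I2) - part I1) f2"
    by (rule homeo_big[OF regular_Diff[OF regular_part rM] b3 regular_Diff[OF regular_part regular_part] b4])
  have "homeo (part I1) M (k1 \<circ> g)" unfolding M_def by (rule homeo_restrict[OF Aut_homeo[OF cL] part_mono[OF subset_UNIV]])
  then have f3: "homeo M (part I1) (inv_into (part I1) (k1 \<circ> g))" by (rule homeo_inv)
  obtain k2 where k2: "k2 \<in> Aut (part (I1 \<union> I2))"
    and k2M: "\<And>x. x \<in> M \<Longrightarrow> k2 x = inv_into (part I1) (k1 \<circ> g) x"
    by (rule Aut_glue[OF f3 f2 rM regular_part regular_part M12 s1]) (rule that)
  have k2L: "k2 \<in> Aut L" using Aut_part_mono[OF k2 subset_UNIV] .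
  have injc: "inj (k1 \<circ> g)" using Aut_bij[OF cL] by (rule bij_is_inj)
  have kL: "k2 \<circ> (k1 \<circ> g) \<in> Aut L" using comp_Aut[OF k2L cL] .
  \<comment> \<open>This product is the identity on \<open>part I1\<close> and off the three parts,
    so it lies in a group already contained in \<open>H\<close>, and \<open>k2\<close> and
    \<open>k1\<close> can be cancelled.\<close>
  have "k2 \<circ> (k1 \<circ> g) \<in> Aut (part (I2 \<union> I3))"
  proof (rule Aut_restrict[OF kL part_mono[OF subset_UNIV]])
    fix x assume x: "x \<notin> part (I2 \<union> I3)"
    show "(k2 \<circ> (k1 \<circ> g)) x = x"
    proof (cases "x \<in> part I1")
      case True
      then have "(k1 \<circ> g) x \<in> M" unfolding M_def by (rule imageI)
      then have "k2 ((k1 \<circ> g) x) = inv_into (part I1) (k1 \<circ> g) ((k1 \<circ> g) x)" by (rule k2M)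
      also have "\<dots> = x" using True by (rule inv_into_f_f[OF inj_on_subset[OF injc subset_UNIV]])
      finally show ?thesis by simp
    next
      case False
      have "g x = x" by (rule Aut_out[OF g]) (use x False in \<open>auto simp: part_Un\<close>)
      moreover have "k1 x = x" by (rule Aut_out[OF k1 x])
      moreover have "k2 x = x" by (rule Aut_out[OF k2]) (use x False in \<open>auto simp: part_Un\<close>)
      ultimately show ?thesis by simp
    qed
  qed
  then have "k2 \<circ> (k1 \<circ> g) \<in> H" using H23 by blast
  then have "k1 \<circ> g \<in> H" using perm_group_cancel[OF H _ Aut_bij[OF k2]] k2 H12 by blast
  then show "g \<in> H" using perm_group_cancel[OF H _ Aut_bij[OF k1]] k1 H23 by blast
qed

text \<open>The image of \<open>part (I2 \<union> I3)\<close> under \<open>g\<close> is big and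
  misses that of \<open>part I1\<close>, so big room is left in \<open>part (I2 \<union> I3)\<close>
  or in \<open>part I1\<close>. The second case reduces to the first by an element of
  \<open>H\<close> that carries \<open>part I1\<close> onto \<open>part I2\<close>.\<close>

lemma generate_union:
  assumes H: "perm_group H" and inf: "infinite I1" "infinite I2" "infinite I3"
    and d: "I1 \<inter> I2 = {}" "I1 \<inter> I3 = {}" "I2 \<inter> I3 = {}"
    and H12: "Aut (part (I1 \<union> I2)) \<subseteq> H" and H23: "Aut (part (I2 \<union> I3)) \<subseteq> H"
  shows "Aut (part (I1 \<union> I2 \<union> I3)) \<subseteq> H"
proof
  fix g assume g: "g \<in> Aut (part (I1 \<union> I2 \<union> I3))"
  have gL: "g \<in> Aut L" using Aut_part_mono[OF g subset_UNIV] .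
  have dp: "part I1 \<inter> part (I2 \<union> I3) = {}" "part I1 \<inter> part I2 = {}"
    by (rule part_disj, use d in blast)+
  have "big q (g ` part (I2 \<union> I3))" using Aut_big[OF gL big_part] inf by simp
  moreover have "g ` part (I2 \<union> I3) \<subseteq> (part I1 - g ` part I1) \<union> (part (I2 \<union> I3) - g ` part I1)"
  proof
    fix y assume "y \<in> g ` part (I2 \<union> I3)"
    then obtain x where x: "x \<in> part (I2 \<union> I3)" "y = g x" by blast
    have "x \<notin> part I1" using dp x by blast
    then have "y \<notin> g ` part I1" using Aut_inj[OF gL] x by auto
    moreover have "y \<in> part (I1 \<union> I2 \<union> I3)" using x Aut_mem[OF g] by (simp add: part_Un)
    ultimately show "y \<in> (part I1 - g ` part I1) \<union> (part (I2 \<union> I3) - g ` part I1)"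
      by (auto simp: part_Un)
  qed
  ultimately consider "big q (part (I2 \<union> I3) - g ` part I1)" | "big q (part I1 - g ` part I1)"
    using big_mono big_Un by meson
  then show "g \<in> H"
  proof cases
    case 1
    then show ?thesis using generate_big_case[OF H inf d H12 H23 g] by blast
  next
    case 2
    obtain \<tau> where \<tau>: "homeo (part I1) (part I2) \<tau>"
      by (rule homeo_big[OF regular_part big_part[OF inf(1)] regular_part big_part[OF inf(2)]])
    have eq: "part (I1 \<union> I2) - part I1 = part I2" "part (I1 \<union> I2) - part I2 = part I1"
      using dp(2) by (auto simp: part_Un)
    have \<tau>': "homeo (part (I1 \<union> I2) - part I1) (part (I1 \<union> I2) - part I2) (inv_into (part I1) \<tau>)"
      unfolding eq using homeo_inv[OF \<tau>] .
    have sub: "part I1 \<subseteq> part (I1 \<union> I2)" "part I2 \<subseteq> part (I1 \<union> I2)" by (auto simp: part_Un)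
    obtain k where k: "k \<in> Aut (part (I1 \<union> I2))" and k\<tau>: "\<And>x. x \<in> part I1 \<Longrightarrow> k x = \<tau> x"
      by (rule Aut_glue[OF \<tau> \<tau>' regular_part regular_part regular_part sub]) (rule that)
    have kL: "k \<in> Aut L" using Aut_part_mono[OF k subset_UNIV] .
    have "big q (k ` (part I1 - g ` part I1))" using Aut_big[OF kL 2] .
    moreover have "k ` (part I1 - g ` part I1) \<subseteq> part (I2 \<union> I3) - (k \<circ> g) ` part I1"
    proof
      fix y assume "y \<in> k ` (part I1 - g ` part I1)"
      then obtain x where x: "x \<in> part I1" "x \<notin> g ` part I1" "y = k x" by blast
      then have "y \<in> part I2" using k\<tau> homeo_image[OF \<tau>] by auto
      moreover have "y \<notin> (k \<circ> g) ` part I1" using x Aut_inj[OF k] by auto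
      ultimately show "y \<in> part (I2 \<union> I3) - (k \<circ> g) ` part I1" by (simp add: part_Un)
    qed
    ultimately have b: "big q (part (I2 \<union> I3) - (k \<circ> g) ` part I1)" by (rule big_mono)
    have "k \<in> Aut (part (I1 \<union> I2 \<union> I3))" using k by (rule Aut_part_mono) blast
    then have "k \<circ> g \<in> Aut (part (I1 \<union> I2 \<union> I3))" using g by (rule comp_Aut)
    then have "k \<circ> g \<in> H" using generate_big_case[OF H inf d H12 H23 _ b] by blast
    then show ?thesis using perm_group_cancel[OF H _ Aut_bij[OF k]] k H12 by blast
  qed
qed

text \<open>\<open>F S\<close> carries \<open>part J\<close> onto \<open>part (- D S)\<close>. Two
  of these maps share a coset, so one conjugate of \<open>H\<close> contains the groups of both
  \<open>part (- D S)\<close> and \<open>part (- D T)\<close>, whose index sets have all odd numbers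
  in common. By \<open>generate_union\<close> only the finite set \<open>D S \<inter> D T\<close> is
  left out. Conjugating back need not give a union of pieces, but the omitted set remains compact
  and so lies in finitely many pieces.\<close>

lemma tail_in_small_index:
  assumes H: "perm_group H" and small: "small_index H (Aut L)"
  obtains k where "Aut (part {k..}) \<subseteq> H"
proof -
  obtain J where J: "infinite J" "infinite (- J)" "Aut (part J) \<subseteq> H"
    by (rule moiety_in_small_index[OF H small])
  obtain D :: "nat set \<Rightarrow> nat set" where D: "\<And>S. infinite (D S)"
    "\<And>S T. S \<noteq> T \<Longrightarrow> finite (D S \<inter> D T)" "\<And>S. D S \<subseteq> Collect even"
    by (rule almost_disjoint_family) (rule that)
  have odd: "infinite (Collect odd :: nat set)"
  proof -
    have "range (\<lambda>n. 2 * n + 1) \<subseteq> (Collect odd :: nat set)" by auto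
    moreover have "infinite (range (\<lambda>n::nat. 2 * n + 1))" by (intro range_inj_infinite) (auto simp: inj_def)
    ultimately show ?thesis using infinite_super by blast
  qed
  have cD: "infinite (- D S)" for S
  proof -
    have "Collect odd \<subseteq> - D S" using D(3)[of S] by auto
    then show ?thesis using odd infinite_super by blast
  qed
  have "\<exists>g. g \<in> Aut L \<and> g ` part J = part (- D S)" for S
  proof -
    obtain f where f: "homeo (part J) (part (- D S)) f"
      by (rule homeo_big[OF regular_part big_part[OF J(1)] regular_part big_part[OF cD]])
    have c: "L - part J = part (- J)" "L - part (- D S) = part (D S)"
      unfolding part_Diff[symmetric] by (simp_all add: Compl_eq_Diff_UNIV[symmetric])
    obtain f' where f': "homeo (L - part J) (L - part (- D S)) f'"
      unfolding c by (rule homeo_big[OF regular_part big_part[OF J(2)] regular_part big_part[OF D(1)]])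
    obtain g where g: "g \<in> Aut L" "\<And>x. x \<in> part J \<Longrightarrow> g x = f x"
      by (rule Aut_glue[OF f f' regular_part regular_part regular_part part_mono[OF subset_UNIV] part_mono[OF subset_UNIV]])
         (rule that)
    then have "g ` part J = f ` part J" by (intro image_cong) auto
    then show ?thesis using homeo_image[OF f] g(1) by auto
  qed
  then obtain F where F: "\<And>S. F S \<in> Aut L" and FJ: "\<And>S. F S ` part J = part (- D S)" by metis
  obtain S T h where ST: "S \<noteq> T" "h \<in> H" "F T = F S \<circ> h" by (rule small_indexD[OF small F])
  define g where "g = F S"
  have g: "g \<in> Aut L" "bij g" using F Aut_bij by (auto simp: g_def)
  have hb: "bij h" "finv h \<in> H" using H ST(2) by (auto simp: perm_group_def)
  define H' where "H' = {f. bij f \<and> finv g \<circ> f \<circ> g \<in> H}"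
  have H': "perm_group H'" unfolding H'_def using perm_group_conj[OF H g(2)] .
  have JL: "part J \<subseteq> L" by (intro part_mono) blast
  have S': "Aut (part (- D S)) \<subseteq> H'"
  proof
    fix f assume f: "f \<in> Aut (part (- D S))"
    then have "finv g \<circ> f \<circ> g \<in> Aut (part J)"
      using Aut_conj[OF g(1) _ JL] FJ[of S] by (simp add: g_def)
    then show "f \<in> H'" using J(3) Aut_bij[OF f] by (auto simp: H'_def)
  qed
  \<comment> \<open>\<open>F T\<close> is \<open>g \<circ> h\<close> with \<open>h \<in> H\<close>,
    so conjugating \<open>H\<close> by \<open>F T\<close> or by \<open>g\<close> gives the same
    group.\<close>
  have T': "Aut (part (- D T)) \<subseteq> H'"
  proof
    fix f assume f: "f \<in> Aut (part (- D T))"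
    then have "finv (F T) \<circ> f \<circ> F T \<in> Aut (part J)" using Aut_conj[OF F _ JL] FJ[of T] by simp
    moreover have "finv (F T) = finv h \<circ> finv g"
      unfolding ST(3) g_def using hb(1) Aut_bij[OF F] by (intro o_inv_distrib) auto
    ultimately have "finv h \<circ> (finv g \<circ> f \<circ> g) \<circ> h \<in> H" using J(3) ST(3) by (auto simp: comp_assoc g_def)
    then have "h \<circ> (finv h \<circ> (finv g \<circ> f \<circ> g) \<circ> h) \<circ> finv h \<in> H" (is "?u \<in> H")
      using H ST(2) hb(2) by (simp add: perm_group_def)
    moreover have "?u = finv g \<circ> f \<circ> g" using hb(1) by (simp add: fun_eq_iff bij_is_surj surj_f_inv_f)
    ultimately show "f \<in> H'" using Aut_bij[OF f] by (simp add: H'_def)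
  qed
  have "D T - D S = D T - D S \<inter> D T" "D S - D T = D S - D S \<inter> D T" by auto
  then have i13: "infinite (D T - D S)" "infinite (D S - D T)"
    using Diff_infinite_finite[OF D(2)[OF ST(1)]] D(1) by auto
  have "Collect odd \<subseteq> - D S \<inter> - D T" using D(3)[of S] D(3)[of T] by auto
  then have i2: "infinite (- D S \<inter> - D T)" using odd infinite_super by blast
  have u: "(D T - D S) \<union> (- D S \<inter> - D T) = - D S" "(- D S \<inter> - D T) \<union> (D S - D T) = - D T"
    "- D S \<union> (D S - D T) = - (D S \<inter> D T)" by auto
  have "Aut (part ((D T - D S) \<union> (- D S \<inter> - D T) \<union> (D S - D T))) \<subseteq> H'"
    by (rule generate_union[OF H' i13(1) i2 i13(2)]) (use S' T' in \<open>auto simp: u\<close>)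
  then have E: "Aut (part (- (D S \<inter> D T))) \<subseteq> H'" unfolding u .
  have fin: "finite (D S \<inter> D T)" using D(2)[OF ST(1)] .
  have KC: "part (D S \<inter> D T) \<in> C"
    unfolding part_def by (rule UN_C[OF fin layer_Y(1)[OF layer]])
  have gi: "finv g \<in> Aut L" using inv_Aut[OF g(1)] .
  define K where "K = finv g ` part (D S \<inter> D T)"
  have KL: "K \<subseteq> L" unfolding K_def using Aut_image[OF gi] part_mono[of "D S \<inter> D T" UNIV] by blast
  have "K \<in> C" unfolding K_def using KC Aut_C[OF gi part_mono] by blast
  then obtain k where k: "\<And>i. i \<ge> k \<Longrightarrow> K \<inter> Y i = {}"
    using layer_bounded[OF layer] KL[unfolded part_def] by blast
  have gk: "g ` part {k..} \<subseteq> part (- (D S \<inter> D T))"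
  proof
    fix y assume "y \<in> g ` part {k..}"
    then obtain x where x: "x \<in> part {k..}" "y = g x" by blast
    then have "x \<notin> K" using k by (auto elim!: partE)
    have "finv g y = x" using x g(2) by (simp add: bij_is_inj)
    then have "y \<notin> part (D S \<inter> D T)" using \<open>x \<notin> K\<close> unfolding K_def by blast
    moreover have "x \<in> L" using x(1) part_mono[OF subset_UNIV] by blast
    then have "y \<in> L" using x(2) Aut_mem[OF g(1)] by simp
    ultimately have "y \<in> L - part (D S \<inter> D T)" by blast
    then show "y \<in> part (- (D S \<inter> D T))" by (simp add: part_Diff[symmetric] Compl_eq_Diff_UNIV)
  qed
  have "Aut (part {k..}) \<subseteq> H"
  proof
    fix f assume f: "f \<in> Aut (part {k..})"
    have "finv g ` g ` part {k..} = part {k..}" using g(2) by (simp add: image_inv_f_f bij_is_inj)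
    then have "f \<in> Aut (finv g ` g ` part {k..})" using f by simp
    then have "finv (finv g) \<circ> f \<circ> finv g \<in> Aut (g ` part {k..})"
      by (rule Aut_conj[OF gi]) (use Aut_image[OF g(1)] part_mono[of "{k..}" UNIV] in blast)
    then have f': "g \<circ> f \<circ> finv g \<in> Aut (g ` part {k..})" using g(2) by (simp add: inv_inv_eq)
    have "g \<circ> f \<circ> finv g \<in> Aut (part (- (D S \<inter> D T)))"
      using Aut_extend[OF f' gk Aut_regular[OF g(1) regular_part] regular_part] .
    then have "g \<circ> f \<circ> finv g \<in> H'" using E by blast
    then have "finv g \<circ> (g \<circ> f \<circ> finv g) \<circ> g \<in> H" by (simp add: H'_def)
    moreover have "finv g \<circ> (g \<circ> f \<circ> finv g) \<circ> g = f" using g(2) by (simp add: fun_eq_iff bij_is_inj)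
    ultimately show "f \<in> H" by simp
  qed
  then show thesis using that by blast
qed

section \<open>Passage between the union of the pieces and its one-point compactification\<close>

lemma X_eq: "X = insert p L" and p_notin: "p \<notin> L"
  using layer by (auto simp: layer_def part_def)

text \<open>If \<open>f p\<close> lay in \<open>Y i\<close>, the preimage of \<open>Y i\<close>
  would be a clopen neighbourhood of \<open>p\<close>, and \<open>top_invariant\<close>, with
  \<open>X\<close> on both sides, would put \<open>p\<close> into \<open>Y i\<close>.\<close>

lemma Aut_top:
  assumes f: "f \<in> Aut X" shows "f p = p"
proof (rule ccontr)
  assume np: "f p \<noteq> p"
  have o: "omega_power (Suc n) p X" using layer Y by auto
  have "f p \<in> X" using Aut_mem[OF f] X_eq by blast
  then have "f p \<in> L" using np X_eq by blast
  then obtain i where i: "f p \<in> Y i" by (rule partE)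
  define U where "U = {x\<in>X. f x \<in> Y i}"
  have UX: "U \<subseteq> X" by (auto simp: U_def)
  have fU: "f ` U = Y i"
  proof
    show "Y i \<subseteq> f ` U"
    proof
      fix y assume y: "y \<in> Y i"
      then have "y \<in> f ` X" using Aut_image[OF f] layer_Y(2)[OF layer] by blast
      then show "y \<in> f ` U" using y by (auto simp: U_def)
    qed
  qed (auto simp: U_def)
  have UC: "U \<in> C" using Aut_C[OF f UX] fU layer_Y(1)[OF layer] by simp
  have pU: "p \<in> U" using i X_eq by (simp add: U_def)
  have h: "homeo U (Y i) f" using homeo_restrict[OF Aut_homeo[OF f] UX] fU by simp
  have "p \<in> Y i" by (rule top_invariant[OF o o UX UC pU h layer_Y(2)[OF layer] layer_Y(1)[OF layer]])
  then show False using layer_Y(3)[OF layer] by blast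
qed

text \<open>Homeomorphisms of the union extend to the one-point compactification, and those of
  \<open>X\<close> fix the added point. Since both groups consist of permutations of the type, the
  extension is the same permutation.\<close>

lemma Aut_X_eq: "Aut X = Aut L"
proof
  show "Aut X \<subseteq> Aut L"
  proof
    fix f assume f: "f \<in> Aut X"
    show "f \<in> Aut L" by (rule Aut_restrict[OF f]) (use X_eq Aut_top[OF f] in auto)
  qed
  show "Aut L \<subseteq> Aut X"
  proof
    fix f assume f: "f \<in> Aut L"
    have fp: "f p = p" using Aut_out[OF f p_notin] .
    have fX: "f ` X = X" using Aut_image[OF f] fp X_eq by simp
    have "U \<in> C \<longleftrightarrow> f ` U \<in> C" if U: "U \<subseteq> X" for U
    proof (cases "p \<in> U")
      case False
      then have "U \<subseteq> L" using U X_eq by blast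
      then show ?thesis using Aut_C[OF f] by simp
    next
      case True
      then have XU: "X - U \<subseteq> L" using X_eq by blast
      have "f ` (X - U) = X - f ` U"
        using image_set_diff[OF bij_is_inj[OF Aut_bij[OF f]]] fX by simp
      moreover have "p \<in> f ` U" using True fp by (metis imageI)
      moreover have "f ` U \<subseteq> X" using U fX by blast
      ultimately show ?thesis
        using Aut_C[OF f XU] layer_C_compl[OF layer U True] layer_C_compl[OF layer, of "f ` U"] by simp
    qed
    moreover have "f x = x" if "x \<notin> X" for x using Aut_out[OF f] that X_eq by blast
    ultimately show "f \<in> Aut X" using Aut_bij[OF f] by (simp add: Aut_def)
  qed
qed

text \<open>Induction on the set \<open>F\<close> of those first \<open>k\<close> pieces on which
  \<open>f\<close> may act. Each such \<open>Y i\<close> is in \<open>B\<close>, so \<open>f\<close>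
  preserves it and its restriction \<open>g\<close> to \<open>Y i\<close> splits off. As
  \<open>g\<close> fixes \<open>A i\<close>, it is in \<open>H\<close>, and
  \<open>finv g \<circ> f\<close> acts on one piece fewer. For empty \<open>F\<close> only the tail
  remains.\<close>

lemma small_index_layer:
  assumes H: "perm_group H" and k: "Aut (part {k..}) \<subseteq> H"
    and A: "\<And>i. i < k \<Longrightarrow> finite (A i) \<and> (\<forall>a\<in>A i. a \<in> C \<and> a \<subseteq> Y i) \<and>
      (\<forall>f\<in>Aut (Y i). (\<forall>a\<in>A i. f ` a = a) \<longrightarrow> f \<in> H)"
    and B: "B = (\<Union>i<k. insert (Y i) (A i))"
  shows "F \<subseteq> {..<k} \<Longrightarrow> f \<in> Aut L \<Longrightarrow> (\<And>a. a \<in> B \<Longrightarrow> f ` a = a) \<Longrightarrow>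
    (\<And>i x. i < k \<Longrightarrow> i \<notin> F \<Longrightarrow> x \<in> Y i \<Longrightarrow> f x = x) \<Longrightarrow> f \<in> H"
proof -
  assume F: "F \<subseteq> {..<k}"
  then have "finite F" using finite_subset by blast
  then show "f \<in> Aut L \<Longrightarrow> (\<And>a. a \<in> B \<Longrightarrow> f ` a = a) \<Longrightarrow>
    (\<And>i x. i < k \<Longrightarrow> i \<notin> F \<Longrightarrow> x \<in> Y i \<Longrightarrow> f x = x) \<Longrightarrow> f \<in> H"
    using F
  proof (induction F arbitrary: f rule: finite_induct)
    case empty
    have "f \<in> Aut (part {k..})"
    proof (rule Aut_restrict[OF empty.prems(1) part_mono[OF subset_UNIV]])
      fix x assume x: "x \<in> L" "x \<notin> part {k..}"
      then obtain i where i: "x \<in> Y i" by (auto elim: partE)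
      then have "i < k" using x(2) part_mem[OF i] by auto
      then show "f x = x" using empty.prems(3) i by blast
    qed
    then show ?case using k by blast
  next
    case (insert i F)
    have i: "i < k" using insert.prems by simp
    note fL = insert.prems(1)
    have "Y i \<in> B" using i B by blast
    then have fY: "f ` Y i = Y i" using insert.prems(2) by blast
    define g where "g = (\<lambda>x. if x \<in> Y i then f x else x)"
    have YL: "Y i \<subseteq> L" by (auto simp: part_def)
    have "homeo (Y i) (Y i) f" using homeo_restrict[OF Aut_homeo[OF fL] YL] fY by simp
    then have gY: "g \<in> Aut (Y i)" unfolding g_def by (rule homeo_Aut)
    have ga: "g ` a = a" if a: "a \<in> B" for a
    proof -
      obtain j where j: "j < k" "a \<in> insert (Y j) (A j)" using a B by blast
      then have aj: "a \<subseteq> Y j" using A[OF j(1)] by blast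
      show ?thesis
      proof (cases "j = i")
        case True
        then have "g ` a = f ` a" using aj by (intro image_cong) (auto simp: g_def)
        then show ?thesis using insert.prems(2)[OF a] by simp
      next
        case False
        then have "g x = x" if "x \<in> a" for x using that aj layer_disj[OF layer, of x i j] by (auto simp: g_def)
        then show ?thesis by simp
      qed
    qed
    have "A i \<subseteq> B" using i B by blast
    then have gH: "g \<in> H" using A[OF i] gY ga by blast
    have gb: "bij g" using Aut_bij[OF gY] .
    have gL: "g \<in> Aut L"
      using Aut_extend[OF gY YL regular_Y[OF layer] regular_part] .
    have "finv g \<circ> f \<in> H"
    proof (rule insert.IH)
      show "finv g \<circ> f \<in> Aut L" using comp_Aut[OF inv_Aut[OF gL] fL] .
      show "F \<subseteq> {..<k}" using insert.prems by simp
      show "(finv g \<circ> f) ` a = a" if a: "a \<in> B" for a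
      proof -
        have "(finv g \<circ> f) ` a = finv g ` (f ` a)" by (simp only: image_comp)
        also have "\<dots> = finv g ` g ` a" using insert.prems(2)[OF a] ga[OF a] by simp
        finally have "(finv g \<circ> f) ` a = finv g ` g ` a" .
        then show ?thesis using gb by (simp add: image_inv_f_f bij_is_inj)
      qed
      show "(finv g \<circ> f) x = x" if x: "j < k" "j \<notin> F" "x \<in> Y j" for j x
      proof (cases "j = i")
        case True
        then have "f x = g x" using x by (simp add: g_def)
        then show ?thesis using gb by (simp add: bij_is_inj)
      next
        case False
        then have "f x = x" using insert.prems(3) x by blast
        moreover have "g x = x" using False x layer_disj[OF layer, of x i j] by (auto simp: g_def)
        then have "finv g x = x" using gb by (metis bij_inv_eq_iff)
        ultimately show ?thesis by simp
      qed
    qed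
    then have "g \<circ> (finv g \<circ> f) \<in> H" using H gH by (simp add: perm_group_def)
    moreover have "g \<circ> (finv g \<circ> f) = f" using gb by (simp add: fun_eq_iff bij_is_surj surj_f_inv_f)
    ultimately show ?case by simp
  qed
qed

end

context set_ring
begin

text \<open>The index hypothesis passes to the subgroups \<open>Aut (Y i)\<close>, so the induction
  hypothesis applies to each piece with the same \<open>H\<close>. The finite sets for the pieces
  before the tail are collected, together with those pieces.\<close>

theorem omega_power_small_index:
  "omega_power n p X \<Longrightarrow> perm_group H \<Longrightarrow> small_index H (Aut X) \<Longrightarrow>
   \<exists>A. finite A \<and> (\<forall>a\<in>A. a \<in> C \<and> a \<subseteq> X) \<and> (\<forall>f\<in>Aut X. (\<forall>a\<in>A. f ` a = a) \<longrightarrow> f \<in> H)"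
proof (induction n arbitrary: p X)
  case 0
  have "f = id" if "f \<in> Aut X" for f
  proof
    fix x
    show "f x = id x" using 0(1) Aut_out[OF that, of x] Aut_mem[OF that, of x] by (cases "x = p") auto
  qed
  then have "f \<in> H" if "f \<in> Aut X" for f using 0(2) that by (auto simp: perm_group_def)
  then show ?case by (intro exI[of _ "{}"]) simp
next
  case (Suc n)
  obtain Y q where l: "layer p X Y" and Y: "\<And>i. omega_power n (q i) (Y i)" using Suc.prems(1) by auto
  interpret omega_layer C n p X Y q by unfold_locales (use l Y in auto)
  have small: "small_index H (Aut L)" using Suc.prems(3) by (simp add: Aut_X_eq)
  obtain k where k: "Aut (part {k..}) \<subseteq> H" by (rule tail_in_small_index[OF Suc.prems(2) small])
  have YL: "Y i \<subseteq> L" for i by (auto simp: part_def)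
  have YX: "f \<in> Aut (Y i) \<Longrightarrow> f \<in> Aut L" for f i
    using Aut_extend[OF _ YL regular_Y[OF l] regular_part] .
  have "small_index H (Aut (Y i))" for i
    using small YX unfolding small_index_def by meson
  then have "\<exists>A. finite A \<and> (\<forall>a\<in>A. a \<in> C \<and> a \<subseteq> Y i) \<and>
      (\<forall>f\<in>Aut (Y i). (\<forall>a\<in>A. f ` a = a) \<longrightarrow> f \<in> H)" for i
    using Suc.IH[OF Y Suc.prems(2)] by blast
  then obtain A where A: "\<And>i. finite (A i) \<and> (\<forall>a\<in>A i. a \<in> C \<and> a \<subseteq> Y i) \<and>
      (\<forall>f\<in>Aut (Y i). (\<forall>a\<in>A i. f ` a = a) \<longrightarrow> f \<in> H)" by metis
  define B where "B = (\<Union>i<k. insert (Y i) (A i))"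
  have "finite B" using A by (simp add: B_def)
  moreover have "a \<in> C \<and> a \<subseteq> X" if a: "a \<in> B" for a
  proof -
    obtain i where "a \<in> insert (Y i) (A i)" using a B_def by blast
    then show ?thesis using A[of i] layer_Y[OF l, of i] by blast
  qed
  moreover have "f \<in> H" if f: "f \<in> Aut X" "\<forall>a\<in>B. f ` a = a" for f
  proof (rule small_index_layer[OF Suc.prems(2) k _ B_def subset_refl])
    show "finite (A i) \<and> (\<forall>a\<in>A i. a \<in> C \<and> a \<subseteq> Y i) \<and>
      (\<forall>f\<in>Aut (Y i). (\<forall>a\<in>A i. f ` a = a) \<longrightarrow> f \<in> H)" for i by (rule A)
    show "f \<in> Aut L" using f(1) by (simp only: Aut_X_eq)
    show "f ` a = a" if "a \<in> B" for a using f(2) that by blast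
    show "f x = x" if "i < k" "i \<notin> {..<k}" for i x using that by simp
  qed
  ultimately have "finite B \<and> (\<forall>a\<in>B. a \<in> C \<and> a \<subseteq> X) \<and> (\<forall>f\<in>Aut X. (\<forall>a\<in>B. f ` a = a) \<longrightarrow> f \<in> H)"
    by simp
  then show ?case by (rule exI)
qed

section \<open>Ultrafilters of clopen sets\<close>

text \<open>An ultrafilter of the algebra of members of \<open>C\<close> below \<open>X\<close>.
  Other sets in \<open>F\<close> are unconstrained, so the same \<open>F\<close> is an ultrafilter
  for any piece that belongs to it.\<close>

definition prime_filter :: "'a set \<Rightarrow> 'a set set \<Rightarrow> bool" where
  "prime_filter X F \<longleftrightarrow> (\<forall>U\<in>C. U \<subseteq> X \<longrightarrow> (X - U \<in> F \<longleftrightarrow> U \<notin> F)) \<and>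
     (\<forall>U\<in>C. \<forall>V\<in>C. U \<subseteq> X \<longrightarrow> V \<subseteq> X \<longrightarrow> (U \<inter> V \<in> F \<longleftrightarrow> U \<in> F \<and> V \<in> F))"

text \<open>This is compactness. If \<open>F\<close> contains a piece, that piece gives the point by
  induction. Otherwise \<open>F\<close> contains no finite union of pieces, hence no clopen set
  avoiding \<open>p\<close>, and the point is \<open>p\<close>.\<close>

lemma prime_filter_principal:
  "omega_power n p X \<Longrightarrow> prime_filter X F \<Longrightarrow> \<exists>x\<in>X. \<forall>U\<in>C. U \<subseteq> X \<longrightarrow> (U \<in> F \<longleftrightarrow> x \<in> U)"
proof (induction n arbitrary: p X)
  case 0
  have co: "X - U \<in> F \<longleftrightarrow> U \<notin> F" and int: "U \<inter> V \<in> F \<longleftrightarrow> U \<in> F \<and> V \<in> F"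
    if "U \<in> C" "V \<in> C" "U \<subseteq> X" "V \<subseteq> X" for U V
    using 0(2) that by (simp_all add: prime_filter_def)
  have X: "X = {p}" "X \<in> C" using 0 by auto
  have "{} \<notin> F" "X \<in> F" using co[of "{}" "{}"] int[of "{}" X] X(2) by auto
  moreover have "U = {} \<or> U = X" if "U \<subseteq> X" for U using that X by auto
  ultimately show ?case using X by (intro bexI[of _ p]) auto
next
  case (Suc n)
  obtain Y q where l: "layer p X Y" and Y: "\<And>i. omega_power n (q i) (Y i)" using Suc.prems(1) by auto
  have co: "X - U \<in> F \<longleftrightarrow> U \<notin> F" if "U \<in> C" "U \<subseteq> X" for U
    using Suc.prems(2) that by (simp add: prime_filter_def)
  have int: "U \<inter> V \<in> F \<longleftrightarrow> U \<in> F \<and> V \<in> F" if "U \<in> C" "V \<in> C" "U \<subseteq> X" "V \<subseteq> X" for U V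
    using Suc.prems(2) that by (simp add: prime_filter_def)
  have XC: "X \<in> C" using layer_X[OF l] .
  show ?case
  proof (cases "\<exists>i. Y i \<in> F")
    case True
    then obtain i where i: "Y i \<in> F" by blast
    note YC = layer_Y(1)[OF l, of i] and YX = layer_Y(2)[OF l, of i]
    have "prime_filter (Y i) F"
      unfolding prime_filter_def
    proof (intro conjI ballI impI)
      fix U assume U: "U \<in> C" "U \<subseteq> Y i"
      have "Y i - U = Y i \<inter> (X - U)" using YX by blast
      then show "Y i - U \<in> F \<longleftrightarrow> U \<notin> F"
        using int[OF YC Diff_C[OF XC U(1)] YX] co[OF U(1)] U(2) YX i by auto
    next
      fix U V assume "U \<in> C" "V \<in> C" "U \<subseteq> Y i" "V \<subseteq> Y i"
      then show "U \<inter> V \<in> F \<longleftrightarrow> U \<in> F \<and> V \<in> F" using int YX by blast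
    qed
    from Suc.IH[OF Y this]
    obtain x where x: "x \<in> Y i" "\<forall>U\<in>C. U \<subseteq> Y i \<longrightarrow> (U \<in> F \<longleftrightarrow> x \<in> U)" by (elim bexE)
    have "U \<in> F \<longleftrightarrow> x \<in> U" if U: "U \<in> C" "U \<subseteq> X" for U
      using int[OF U(1) YC U(2) YX] i x(1) bspec[OF x(2) Int_C[OF U(1) YC]] by auto
    then show ?thesis using x(1) YX by blast
  next
    case False
    have un: "U \<union> V \<notin> F" if "U \<in> C" "V \<in> C" "U \<subseteq> X" "V \<subseteq> X" "U \<notin> F" "V \<notin> F" for U V
    proof -
      have "X - (U \<union> V) = (X - U) \<inter> (X - V)" by blast
      then have "X - (U \<union> V) \<in> F" using int[of "X - U" "X - V"] co that Diff_C[OF XC] by simp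
      then show ?thesis using co[of "U \<union> V"] that Un_C by simp
    qed
    have fin: "(\<Union>i\<in>I. Y i) \<notin> F \<and> (\<Union>i\<in>I. Y i) \<in> C" if "finite I" for I
      using that
    proof (induction I rule: finite_induct)
      case empty
      then show ?case using co[of "{}"] int[of "{}" X] XC by auto
    next
      case (insert i I)
      have "Y i \<union> (\<Union>i\<in>I. Y i) \<notin> F" using insert.IH False layer_Y(1,2)[OF l] by (intro un) auto
      then show ?case using insert.IH Un_C layer_Y(1)[OF l] by simp
    qed
    have np: "U \<notin> F" if U: "U \<in> C" "U \<subseteq> X" "p \<notin> U" for U
    proof -
      define V where "V = (\<Union>i\<in>{i. U \<inter> Y i \<noteq> {}}. Y i)"
      have UL: "U \<subseteq> (\<Union>i. Y i)" using U layer_eq[OF l] by blast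
      then have "U \<subseteq> V" unfolding V_def by blast
      then have UV: "U \<inter> V = U" by blast
      have V: "V \<notin> F" "V \<in> C" using fin[OF layer_finite[OF l U(1) UL]] by (simp_all add: V_def)
      have "V \<subseteq> X" using layer_Y(2)[OF l] by (auto simp: V_def)
      then show ?thesis using int[OF U(1) V(2) U(2)] V(1) unfolding UV by blast
    qed
    have "U \<in> F \<longleftrightarrow> p \<in> U" if U: "U \<in> C" "U \<subseteq> X" for U
      using np[OF U] np[OF Diff_C[OF XC U(1)]] co[OF U] by auto
    then show ?thesis using layer_p[OF l] by blast
  qed
qed

end

section \<open>Stone duality\<close>

locale stone_space = set_ring C for C :: "'a set set" +
  fixes n :: nat and p :: 'a and X :: "'a set"
  assumes space: "omega_power n p X" and C_sub: "\<And>U. U \<in> C \<Longrightarrow> U \<subseteq> X"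
begin

lemma XC: "X \<in> C"
  using omega_power_C[OF space] .

lemma points_eqI:
  assumes "x \<in> X" "y \<in> X" "\<And>U. U \<in> C \<Longrightarrow> x \<in> U \<longleftrightarrow> y \<in> U" shows "x = y"
  using omega_power_separated[OF space assms(1,2)] assms(3) by blast

definition lift :: "('a \<Rightarrow> 'a) \<Rightarrow> 'a set \<Rightarrow> 'a set" where
  "lift f = restrict ((`) f) C"

lemma lift_C: "f \<in> Aut X \<Longrightarrow> U \<in> C \<Longrightarrow> f ` U \<in> C"
  using Aut_C C_sub by blast

lemma lift_mem:
  assumes f: "f \<in> Aut X" shows "lift f \<in> boolean_auts X C"
proof -
  have inj: "inj f" using bij_is_inj[OF Aut_bij[OF f]] .
  have "bij_betw (lift f) C C"
    unfolding bij_betw_def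
  proof
    show "inj_on (lift f) C" using inj by (auto simp: lift_def inj_on_def inj_image_eq_iff)
    have "U \<in> lift f ` C" if U: "U \<in> C" for U
    proof
      show "finv f ` U \<in> C" using lift_C[OF inv_Aut[OF f] U] .
      then show "U = lift f (finv f ` U)" using Aut_bij[OF f] by (simp add: lift_def image_f_inv_f bij_is_surj)
    qed
    then show "lift f ` C = C" using lift_C[OF f] by (auto simp: lift_def)
  qed
  then have "lift f \<in> Bij C" by (simp add: Bij_def lift_def)
  moreover have "f ` (X - U) = X - f ` U" for U using image_set_diff[OF inj] Aut_image[OF f] by simp
  ultimately show ?thesis
    using Aut_image[OF f] XC Diff_C Un_C Int_C inj
    by (simp add: boolean_auts_def lift_def image_Int image_Un)
qed

text \<open>\<open>g\<close> carries the ultrafilter of clopen sets around \<open>x\<close> to an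
  ultrafilter, which is again that of a point.\<close>

lemma boolean_aut_point:
  assumes g: "g \<in> boolean_auts X C" and x: "x \<in> X"
  shows "\<exists>y\<in>X. \<forall>U\<in>C. y \<in> g U \<longleftrightarrow> x \<in> U"
proof -
  have bij: "bij_betw g C C" and compl: "\<And>U. U \<in> C \<Longrightarrow> g (X - U) = X - g U"
    and int: "\<And>U V. U \<in> C \<Longrightarrow> V \<in> C \<Longrightarrow> g (U \<inter> V) = g U \<inter> g V"
    using g by (auto simp: boolean_auts_def Bij_def)
  define F where "F = g ` {U\<in>C. x \<in> U}"
  have F: "g U \<in> F \<longleftrightarrow> x \<in> U" if "U \<in> C" for U
    using that bij by (auto simp: F_def bij_betw_def inj_on_def)
  have img: "\<exists>U\<in>C. V = g U" if "V \<in> C" for V using that bij by (auto simp: bij_betw_def)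
  have "prime_filter X F"
    unfolding prime_filter_def
  proof (intro conjI ballI impI)
    fix V assume "V \<in> C"
    then obtain U where U: "U \<in> C" "V = g U" using img by blast
    show "X - V \<in> F \<longleftrightarrow> V \<notin> F"
      unfolding U(2) compl[OF U(1), symmetric] F[OF U(1)] F[OF Diff_C[OF XC U(1)]] using x by simp
  next
    fix V V' assume "V \<in> C" "V' \<in> C"
    then obtain U U' where U: "U \<in> C" "V = g U" "U' \<in> C" "V' = g U'" using img by blast
    show "V \<inter> V' \<in> F \<longleftrightarrow> V \<in> F \<and> V' \<in> F"
      unfolding U(2,4) int[OF U(1,3), symmetric] F[OF U(1)] F[OF U(3)] F[OF Int_C[OF U(1,3)]] by simp
  qed
  from prime_filter_principal[OF space this]
  obtain y where y: "y \<in> X" "\<forall>V\<in>C. V \<subseteq> X \<longrightarrow> (V \<in> F \<longleftrightarrow> y \<in> V)" by (elim bexE)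
  have "y \<in> g U \<longleftrightarrow> x \<in> U" if "U \<in> C" for U
  proof -
    have "g U \<in> C" using bij that by (auto simp: bij_betw_def)
    then show ?thesis using bspec[OF y(2), of "g U"] F[OF that] C_sub by blast
  qed
  then show ?thesis using y(1) by blast
qed

text \<open>The map on points comes from \<open>boolean_aut_point\<close>; it is onto because the
  preimage under \<open>g\<close> of the ultrafilter at \<open>y\<close> is principal too.\<close>

lemma lift_surj:
  assumes g: "g \<in> boolean_auts X C" obtains f where "f \<in> Aut X" "g = lift f"
proof -
  have ext: "g \<in> extensional C" and bij: "bij_betw g C C" using g by (auto simp: boolean_auts_def Bij_def)
  have "\<forall>x\<in>X. \<exists>y. y \<in> X \<and> (\<forall>U\<in>C. y \<in> g U \<longleftrightarrow> x \<in> U)" using boolean_aut_point[OF g] by blast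
  then obtain f where fX: "\<And>x. x \<in> X \<Longrightarrow> f x \<in> X" and f: "\<And>x U. x \<in> X \<Longrightarrow> U \<in> C \<Longrightarrow> f x \<in> g U \<longleftrightarrow> x \<in> U"
    by metis
  have img: "\<exists>U\<in>C. V = g U" if "V \<in> C" for V using that bij by (auto simp: bij_betw_def)
  have gC: "g U \<in> C" if "U \<in> C" for U using that bij by (auto simp: bij_betw_def)
  have inj: "inj_on f X"
  proof (rule inj_onI)
    fix x y assume xy: "x \<in> X" "y \<in> X" "f x = f y"
    show "x = y" by (rule points_eqI[OF xy(1,2)]) (use f xy in metis)
  qed
  have surj: "y \<in> f ` X" if y: "y \<in> X" for y
  proof -
    define F where "F = {U\<in>C. y \<in> g U}"
    have "prime_filter X F"
      unfolding prime_filter_def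
    proof (intro conjI ballI impI)
      fix U assume U: "U \<in> C"
      have "g (X - U) = X - g U" using g U by (simp add: boolean_auts_def)
      then show "X - U \<in> F \<longleftrightarrow> U \<notin> F" using U y Diff_C[OF XC U] by (simp add: F_def)
    next
      fix U V assume U: "U \<in> C" "V \<in> C"
      then have "g (U \<inter> V) = g U \<inter> g V" using g by (simp add: boolean_auts_def)
      then show "U \<inter> V \<in> F \<longleftrightarrow> U \<in> F \<and> V \<in> F" using U Int_C[OF U] by (simp add: F_def)
    qed
    from prime_filter_principal[OF space this]
    obtain x where x: "x \<in> X" "\<forall>U\<in>C. U \<subseteq> X \<longrightarrow> (U \<in> F \<longleftrightarrow> x \<in> U)" by (elim bexE)
    have "f x = y"
    proof (rule points_eqI[OF fX[OF x(1)] y])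
      fix V assume "V \<in> C"
      then obtain U where U: "U \<in> C" "V = g U" using img by blast
      have "y \<in> g U \<longleftrightarrow> x \<in> U" using bspec[OF x(2) U(1)] C_sub[OF U(1)] U(1) by (simp add: F_def)
      then show "f x \<in> V \<longleftrightarrow> y \<in> V" using f[OF x(1) U(1)] U(2) by simp
    qed
    then show ?thesis using x(1) by blast
  qed
  have bf: "bij_betw f X X" using inj surj fX by (auto simp: bij_betw_def)
  have im: "f ` U = g U" if U: "U \<in> C" for U
  proof
    show "f ` U \<subseteq> g U" using f[OF _ U] C_sub[OF U] by auto
    show "g U \<subseteq> f ` U"
    proof
      fix y assume y: "y \<in> g U"
      then have "y \<in> f ` X" using surj C_sub[OF gC[OF U]] by blast
      then show "y \<in> f ` U" using f[OF _ U] y by auto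
    qed
  qed
  have "U \<in> C \<longleftrightarrow> f ` U \<in> C" if U: "U \<subseteq> X" for U
  proof
    assume "f ` U \<in> C"
    then obtain V where V: "V \<in> C" "f ` U = g V" using img by blast
    then have "f ` U = f ` V" using im by simp
    then have "U = V" using inj_on_image_eq_iff[OF inj U C_sub[OF V(1)]] by simp
    then show "U \<in> C" using V by simp
  qed (use im gC in simp)
  then have "homeo X X f" using bf by (simp add: homeo_def)
  then have h: "(\<lambda>x. if x \<in> X then f x else x) \<in> Aut X" (is "?f \<in> _") by (rule homeo_Aut)
  have "g = lift ?f"
  proof (rule extensionalityI[OF ext])
    show "lift ?f \<in> extensional C" by (simp add: lift_def)
    fix U assume U: "U \<in> C"
    then have "?f ` U = f ` U" using C_sub by (intro image_cong) auto
    then show "g U = lift ?f U" using U im by (simp add: lift_def)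
  qed
  then show thesis using h that by blast
qed

lemma lift_inj:
  assumes f: "f \<in> Aut X" and g: "g \<in> Aut X" and eq: "lift f = lift g" shows "f = g"
proof
  have *: "f ` U = g ` U" if "U \<in> C" for U using fun_cong[OF eq, of U] that by (simp add: lift_def)
  fix x show "f x = g x"
  proof (cases "x \<in> X")
    case True
    show ?thesis
    proof (rule points_eqI)
      show "f x \<in> X" "g x \<in> X" using True Aut_mem f g by blast+
      fix V assume V: "V \<in> C"
      define U where "U = finv f ` V"
      have U: "U \<in> C" unfolding U_def using lift_C[OF inv_Aut[OF f] V] .
      have V': "V = f ` U" using Aut_bij[OF f] by (simp add: U_def image_f_inv_f bij_is_surj)
      then have "f x \<in> V \<longleftrightarrow> x \<in> U" using Aut_inj[OF f] by auto
      moreover have "g x \<in> V \<longleftrightarrow> x \<in> U" unfolding V' *[OF U] using Aut_inj[OF g] by auto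
      ultimately show "f x \<in> V \<longleftrightarrow> g x \<in> V" by simp
    qed
  next
    case False
    then show ?thesis using Aut_out f g by metis
  qed
qed

abbreviation "G \<equiv> boolean_aut_group X C"

lemma carrier_G: "carrier G = boolean_auts X C"
  by (simp add: boolean_aut_group_def)

lemma lift_mult:
  assumes "f \<in> Aut X" "g \<in> Aut X" shows "lift f \<otimes>\<^bsub>G\<^esub> lift g = lift (f \<circ> g)"
proof -
  have B: "lift f \<in> Bij C" "lift g \<in> Bij C" using assms lift_mem by (auto simp: boolean_auts_def)
  have "compose C (lift f) (lift g) = lift (f \<circ> g)"
    using lift_C[OF assms(2)] by (auto simp: lift_def compose_def fun_eq_iff image_comp[symmetric])
  then show ?thesis using B by (simp add: boolean_aut_group_def BijGroup_def)
qed

lemma lift_one: "\<one>\<^bsub>G\<^esub> = lift id"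
  by (simp add: boolean_aut_group_def BijGroup_def lift_def restrict_def fun_eq_iff)

lemma lift_inv:
  assumes f: "f \<in> Aut X" shows "inv\<^bsub>G\<^esub> (lift f) = lift (finv f)"
  unfolding m_inv_def
proof (rule the_equality)
  note f' = inv_Aut[OF f]
  have c: "f \<circ> finv f = id" "finv f \<circ> f = id"
    using Aut_bij[OF f] by (simp_all add: fun_eq_iff bij_is_surj surj_f_inv_f bij_is_inj)
  show "lift (finv f) \<in> carrier G \<and> lift f \<otimes>\<^bsub>G\<^esub> lift (finv f) = \<one>\<^bsub>G\<^esub> \<and> lift (finv f) \<otimes>\<^bsub>G\<^esub> lift f = \<one>\<^bsub>G\<^esub>"
    using lift_mem[OF f'] lift_mult[OF f f'] lift_mult[OF f' f] c by (simp add: carrier_G lift_one)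
  fix y assume y: "y \<in> carrier G \<and> lift f \<otimes>\<^bsub>G\<^esub> y = \<one>\<^bsub>G\<^esub> \<and> y \<otimes>\<^bsub>G\<^esub> lift f = \<one>\<^bsub>G\<^esub>"
  then obtain g where g: "g \<in> Aut X" "y = lift g" using lift_surj by (auto simp: carrier_G)
  then have "lift (f \<circ> g) = lift id" using y lift_mult[OF f g(1)] lift_one by simp
  then have "f \<circ> g = id" using lift_inj[OF comp_Aut[OF f g(1)] id_Aut(1)] by blast
  then have "finv f \<circ> (f \<circ> g) = finv f" by simp
  then have "g = finv f" using c by (metis comp_assoc id_comp)
  then show "y = lift (finv f)" using g by simp
qed

text \<open>\<open>rcosets\<close> consists of right cosets, whereas the equation
  \<open>g = f \<circ> h\<close> concerns left cosets, as in \<open>small_index\<close>. Passing to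
  inverses exchanges the two.\<close>

lemma coset_eq_lift:
  assumes H: "subgroup H G" and f: "f \<in> Aut X" and g: "g \<in> Aut X"
    and eq: "H #>\<^bsub>G\<^esub> lift (finv f) = H #>\<^bsub>G\<^esub> lift (finv g)"
  shows "\<exists>h\<in>Aut X. lift h \<in> H \<and> g = f \<circ> h"
proof -
  have "lift id \<in> H" using subgroup.one_closed[OF H] lift_one by simp
  moreover have "lift id \<otimes>\<^bsub>G\<^esub> lift (finv g) = lift (finv g)" using lift_mult[OF id_Aut(1) inv_Aut[OF g]] by simp
  ultimately have "lift (finv g) \<in> H #>\<^bsub>G\<^esub> lift (finv g)" unfolding r_coset_def by force
  then have "lift (finv g) \<in> H #>\<^bsub>G\<^esub> lift (finv f)" unfolding eq .
  then obtain y where y: "y \<in> H" "lift (finv g) = y \<otimes>\<^bsub>G\<^esub> lift (finv f)" by (auto simp: r_coset_def)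
  then obtain h where h: "h \<in> Aut X" "y = lift h"
    using lift_surj subgroup.subset[OF H] by (auto simp: carrier_G)
  then have "lift (finv g) = lift (h \<circ> finv f)" using y lift_mult[OF h(1) inv_Aut[OF f]] by simp
  then have e: "finv g = h \<circ> finv f" using lift_inj inv_Aut[OF g] comp_Aut[OF h(1) inv_Aut[OF f]] by blast
  have "g = f \<circ> finv h"
  proof
    fix x
    have "finv g (f (finv h x)) = x"
      unfolding e using Aut_bij[OF f] Aut_bij[OF h(1)] by (simp add: bij_is_inj bij_is_surj surj_f_inv_f)
    then show "g x = (f \<circ> finv h) x" using Aut_bij[OF g] by (metis bij_inv_eq_iff comp_apply)
  qed
  moreover have "lift (finv h) \<in> H" using subgroup.m_inv_closed[OF H y(1)] h lift_inv by simp
  ultimately show ?thesis using inv_Aut[OF h(1)] by blast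
qed

text \<open>If \<open>small_index\<close> failed, a family indexed by all sets of naturals would
  give continuum many distinct cosets.\<close>

theorem small_index_property: "small_index_property X C"
  unfolding small_index_property_def
proof (intro allI impI)
  fix H assume "subgroup H G \<and> |rcosets\<^bsub>G\<^esub> H| <o ctwo ^c natLeq"
  then have H: "subgroup H G" and card: "|rcosets\<^bsub>G\<^esub> H| <o ctwo ^c natLeq" by auto
  define H' where "H' = {f \<in> Aut X. lift f \<in> H}"
  have "id \<in> H'" using subgroup.one_closed[OF H] lift_one id_Aut by (simp add: H'_def)
  moreover have "f \<circ> g \<in> H'" if "f \<in> H'" "g \<in> H'" for f g
    using that subgroup.m_closed[OF H, of "lift f" "lift g"] lift_mult comp_Aut by (simp add: H'_def)
  moreover have "bij f \<and> finv f \<in> H'" if "f \<in> H'" for f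
    using that subgroup.m_inv_closed[OF H, of "lift f"] lift_inv inv_Aut Aut_bij[of f X] by (simp add: H'_def)
  ultimately have pg: "perm_group H'" by (simp add: perm_group_def)
  have "small_index H' (Aut X)"
    unfolding small_index_def
  proof (intro allI impI, rule ccontr)
    fix F :: "nat set \<Rightarrow> 'a \<Rightarrow> 'a"
    assume F: "\<forall>S. F S \<in> Aut X" and no: "\<not> (\<exists>S T h. S \<noteq> T \<and> h \<in> H' \<and> F T = F S \<circ> h)"
    define K where "K S = H #>\<^bsub>G\<^esub> lift (finv (F S))" for S
    have "S = T" if KK: "K S = K T" for S T
    proof (rule ccontr)
      assume "S \<noteq> T"
      obtain h where "h \<in> Aut X" "lift h \<in> H" "F T = F S \<circ> h"
        using coset_eq_lift[OF H _ _ KK[unfolded K_def]] F by blast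
      then have "S \<noteq> T \<and> h \<in> H' \<and> F T = F S \<circ> h" using \<open>S \<noteq> T\<close> by (simp add: H'_def)
      then show False using no by blast
    qed
    then have "inj K" by (rule injI)
    moreover have "range K \<subseteq> rcosets\<^bsub>G\<^esub> H"
      using lift_mem[OF inv_Aut] F by (auto simp: K_def RCOSETS_def carrier_G)
    ultimately have "|UNIV :: nat set set| \<le>o |rcosets\<^bsub>G\<^esub> H|" using card_of_ordLeq by blast
    moreover have "|UNIV :: nat set set| =o ctwo ^c natLeq"
      using card_of_Pow_Func[of "UNIV :: nat set"] by (simp add: cexp_def ctwo_def Field_natLeq Field_card_of)
    ultimately have "ctwo ^c natLeq \<le>o |rcosets\<^bsub>G\<^esub> H|" using ordIso_ordLeq_trans ordIso_symmetric by blast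
    then show False using card not_ordLess_ordLeq by blast
  qed
  from omega_power_small_index[OF space pg this]
  obtain A where A: "finite A" "\<And>a. a \<in> A \<Longrightarrow> a \<in> C"
    and AH: "\<forall>f\<in>Aut X. (\<forall>a\<in>A. f ` a = a) \<longrightarrow> f \<in> H'" by (elim exE conjE) simp
  have "g \<in> H" if g: "g \<in> pointwise_stabilizer G A" for g
  proof -
    obtain f where f: "f \<in> Aut X" "g = lift f"
      using g lift_surj by (auto simp: pointwise_stabilizer_def carrier_G)
    have "f ` a = a" if a: "a \<in> A" for a
    proof -
      have "g a = a" using g a by (simp add: pointwise_stabilizer_def)
      then show ?thesis using f(2) A(2)[OF a] by (simp add: lift_def)
    qed
    then have "f \<in> H'" using AH f(1) by simp
    then show ?thesis using f(2) by (simp add: H'_def)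
  qed
  then show "\<exists>A. finite A \<and> A \<subseteq> C \<and> pointwise_stabilizer G A \<subseteq> H" using A by blast
qed

end

section \<open>Order topologies\<close>

locale partial_ord =
  fixes r :: "'a rel"
  assumes antisym: "(x, y) \<in> r \<Longrightarrow> (y, x) \<in> r \<Longrightarrow> x = y"
    and trans: "(x, y) \<in> r \<Longrightarrow> (y, z) \<in> r \<Longrightarrow> (x, z) \<in> r"
begin

definition less :: "'a \<Rightarrow> 'a \<Rightarrow> bool" (infix "\<ll>" 50) where
  "x \<ll> y \<longleftrightarrow> (x, y) \<in> r \<and> x \<noteq> y"

lemma less_trans: "x \<ll> y \<Longrightarrow> y \<ll> z \<Longrightarrow> x \<ll> z"
  using antisym trans unfolding less_def by blast

lemma le_less_trans: "(x, y) \<in> r \<Longrightarrow> y \<ll> z \<Longrightarrow> x \<ll> z"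
  using antisym trans unfolding less_def by blast

lemma not_less: "x \<ll> y \<Longrightarrow> (y, x) \<notin> r"
  using antisym unfolding less_def by blast

lemma less_irrefl: "\<not> x \<ll> x"
  by (simp add: less_def)

text \<open>\<open>omega_interval n p S\<close>: \<open>S\<close> is a copy of \<open>[1, \<omega>\<^sup>n]\<close> with greatest element \<open>p\<close>,
  namely an \<open>\<omega>\<close>-sequence of consecutive copies of \<open>[1, \<omega>\<^sup>n\<^sup>-\<^sup>1]\<close> followed by \<open>p\<close>.\<close>

fun omega_interval :: "nat \<Rightarrow> 'a \<Rightarrow> 'a set \<Rightarrow> bool" where
  "omega_interval 0 p S \<longleftrightarrow> S = {p} \<and> (p, p) \<in> r"
| "omega_interval (Suc n) p S \<longleftrightarrow> (\<exists>(Y :: nat \<Rightarrow> 'a set) q. S = insert p (\<Union>i. Y i) \<and> (p, p) \<in> r \<and>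
     (\<forall>i. omega_interval n (q i) (Y i)) \<and> (\<forall>i. \<forall>x\<in>Y i. x \<ll> p) \<and>
     (\<forall>i j. i < j \<longrightarrow> (\<forall>x\<in>Y i. \<forall>y\<in>Y j. x \<ll> y)))"

lemma omega_interval_SucE:
  assumes "omega_interval (Suc n) p S"
  obtains Y :: "nat \<Rightarrow> 'a set" and q where "S = insert p (\<Union>i. Y i)" "(p, p) \<in> r"
    "\<And>i. omega_interval n (q i) (Y i)" "\<And>i x. x \<in> Y i \<Longrightarrow> x \<ll> p"
    "\<And>i j x y. i < j \<Longrightarrow> x \<in> Y i \<Longrightarrow> y \<in> Y j \<Longrightarrow> x \<ll> y"
proof -
  from assms obtain Y q where "S = insert p (\<Union>i. Y i) \<and> (p, p) \<in> r \<and>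
     (\<forall>i. omega_interval n (q i) (Y i)) \<and> (\<forall>i. \<forall>x\<in>Y i. x \<ll> p) \<and>
     (\<forall>i j :: nat. i < j \<longrightarrow> (\<forall>x\<in>Y i. \<forall>y\<in>Y j. x \<ll> y))"
    unfolding omega_interval.simps by (elim exE)
  then show thesis by (intro that[of Y q]) simp_all
qed

lemma omega_interval_max:
  "omega_interval n p S \<Longrightarrow> p \<in> S \<and> (\<forall>x\<in>S. (x, p) \<in> r)"
  by (cases n) (auto simp: less_def)

lemma omega_interval_total:
  "omega_interval n p S \<Longrightarrow> x \<in> S \<Longrightarrow> y \<in> S \<Longrightarrow> (x, y) \<in> r \<or> y \<ll> x"
proof (induction n arbitrary: p S x y)
  case (Suc n)
  obtain Y :: "nat \<Rightarrow> 'a set" and q where S: "S = insert p (\<Union>i. Y i)" "(p, p) \<in> r"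
    and Y: "\<And>i. omega_interval n (q i) (Y i)" and top: "\<And>i x. x \<in> Y i \<Longrightarrow> x \<ll> p"
    and lt: "\<And>i j x y. i < j \<Longrightarrow> x \<in> Y i \<Longrightarrow> y \<in> Y j \<Longrightarrow> x \<ll> y"
    by (rule omega_interval_SucE[OF Suc.prems(1)]) (rule that)
  consider "y = p" | "x = p" "y \<noteq> p" | i j where "x \<in> Y i" "y \<in> Y j" using Suc.prems(2,3) S by blast
  then show ?case
  proof cases
    case 1
    then show ?thesis using omega_interval_max[OF Suc.prems(1)] Suc.prems(2) by blast
  next
    case 2
    then show ?thesis using omega_interval_max[OF Suc.prems(1)] Suc.prems(3) by (simp add: less_def)
  next
    case (3 i j)
    consider "i < j" | "j < i" | "i = j" by linarith
    then show ?thesis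
    proof cases
      case 1 then show ?thesis using lt[OF 1 3] by (simp add: less_def)
    next
      case 2 then show ?thesis using lt[OF 2 3(2,1)] by simp
    next
      case e: 3 then show ?thesis using Suc.IH[OF Y, of x i y] 3 by simp
    qed
  qed
qed simp

lemma omega_interval_min: "omega_interval n p S \<Longrightarrow> \<exists>m\<in>S. \<forall>x\<in>S. (m, x) \<in> r"
proof (induction n arbitrary: p S)
  case (Suc n)
  obtain Y :: "nat \<Rightarrow> 'a set" and q where S: "S = insert p (\<Union>i. Y i)" "(p, p) \<in> r"
    and Y: "\<And>i. omega_interval n (q i) (Y i)" and top: "\<And>i x. x \<in> Y i \<Longrightarrow> x \<ll> p"
    and lt: "\<And>i j x y. i < j \<Longrightarrow> x \<in> Y i \<Longrightarrow> y \<in> Y j \<Longrightarrow> x \<ll> y"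
    by (rule omega_interval_SucE[OF Suc.prems(1)]) (rule that)
  obtain m where m: "m \<in> Y 0" "\<And>x. x \<in> Y 0 \<Longrightarrow> (m, x) \<in> r" using Suc.IH[OF Y] by blast
  have "(m, x) \<in> r" if x: "x \<in> S" for x
  proof (cases "x = p")
    case True
    then show ?thesis using top[OF m(1)] by (simp add: less_def)
  next
    case False
    then obtain i where i: "x \<in> Y i" using x S by blast
    show ?thesis using m(2)[of x] lt[of 0 i m x] i m(1) by (cases "i = 0") (auto simp: less_def)
  qed
  then show ?case using m S by blast
qed auto

text \<open>The successor lies in the same piece unless \<open>x\<close> is its greatest element;
  then it is the least element of the next piece. It is what makes closed initial segments
  open.\<close>

lemma omega_interval_succ:
  "omega_interval n p S \<Longrightarrow> x \<in> S \<Longrightarrow> x \<noteq> p \<Longrightarrow> \<exists>y\<in>S. x \<ll> y \<and> (\<forall>z\<in>S. x \<ll> z \<longrightarrow> (y, z) \<in> r)"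
proof (induction n arbitrary: p S x)
  case (Suc n)
  obtain Y :: "nat \<Rightarrow> 'a set" and q where S: "S = insert p (\<Union>i. Y i)" "(p, p) \<in> r"
    and Y: "\<And>i. omega_interval n (q i) (Y i)" and top: "\<And>i x. x \<in> Y i \<Longrightarrow> x \<ll> p"
    and lt: "\<And>i j x y. i < j \<Longrightarrow> x \<in> Y i \<Longrightarrow> y \<in> Y j \<Longrightarrow> x \<ll> y"
    by (rule omega_interval_SucE[OF Suc.prems(1)]) (rule that)
  obtain i where i: "x \<in> Y i" using Suc.prems S by blast
  have "\<exists>j y. y \<in> Y j \<and> x \<ll> y \<and> i \<le> j \<and> (\<forall>l z. z \<in> Y l \<longrightarrow> x \<ll> z \<longrightarrow> l \<le> j \<longrightarrow> (y, z) \<in> r)"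
  proof (cases "x = q i")
    case False
    obtain y where y: "y \<in> Y i" "x \<ll> y" "\<forall>z\<in>Y i. x \<ll> z \<longrightarrow> (y, z) \<in> r" using Suc.IH[OF Y i False] by blast
    have "(y, z) \<in> r" if z: "z \<in> Y l" "x \<ll> z" "l \<le> i" for l z
    proof (cases "l = i")
      case True then show ?thesis using y z by blast
    next
      case False
      then have "z \<ll> x" using lt[of l i z x] i z by simp
      then show ?thesis using z(2) not_less by (auto simp: less_def)
    qed
    then show ?thesis using y by blast
  next
    case True
    obtain m where m: "m \<in> Y (Suc i)" "\<And>z. z \<in> Y (Suc i) \<Longrightarrow> (m, z) \<in> r"
      using omega_interval_min[OF Y] by blast
    have "(m, z) \<in> r" if z: "z \<in> Y l" "x \<ll> z" "l \<le> Suc i" for l z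
    proof (cases "l = Suc i")
      case True then show ?thesis using m z by blast
    next
      case False
      have "(z, x) \<in> r"
      proof (cases "l = i")
        case l: True
        then have "(z, q i) \<in> r" using omega_interval_max[OF Y[of i]] z(1) by simp
        then show ?thesis using True by simp
      next
        case l: False
        then show ?thesis using lt[of l i z x] i z False by (simp add: less_def)
      qed
      then show ?thesis using z(2) not_less by blast
    qed
    moreover have "x \<ll> m" using lt[of i "Suc i" x m] i m by simp
    ultimately show ?thesis using m by (intro exI[of _ "Suc i"] exI[of _ m]) auto
  qed
  then obtain j y where y: "y \<in> Y j" "x \<ll> y" "\<And>l z. z \<in> Y l \<Longrightarrow> x \<ll> z \<Longrightarrow> l \<le> j \<Longrightarrow> (y, z) \<in> r" by blast
  have "(y, z) \<in> r" if z: "z \<in> S" "x \<ll> z" for z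
  proof (cases "z = p")
    case True
    then show ?thesis using top[OF y(1)] by (simp add: less_def)
  next
    case False
    then obtain l where l: "z \<in> Y l" using z S by blast
    show ?thesis using y(3)[OF l z(2)] lt[of j l y z] y(1) l by (cases "l \<le> j") (auto simp: less_def)
  qed
  then show ?case using y S by blast
qed simp

text \<open>The neighbourhoods of \<open>x\<close> in a well-ordered \<open>S\<close> are generated by the left-open
  intervals ending at \<open>x\<close>. So clopen means constant near \<open>x\<close> on the left of \<open>x\<close>, for all \<open>x\<close>.\<close>

definition left_locally :: "'a set \<Rightarrow> ('a \<Rightarrow> bool) \<Rightarrow> 'a \<Rightarrow> bool" where
  "left_locally S P x \<longleftrightarrow> (\<forall>y\<in>S. (y, x) \<in> r \<longrightarrow> P y) \<or>
     (\<exists>a\<in>S. a \<ll> x \<and> (\<forall>y\<in>S. a \<ll> y \<longrightarrow> (y, x) \<in> r \<longrightarrow> P y))"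

definition left_constant :: "'a set \<Rightarrow> 'a set \<Rightarrow> bool" where
  "left_constant S U \<longleftrightarrow> (\<forall>x\<in>S. left_locally S (\<lambda>y. y \<in> U \<longleftrightarrow> x \<in> U) x)"

lemma left_locally_mono: "left_locally S P x \<Longrightarrow> (\<And>y. y \<in> S \<Longrightarrow> P y \<Longrightarrow> Q y) \<Longrightarrow> left_locally S Q x"
  unfolding left_locally_def by blast

lemma left_locally_conj:
  assumes tot: "\<And>x y. x \<in> S \<Longrightarrow> y \<in> S \<Longrightarrow> (x, y) \<in> r \<or> y \<ll> x"
    and P: "left_locally S P x" and Q: "left_locally S Q x"
  shows "left_locally S (\<lambda>y. P y \<and> Q y) x"
proof -
  consider "\<forall>y\<in>S. (y, x) \<in> r \<longrightarrow> P y" | "\<forall>y\<in>S. (y, x) \<in> r \<longrightarrow> Q y"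
    | a b where "a \<in> S" "a \<ll> x" "\<forall>y\<in>S. a \<ll> y \<longrightarrow> (y, x) \<in> r \<longrightarrow> P y"
        "b \<in> S" "b \<ll> x" "\<forall>y\<in>S. b \<ll> y \<longrightarrow> (y, x) \<in> r \<longrightarrow> Q y"
    using P Q unfolding left_locally_def by blast
  then show ?thesis
  proof cases
    case 1 then show ?thesis using Q unfolding left_locally_def by blast
  next
    case 2 then show ?thesis using P unfolding left_locally_def by blast
  next
    case (3 a b)
    show ?thesis
    proof (cases "(a, b) \<in> r")
      case True
      then have "b \<ll> y \<Longrightarrow> a \<ll> y" for y by (rule le_less_trans)
      then show ?thesis using 3 unfolding left_locally_def by blast
    next
      case False
      then have "b \<ll> a" using tot 3 by blast
      then have "a \<ll> y \<Longrightarrow> b \<ll> y" for y by (rule less_trans)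
      then show ?thesis using 3 unfolding left_locally_def by blast
    qed
  qed
qed

section \<open>Clopen sets of the order topology\<close>

context
  fixes S n p
  assumes S: "omega_interval n p S"
begin

lemma topspace_order: "topspace (order_topology_on S r) = S"
  unfolding order_topology_on_def topology_generated_by_topspace by auto

text \<open>Induction over the generation by rays: a ray below \<open>a\<close> contains with
  \<open>x\<close> everything below \<open>x\<close>, and a ray above \<open>a\<close> contains
  everything from \<open>a\<close>, exclusive, to \<open>x\<close>.\<close>

lemma openin_order_left:
  assumes "openin (order_topology_on S r) U" and "x \<in> U"
  shows "left_locally S (\<lambda>y. y \<in> U) x"
proof -
  have "generate_topology_on (insert S ({{x \<in> S. (x, a) \<in> r - Id} | a. a \<in> S} \<union> {{x \<in> S. (a, x) \<in> r - Id} | a. a \<in> S})) U"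
    using assms(1) by (simp add: order_topology_on_def openin_topology_generated_by_iff)
  then show ?thesis using assms(2)
  proof (induction arbitrary: x rule: generate_topology_on.induct)
    case (Int U V)
    show ?case using left_locally_conj[OF omega_interval_total[OF S] Int.IH(1) Int.IH(2)] Int.prems by simp
  next
    case (UN K)
    obtain k where k: "k \<in> K" "x \<in> k" using UN.prems by (rule UnionE)
    show ?case by (rule left_locally_mono[OF UN.IH[OF k]]) (use k(1) in blast)
  next
    case (Basis B)
    from Basis.hyps consider "B = S" | a where "B = {x \<in> S. (x, a) \<in> r - Id}" | a where "a \<in> S" "B = {x \<in> S. (a, x) \<in> r - Id}"
      by blast
    then show ?case
    proof cases
      case 1 then show ?thesis by (simp add: left_locally_def)
    next
      case (2 a)
      then have "x \<ll> a" using Basis.prems by (simp add: less_def)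
      then have "y \<ll> a" if "(y, x) \<in> r" for y using le_less_trans that by blast
      then show ?thesis using 2 by (simp add: left_locally_def less_def)
    next
      case (3 a)
      then have "a \<ll> x" using Basis.prems by (simp add: less_def)
      then show ?thesis using 3 by (auto simp: left_locally_def less_def)
    qed
  qed simp
qed

lemma openin_order_ray:
  assumes a: "a \<in> S"
  shows "openin (order_topology_on S r) {x\<in>S. x \<ll> a}"
    and "openin (order_topology_on S r) {x\<in>S. a \<ll> x}"
proof -
  have *: "{x\<in>S. x \<ll> a} = {x \<in> S. (x, a) \<in> r - Id}" "{x\<in>S. a \<ll> x} = {x \<in> S. (a, x) \<in> r - Id}"
    by (auto simp: less_def)
  show "openin (order_topology_on S r) {x\<in>S. x \<ll> a}" "openin (order_topology_on S r) {x\<in>S. a \<ll> x}"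
    unfolding * order_topology_on_def by (rule topology_generated_by_Basis; use a in blast)+
qed

lemma openin_order_initial:
  assumes x: "x \<in> S" shows "openin (order_topology_on S r) {y\<in>S. (y, x) \<in> r}"
proof (cases "x = p")
  case True
  then have "{y\<in>S. (y, x) \<in> r} = topspace (order_topology_on S r)"
    using omega_interval_max[OF S] topspace_order by auto
  then show ?thesis using openin_topspace by metis
next
  case False
  obtain z where z: "z \<in> S" "x \<ll> z" "\<And>y. y \<in> S \<Longrightarrow> x \<ll> y \<Longrightarrow> (z, y) \<in> r"
    using omega_interval_succ[OF S x False] by blast
  have "(y, x) \<in> r \<longleftrightarrow> y \<ll> z" if y: "y \<in> S" for y
  proof
    assume "y \<ll> z"
    then have "\<not> x \<ll> y" using z(3)[OF y] not_less by blast
    then show "(y, x) \<in> r" using omega_interval_total[OF S y x] by blast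
  qed (use z(2) le_less_trans in blast)
  then have "{y\<in>S. (y, x) \<in> r} = {y\<in>S. y \<ll> z}" by blast
  then show ?thesis using openin_order_ray(1)[OF z(1)] by simp
qed

lemma left_openin_order:
  assumes U: "U \<subseteq> S" "\<And>x. x \<in> U \<Longrightarrow> left_locally S (\<lambda>y. y \<in> U) x"
  shows "openin (order_topology_on S r) U"
proof (subst openin_subopen, intro ballI)
  fix x assume x: "x \<in> U"
  then have xS: "x \<in> S" using U by blast
  have xx: "(x, x) \<in> r" using omega_interval_total[OF S xS xS] less_irrefl by blast
  consider "\<forall>y\<in>S. (y, x) \<in> r \<longrightarrow> y \<in> U"
    | a where "a \<in> S" "a \<ll> x" "\<forall>y\<in>S. a \<ll> y \<longrightarrow> (y, x) \<in> r \<longrightarrow> y \<in> U"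
    using U(2)[OF x] unfolding left_locally_def by blast
  then show "\<exists>T. openin (order_topology_on S r) T \<and> x \<in> T \<and> T \<subseteq> U"
  proof cases
    case 1
    then show ?thesis using openin_order_initial[OF xS] xS xx by (intro exI[of _ "{y\<in>S. (y, x) \<in> r}"]) auto
  next
    case (2 a)
    then show ?thesis
      using openin_Int[OF openin_order_initial[OF xS] openin_order_ray(2)[OF 2(1)]] xS xx
      by (intro exI[of _ "{y\<in>S. (y, x) \<in> r} \<inter> {y\<in>S. a \<ll> y}"]) auto
  qed
qed

lemma clopens_order: "clopens (order_topology_on S r) = {U. U \<subseteq> S \<and> left_constant S U}"
proof (intro equalityI subsetI)
  fix U assume "U \<in> clopens (order_topology_on S r)"
  then have U: "openin (order_topology_on S r) U" "openin (order_topology_on S r) (S - U)" "U \<subseteq> S"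
    by (simp_all add: clopens_def closedin_def topspace_order)
  have "left_locally S (\<lambda>y. y \<in> U \<longleftrightarrow> x \<in> U) x" if x: "x \<in> S" for x
  proof (cases "x \<in> U")
    case True
    then show ?thesis using left_locally_mono[OF openin_order_left[OF U(1) True]] by simp
  next
    case False
    then have "x \<in> S - U" using x by blast
    then show ?thesis using left_locally_mono[OF openin_order_left[OF U(2)]] False by simp
  qed
  then show "U \<in> {U. U \<subseteq> S \<and> left_constant S U}" using U(3) by (simp add: left_constant_def)
next
  fix U assume "U \<in> {U. U \<subseteq> S \<and> left_constant S U}"
  then have U: "U \<subseteq> S" and lc: "\<And>x. x \<in> S \<Longrightarrow> left_locally S (\<lambda>y. y \<in> U \<longleftrightarrow> x \<in> U) x"
    by (auto simp: left_constant_def)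
  have "openin (order_topology_on S r) U"
    by (rule left_openin_order[OF U]) (use lc U in \<open>auto intro!: left_locally_mono[OF lc]\<close>)
  moreover have "openin (order_topology_on S r) (S - U)"
    by (rule left_openin_order) (use lc U in \<open>auto intro!: left_locally_mono[OF lc]\<close>)
  ultimately show "U \<in> clopens (order_topology_on S r)"
    using U by (simp add: clopens_def closedin_def topspace_order)
qed

end

text \<open>This is the condition in \<open>layer\<close>. Left neighbourhoods of a point of
  \<open>Y i\<close> can be kept inside \<open>Y i\<close>, with the last point of the preceding
  piece as excluded left end, and those of \<open>p\<close> contain a tail of the pieces.\<close>

lemma left_constant_layer:
  fixes Y :: "nat \<Rightarrow> 'a set"
  assumes S: "S = insert p (\<Union>i. Y i)" "(p, p) \<in> r" and Y: "\<And>i. omega_interval n (q i) (Y i)"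
    and top: "\<And>i x. x \<in> Y i \<Longrightarrow> x \<ll> p"
    and lt: "\<And>i j x y. i < j \<Longrightarrow> x \<in> Y i \<Longrightarrow> y \<in> Y j \<Longrightarrow> x \<ll> y"
    and U: "U \<subseteq> S"
  shows "left_constant S U \<longleftrightarrow> (\<forall>i. left_constant (Y i) (U \<inter> Y i)) \<and>
     (\<exists>k. \<forall>i\<ge>k. if p \<in> U then Y i \<subseteq> U else U \<inter> Y i = {})"
proof -
  have below: "\<exists>l\<le>i. y \<in> Y l" if y: "y \<in> S" "(y, x) \<in> r" and x: "x \<in> Y i" for x y i
  proof -
    have "y \<noteq> p" using not_less[OF top[OF x]] y(2) by blast
    then obtain l where l: "y \<in> Y l" using y(1) S(1) by blast
    moreover have "\<not> i < l" using lt[of i l x y] x l not_less y(2) by blast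
    ultimately show ?thesis by (meson not_le)
  qed
  have above: "y = p \<or> (\<exists>l\<ge>i. y \<in> Y l)" if y: "y \<in> S" "a \<ll> y" and a: "a \<in> Y i" for a y i
  proof (cases "y = p")
    case False
    then obtain l where l: "y \<in> Y l" using y(1) S(1) by blast
    moreover have "\<not> l < i" using lt[of l i y a] a l not_less y(2) by (auto simp: less_def)
    ultimately show ?thesis by (meson not_le)
  qed simp
  have YS: "x \<in> Y i \<Longrightarrow> x \<in> S" for x i using S(1) by blast
  have ltn: "x \<in> Y i \<Longrightarrow> x \<in> Y j \<Longrightarrow> i = j" for x i j
    using lt[of i j x x] lt[of j i x x] less_irrefl by (meson linorder_neqE_nat)
  have qY: "q i \<in> Y i" "x \<in> Y i \<Longrightarrow> (x, q i) \<in> r" for x i using omega_interval_max[OF Y[of i]] by auto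
  have pS: "p \<in> S" using S by blast
  show ?thesis
  proof (intro iffI conjI allI)
    assume lc: "left_constant S U"
    show "left_constant (Y i) (U \<inter> Y i)" for i
      unfolding left_constant_def
    proof
      fix x assume x: "x \<in> Y i"
      have "left_locally S (\<lambda>y. y \<in> U \<longleftrightarrow> x \<in> U) x" using lc x YS by (simp add: left_constant_def)
      then consider "\<forall>y\<in>S. (y, x) \<in> r \<longrightarrow> (y \<in> U \<longleftrightarrow> x \<in> U)"
        | a where "a \<in> S" "a \<ll> x" "\<forall>y\<in>S. a \<ll> y \<longrightarrow> (y, x) \<in> r \<longrightarrow> (y \<in> U \<longleftrightarrow> x \<in> U)"
        unfolding left_locally_def by blast
      then show "left_locally (Y i) (\<lambda>y. y \<in> U \<inter> Y i \<longleftrightarrow> x \<in> U \<inter> Y i) x"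
      proof cases
        case 1
        then show ?thesis using x YS by (auto simp: left_locally_def)
      next
        case (2 a)
        show ?thesis
        proof (cases "a \<in> Y i")
          case True
          then show ?thesis using 2 x YS by (auto simp: left_locally_def)
        next
          case False
          have "(a, x) \<in> r" using 2(2) by (simp add: less_def)
          then obtain l where "l \<le> i" "a \<in> Y l" using below[OF 2(1) _ x] by blast
          then have "l < i" "a \<in> Y l" using False by (auto simp: le_less)
          then have "a \<ll> y" if "y \<in> Y i" for y using lt that by blast
          then have "y \<in> U \<longleftrightarrow> x \<in> U" if "y \<in> Y i" "(y, x) \<in> r" for y using 2(3) YS that by blast
          then show ?thesis using x by (simp add: left_locally_def)
        qed
      qed
    qed
    have "left_locally S (\<lambda>y. y \<in> U \<longleftrightarrow> p \<in> U) p" using lc pS by (simp add: left_constant_def)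
    then consider "\<forall>y\<in>S. (y, p) \<in> r \<longrightarrow> (y \<in> U \<longleftrightarrow> p \<in> U)"
      | a where "a \<in> S" "a \<ll> p" "\<forall>y\<in>S. a \<ll> y \<longrightarrow> (y, p) \<in> r \<longrightarrow> (y \<in> U \<longleftrightarrow> p \<in> U)"
      unfolding left_locally_def by blast
    then obtain k where k: "\<And>i y. i \<ge> k \<Longrightarrow> y \<in> Y i \<Longrightarrow> y \<in> U \<longleftrightarrow> p \<in> U"
    proof cases
      case 1
      then have "y \<in> U \<longleftrightarrow> p \<in> U" if "y \<in> Y i" for i y using top[OF that] YS[OF that] by (simp add: less_def)
      then show ?thesis using that by blast
    next
      case (2 a)
      then obtain j where j: "a \<in> Y j" using S(1) less_irrefl by blast
      have "y \<in> U \<longleftrightarrow> p \<in> U" if y: "i \<ge> Suc j" "y \<in> Y i" for i y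
      proof -
        have "a \<ll> y" using lt[of j i a y] j y by simp
        then show ?thesis using 2(3) YS[OF y(2)] top[OF y(2)] by (simp add: less_def)
      qed
      then show ?thesis using that by blast
    qed
    then show "\<exists>k. \<forall>i\<ge>k. if p \<in> U then Y i \<subseteq> U else U \<inter> Y i = {}"
      by (intro exI[of _ k]) auto
  next
    assume "(\<forall>i. left_constant (Y i) (U \<inter> Y i)) \<and> (\<exists>k. \<forall>i\<ge>k. if p \<in> U then Y i \<subseteq> U else U \<inter> Y i = {})"
    then obtain k where lc: "\<And>i. left_constant (Y i) (U \<inter> Y i)"
      and k: "\<And>i. i \<ge> k \<Longrightarrow> if p \<in> U then Y i \<subseteq> U else U \<inter> Y i = {}" by blast
    have k': "y \<in> U \<longleftrightarrow> p \<in> U" if "i \<ge> k" "y \<in> Y i" for i y using k[OF that(1)] that(2) by (auto split: if_splits)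
    show "left_constant S U"
      unfolding left_constant_def
    proof
      fix x assume xS: "x \<in> S"
      show "left_locally S (\<lambda>y. y \<in> U \<longleftrightarrow> x \<in> U) x"
      proof (cases "x = p")
        case True
        \<comment> \<open>Above \<open>q k\<close> there are only \<open>p\<close> and points of the
          pieces from \<open>k\<close> on.\<close>
        have "y \<in> U \<longleftrightarrow> p \<in> U" if "y \<in> S" "q k \<ll> y" for y
          using above[OF that qY(1)] k' by blast
        then show ?thesis using True top[OF qY(1)] YS[OF qY(1)] unfolding left_locally_def by blast
      next
        case False
        then obtain i where i: "x \<in> Y i" using xS S(1) by blast
        have "left_locally (Y i) (\<lambda>y. y \<in> U \<inter> Y i \<longleftrightarrow> x \<in> U \<inter> Y i) x"
          using lc i by (simp add: left_constant_def)
        then consider (init) "\<And>y. y \<in> Y i \<Longrightarrow> (y, x) \<in> r \<Longrightarrow> (y \<in> U \<longleftrightarrow> x \<in> U)"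
          | (cut) a where "a \<in> Y i" "a \<ll> x" "\<And>y. y \<in> Y i \<Longrightarrow> a \<ll> y \<Longrightarrow> (y, x) \<in> r \<Longrightarrow> (y \<in> U \<longleftrightarrow> x \<in> U)"
          using i unfolding left_locally_def by blast
        then show ?thesis
        proof cases
          case init
          show ?thesis
          proof (cases i)
            case 0
            have "y \<in> U \<longleftrightarrow> x \<in> U" if y: "y \<in> S" "(y, x) \<in> r" for y
              using below[OF y i] init[OF _ y(2)] 0 by auto
            then show ?thesis by (simp add: left_locally_def)
          next
            \<comment> \<open>The cut is \<open>q j\<close>, the last point before
              \<open>Y i\<close>; for \<open>i = 0\<close> there was nothing to cut off.\<close>
            case (Suc j)
            have "y \<in> U \<longleftrightarrow> x \<in> U" if y: "y \<in> S" "q j \<ll> y" "(y, x) \<in> r" for y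
            proof -
              obtain l where l: "l \<le> i" "y \<in> Y l" using below[OF y(1,3) i] by blast
              have "l \<noteq> j" using qY(2)[of y j] not_less[OF y(2)] l(2) by blast
              moreover have "\<not> l < j" using lt[of l j y "q j"] l(2) qY(1) not_less y(2) by (auto simp: less_def)
              ultimately have "l = i" using l(1) Suc by linarith
              then show ?thesis using init[OF _ y(3)] l(2) by simp
            qed
            moreover have "q j \<ll> x" using lt[of j i "q j" x] Suc qY(1) i by simp
            ultimately show ?thesis using YS[OF qY(1)] unfolding left_locally_def by blast
          qed
        next
          case (cut a)
          have "y \<in> U \<longleftrightarrow> x \<in> U" if y: "y \<in> S" "a \<ll> y" "(y, x) \<in> r" for y
          proof -
            obtain l where l: "l \<le> i" "y \<in> Y l" using below[OF y(1,3) i] by blast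
            have "\<not> l < i" using lt[of l i y a] l(2) cut(1) not_less y(2) by (auto simp: less_def)
            then have "y \<in> Y i" using l by (simp add: le_less)
            then show ?thesis using cut(3) y by blast
          qed
          then show ?thesis using cut(1,2) YS unfolding left_locally_def by blast
        qed
      qed
    qed
  qed
qed

text \<open>\<open>C\<close> may be any ring that agrees with \<open>left_constant\<close> on the
  subsets of \<open>S\<close>, so one \<open>C\<close> serves all pieces in the induction.\<close>

lemma omega_interval_power:
  assumes "set_ring C" shows "omega_interval n p S \<Longrightarrow> (\<And>U. U \<subseteq> S \<Longrightarrow> U \<in> C \<longleftrightarrow> left_constant S U) \<Longrightarrow>
    set_ring.omega_power C n p S"
proof (induction n arbitrary: p S)
  case 0
  then have "left_constant S S" by (auto simp: left_constant_def left_locally_def)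
  then show ?case using 0 by (simp add: set_ring.omega_power.simps[OF assms])
next
  case (Suc n)
  obtain Y :: "nat \<Rightarrow> 'a set" and q where S: "S = insert p (\<Union>i. Y i)" "(p, p) \<in> r"
    and Y: "\<And>i. omega_interval n (q i) (Y i)" and top: "\<And>i x. x \<in> Y i \<Longrightarrow> x \<ll> p"
    and lt: "\<And>i j x y. i < j \<Longrightarrow> x \<in> Y i \<Longrightarrow> y \<in> Y j \<Longrightarrow> x \<ll> y"
    by (rule omega_interval_SucE[OF Suc.prems(1)]) (rule that)
  have lay: "left_constant S U \<longleftrightarrow> (\<forall>i. left_constant (Y i) (U \<inter> Y i)) \<and>
     (\<exists>k. \<forall>i\<ge>k. if p \<in> U then Y i \<subseteq> U else U \<inter> Y i = {})" if "U \<subseteq> S" for U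
    by (rule left_constant_layer[OF S Y _ _ that]; fact top lt)
  have disj: "Y i \<inter> Y j = {}" if "i \<noteq> j" for i j
    using that lt[of i j] lt[of j i] less_irrefl by (meson disjoint_iff linorder_neqE_nat)
  have empty: "left_constant Z {}" "left_constant Z Z" for Z
    by (auto simp: left_constant_def left_locally_def)
  have YC: "U \<in> C \<longleftrightarrow> left_constant (Y i) U" if U: "U \<subseteq> Y i" for U i
  proof -
    have US: "U \<subseteq> S" using U S(1) by blast
    have p: "p \<notin> U" using top U less_irrefl by blast
    have e: "U \<inter> Y j = (if j = i then U else {})" for j using U disj[of i j] by auto
    have "\<exists>k. \<forall>j\<ge>k. if p \<in> U then Y j \<subseteq> U else (if j = i then U else {}) = {}"
      using p by (intro exI[of _ "Suc i"]) auto
    moreover have "(\<forall>j. left_constant (Y j) (if j = i then U else {})) \<longleftrightarrow> left_constant (Y i) U"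
      using empty(1) by auto
    ultimately have "left_constant S U \<longleftrightarrow> left_constant (Y i) U"
      unfolding lay[OF US] e by blast
    then show ?thesis using Suc.prems(2)[OF US] by simp
  qed
  have "set_ring.layer C p S Y"
    unfolding set_ring.layer_def[OF assms]
  proof (intro conjI allI impI)
    show "disjoint_family Y" using disj by (simp add: disjoint_family_on_def)
    show "p \<notin> (\<Union>i. Y i)" using top less_irrefl by blast
    show "Y i \<in> C" for i using YC[OF subset_refl, of i] empty(2) by simp
    fix U assume U: "U \<subseteq> S"
    have "U \<inter> Y i \<in> C \<longleftrightarrow> left_constant (Y i) (U \<inter> Y i)" for i using YC[of "U \<inter> Y i" i] by simp
    then show "U \<in> C \<longleftrightarrow> (\<forall>i. U \<inter> Y i \<in> C) \<and> (\<exists>k. \<forall>i\<ge>k. if p \<in> U then Y i \<subseteq> U else U \<inter> Y i = {})"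
      using Suc.prems(2)[OF U] lay[OF U] by simp
  qed (use S in simp)
  moreover have "set_ring.omega_power C n (q i) (Y i)" for i using Suc.IH[OF Y YC] by blast
  ultimately show ?case by (auto simp: set_ring.omega_power.simps[OF assms])
qed

lemma omega_interval_small_index:
  assumes S: "omega_interval n p S"
  shows "small_index_property S (clopens (order_topology_on S r))"
proof -
  let ?T = "order_topology_on S r"
  have ring: "set_ring (clopens ?T)"
    by standard (auto simp: clopens_def openin_diff closedin_diff)
  have "U \<in> clopens ?T \<longleftrightarrow> left_constant S U" if "U \<subseteq> S" for U using that clopens_order[OF S] by simp
  then have "set_ring.omega_power (clopens ?T) n p S" by (rule omega_interval_power[OF ring S])
  then have "stone_space (clopens ?T) n p S"
    using ring topspace_order[OF S] openin_subset[of ?T]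
    by (intro stone_space.intro stone_space_axioms.intro) (auto simp: clopens_def)
  then show ?thesis by (rule stone_space.small_index_property)
qed

end

section \<open>The ordinal \<open>\<omega>\<^sup>n\<close>\<close>

text \<open>\<open>f i\<close> is the coefficient of \<open>\<omega>\<^sup>i\<close> in the Cantor
  normal form of an ordinal below \<open>\<omega>\<^sup>n\<close>. The value
  \<open>undefined\<close> comes from \<open>Func\<close>; finite support is automatic for a finite
  exponent.\<close>

definition seqs :: "nat \<Rightarrow> (nat \<Rightarrow> nat) set" where
  "seqs n = {f. \<forall>i\<ge>n. f i = undefined}"

abbreviation omega_pow :: "nat \<Rightarrow> (nat \<Rightarrow> nat) rel" where
  "omega_pow n \<equiv> ord_exp natLeq (natLeq_on n)"

lemma omega_pow_iff:
  "(f, g) \<in> omega_pow n \<longleftrightarrow> f \<in> seqs n \<and> g \<in> seqs n \<and>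
     (f = g \<or> (\<exists>b<n. f b < g b \<and> (\<forall>c>b. f c = g c)))"
proof -
  have F: "Field (natLeq_on n) = {..<n}" by (simp add: Field_natLeq_on lessThan_def)
  have S: "fin_supp_funcs natLeq (natLeq_on n) = seqs n"
    by (auto simp: fin_supp_funcs_def seqs_def Func_def F Field_natLeq not_less)
  have "(\<exists>b\<in>{..<n}. (f b, g b) \<in> natLeq - Id \<and> (\<forall>c. (b, c) \<in> natLeq_on n - Id \<longrightarrow> f c = g c)) \<longleftrightarrow>
      (\<exists>b<n. f b < g b \<and> (\<forall>c>b. f c = g c))" if fg: "f \<in> seqs n" "g \<in> seqs n"
  proof -
    have "(\<forall>c. (b, c) \<in> natLeq_on n - Id \<longrightarrow> f c = g c) \<longleftrightarrow> (\<forall>c>b. f c = g c)" if "b < n" for b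
    proof (intro iffI allI impI)
      fix c assume *: "\<forall>c. (b, c) \<in> natLeq_on n - Id \<longrightarrow> f c = g c" "b < c"
      show "f c = g c"
      proof (cases "c < n")
        case True then show ?thesis using * that by auto
      next
        case False then show ?thesis using fg by (simp add: seqs_def)
      qed
    qed auto
    moreover have "(f b, g b) \<in> natLeq - Id \<longleftrightarrow> f b < g b" for b by (auto simp: natLeq_def)
    ultimately show ?thesis by auto
  qed
  then show ?thesis unfolding ord_exp_def S F by blast
qed

lemma omega_pow_trans:
  assumes "(f, g) \<in> omega_pow n" "(g, h) \<in> omega_pow n" shows "(f, h) \<in> omega_pow n"
proof (cases "f = g \<or> g = h")
  case True
  then show ?thesis using assms by auto
next
  case False
  then obtain b c where b: "b < n" "f b < g b" "\<And>i. i > b \<Longrightarrow> f i = g i"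
    and c: "c < n" "g c < h c" "\<And>i. i > c \<Longrightarrow> g i = h i"
    using assms unfolding omega_pow_iff by metis
  have "f (max b c) < h (max b c)"
    using b(2) c(2) b(3)[of c] c(3)[of b] by (cases b c rule: linorder_cases) auto
  moreover have "f i = h i" if "i > max b c" for i using b(3)[of i] c(3)[of i] that by simp
  ultimately have "\<exists>m<n. f m < h m \<and> (\<forall>i>m. f i = h i)" using b(1) c(1) by (intro exI[of _ "max b c"]) auto
  then show ?thesis using assms unfolding omega_pow_iff by blast
qed

lemma omega_pow_antisym:
  assumes "(f, g) \<in> omega_pow n" "(g, f) \<in> omega_pow n" shows "f = g"
proof (rule ccontr)
  assume ne: "f \<noteq> g"
  obtain b where b: "f b < g b" "\<And>i. i > b \<Longrightarrow> f i = g i" using assms(1) ne unfolding omega_pow_iff by blast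
  obtain c where c: "g c < f c" "\<And>i. i > c \<Longrightarrow> g i = f i" using assms(2) ne unfolding omega_pow_iff by metis
  show False using b(1) c(1) b(2)[of c] c(2)[of b] by (cases b c rule: linorder_cases) auto
qed

lemma omega_pow_total:
  assumes "f \<in> seqs n" "g \<in> seqs n" shows "(f, g) \<in> omega_pow n \<or> (g, f) \<in> omega_pow n"
proof (cases "f = g")
  case False
  define D where "D = {i. f i \<noteq> g i}"
  have D: "D \<subseteq> {..<n}" "D \<noteq> {}" using assms False by (auto simp: D_def seqs_def not_le[symmetric])
  then have fin: "finite D" using finite_subset by blast
  define b where "b = Max D"
  have b: "b \<in> D" "\<And>i. i \<in> D \<Longrightarrow> i \<le> b" using fin D(2) by (simp_all add: b_def)
  have "f i = g i" if "i > b" for i using b(2)[of i] that by (auto simp: D_def)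
  moreover have "f b < g b \<or> g b < f b" "b < n" using b(1) D(1) by (auto simp: D_def)
  ultimately show ?thesis using assms unfolding omega_pow_iff by metis
qed (use assms in \<open>simp add: omega_pow_iff\<close>)

text \<open>Listing the coefficients from the highest down embeds the order into the lexicographic
  order on lists of length \<open>n\<close>.\<close>

lemma omega_pow_wf: "wf (omega_pow n - Id)"
proof (rule wf_subset)
  define l where "l f = map (f :: nat \<Rightarrow> nat) (rev [0..<n])" for f
  show "wf (inv_image (lexn less_than n) l)" by (intro wf_inv_image wf_lexn) simp
  show "omega_pow n - Id \<subseteq> inv_image (lexn less_than n) l"
  proof
    fix x assume "x \<in> omega_pow n - Id"
    then obtain f g where x: "x = (f, g)" "(f, g) \<in> omega_pow n" "f \<noteq> g" by (cases x) auto
    then obtain b where b: "b < n" "f b < g b" "\<And>c. c > b \<Longrightarrow> f c = g c" unfolding omega_pow_iff by blast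
    have "[0..<n] = [0..<b] @ b # [Suc b..<n]" using b(1)
      by (metis le0 le_add_diff_inverse less_imp_le_nat upt_add_eq_append upt_conv_Cons)
    then have split: "l h = map h (rev [Suc b..<n]) @ h b # map h (rev [0..<b])" for h by (simp add: l_def)
    have "map f (rev [Suc b..<n]) = map g (rev [Suc b..<n])" using b(3) by simp
    moreover have "length (l h) = n" for h by (simp add: l_def)
    ultimately have "(l f, l g) \<in> lexn less_than n"
      unfolding lexn_conv mem_Collect_eq case_prod_conv using split b(2) by (metis less_than_iff)
    then show "x \<in> inv_image (lexn less_than n) l" using x(1) by simp
  qed
qed

abbreviation omega_succ :: "nat \<Rightarrow> (nat \<Rightarrow> nat) option rel" where
  "omega_succ n \<equiv> ord_succ (omega_pow n)"

lemma Field_omega_pow: "Field (omega_pow n) = seqs n"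
  unfolding Field_def Domain_unfold Range_def by (auto simp: omega_pow_iff)

lemma omega_succ_iff:
  "(x, y) \<in> omega_succ n \<longleftrightarrow> (case (x, y) of (Some f, Some g) \<Rightarrow> (f, g) \<in> omega_pow n
     | (Some f, None) \<Rightarrow> f \<in> seqs n | (None, Some g) \<Rightarrow> False | (None, None) \<Rightarrow> True)"
  by (auto simp: ord_succ_def Field_omega_pow split: option.splits)

lemma Field_omega_succ: "Field (omega_succ n) = insert None (Some ` seqs n)"
proof
  show "Field (omega_succ n) \<subseteq> insert None (Some ` seqs n)"
    by (auto simp: Field_def ord_succ_def omega_pow_iff Field_omega_pow[unfolded Field_def])
  show "insert None (Some ` seqs n) \<subseteq> Field (omega_succ n)"
  proof
    fix x assume "x \<in> insert None (Some ` seqs n)"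
    then have "(x, x) \<in> omega_succ n" by (auto simp: omega_succ_iff omega_pow_iff)
    then show "x \<in> Field (omega_succ n)" by (rule FieldI1)
  qed
qed

interpretation omega_succ: partial_ord "omega_succ n" for n
proof
  fix x y z
  show "(x, y) \<in> omega_succ n \<Longrightarrow> (y, x) \<in> omega_succ n \<Longrightarrow> x = y"
    using omega_pow_antisym by (auto simp: omega_succ_iff split: option.splits)
  show "(x, y) \<in> omega_succ n \<Longrightarrow> (y, z) \<in> omega_succ n \<Longrightarrow> (x, z) \<in> omega_succ n"
    using omega_pow_trans[of _ _ n] by (auto simp: omega_succ_iff omega_pow_iff[of _ _ n] split: option.splits)
qed

lemma omega_succ_wf: "wf (omega_succ n - Id)"
proof (rule wfUNIVI)
  fix P :: "(nat \<Rightarrow> nat) option \<Rightarrow> bool" and x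
  assume step: "\<forall>x. (\<forall>y. (y, x) \<in> omega_succ n - Id \<longrightarrow> P y) \<longrightarrow> P x"
  have S: "P (Some f)" for f
  proof (induction f rule: wf_induct_rule[OF omega_pow_wf[of n]])
    case (1 f)
    show ?case
    proof (rule step[rule_format])
      fix y assume "(y, Some f) \<in> omega_succ n - Id"
      then show "P y" using 1 by (cases y) (auto simp: omega_succ_iff)
    qed
  qed
  have "P None"
  proof (rule step[rule_format])
    fix y assume "(y, None) \<in> omega_succ n - Id"
    then show "P y" using S by (cases y) auto
  qed
  then show "P x" using S by (cases x) auto
qed

lemma omega_succ_wo_rel: "wo_rel (omega_succ n)"
  unfolding wo_rel_def well_order_on_def linear_order_on_def partial_order_on_def preorder_on_def
proof (intro conjI)
  show "refl_on (Field (omega_succ n)) (omega_succ n)"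
    by (auto simp: refl_on_def Field_omega_succ omega_succ_iff omega_pow_iff split: option.splits)
  show "trans (omega_succ n)" using omega_succ.trans by (rule transI)
  show "antisym (omega_succ n)" using omega_succ.antisym by (rule antisymI)
  show "total_on (Field (omega_succ n)) (omega_succ n)"
    using omega_pow_total by (auto simp: total_on_def Field_omega_succ omega_succ_iff)
  show "wf (omega_succ n - Id)" by (rule omega_succ_wf)
qed (auto intro: FieldI1 FieldI2)

definition zero_seq :: "nat \<Rightarrow> nat \<Rightarrow> nat" where
  "zero_seq n i = (if i < n then 0 else undefined)"

lemma zero_seq_least:
  assumes "x \<in> Field (omega_succ n)" shows "(Some (zero_seq n), x) \<in> omega_succ n"
proof (cases x)
  case None
  then show ?thesis by (simp add: omega_succ_iff zero_seq_def seqs_def)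
next
  case (Some f)
  then have f: "f \<in> seqs n" using assms by (auto simp: Field_omega_succ)
  have z: "zero_seq n \<in> seqs n" by (simp add: zero_seq_def seqs_def)
  have "(zero_seq n, f) \<in> omega_pow n"
  proof (rule ccontr)
    assume *: "(zero_seq n, f) \<notin> omega_pow n"
    then have "(f, zero_seq n) \<in> omega_pow n" "f \<noteq> zero_seq n" using omega_pow_total[OF z f] z by (auto simp: omega_pow_iff)
    then show False by (auto simp: omega_pow_iff zero_seq_def)
  qed
  then show ?thesis using Some by (simp add: omega_succ_iff)
qed

text \<open>One is the least element above zero, so only zero is excluded. This covers the exponent
  \<open>0\<close>, where one is the added greatest element.\<close>

lemma ord_interval_one_omega:
  "ord_interval_one (omega_pow n) = {x \<in> Field (omega_succ n). x \<noteq> Some (zero_seq n)}"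
proof -
  let ?r = "omega_succ n" and ?z = "Some (zero_seq n)"
  interpret wo_rel ?r by (rule omega_succ_wo_rel)
  have zF: "?z \<in> Field ?r" by (auto simp: Field_omega_succ zero_seq_def seqs_def)
  have min: "minim (Field ?r) \<in> Field ?r" using zF by (intro minim_in) auto
  have "ord_zero ?r = ?z"
    unfolding ord_zero_def
    by (rule omega_succ.antisym[OF minim_least[OF subset_refl zF] zero_seq_least[OF min]])
  then have one: "ord_one ?r = minim (AboveS {?z})" by (simp add: ord_one_def suc_def)
  have A: "AboveS {?z} = {x \<in> Field ?r. x \<noteq> ?z}" using zero_seq_least by (auto simp: AboveS_def Order_Relation.AboveS_def)
  have "None \<in> AboveS {?z}" unfolding A by (simp add: Field_omega_succ)
  then have 1: "ord_one ?r \<in> AboveS {?z}" unfolding one by (intro minim_in) (auto simp: A)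
  show ?thesis
  proof (intro equalityI subsetI)
    fix x assume "x \<in> ord_interval_one (omega_pow n)"
    then have x: "(ord_one ?r, x) \<in> ?r" by (simp add: ord_interval_one_def Order_Relation.above_def)
    then have "x \<in> Field ?r" by (rule FieldI2)
    moreover have "x \<noteq> ?z"
    proof
      assume "x = ?z"
      then have "ord_one ?r = ?z" using omega_succ.antisym[OF x] 1 zero_seq_least unfolding A by blast
      then show False using 1 unfolding A by simp
    qed
    ultimately show "x \<in> {x \<in> Field ?r. x \<noteq> ?z}" by simp
  next
    fix x assume "x \<in> {x \<in> Field ?r. x \<noteq> ?z}"
    then have "x \<in> AboveS {?z}" unfolding A .
    then have "(ord_one ?r, x) \<in> ?r" unfolding one by (intro minim_least) (auto simp: A)
    then show "x \<in> ord_interval_one (omega_pow n)" by (simp add: ord_interval_one_def Order_Relation.above_def)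
  qed
qed

text \<open>For \<open>g\<close> vanishing below \<open>m\<close>, \<open>segment n m g\<close> is the interval \<open>(g, g + \<omega>\<^sup>m]\<close>, with last
  element \<open>segment_top n m g\<close>.\<close>

definition segment_top :: "nat \<Rightarrow> nat \<Rightarrow> (nat \<Rightarrow> nat) \<Rightarrow> (nat \<Rightarrow> nat) option" where
  "segment_top n m g = (if m < n then Some (g(m := Suc (g m))) else None)"

definition segment :: "nat \<Rightarrow> nat \<Rightarrow> (nat \<Rightarrow> nat) \<Rightarrow> (nat \<Rightarrow> nat) option set" where
  "segment n m g = insert (segment_top n m g)
     {Some f | f. f \<in> seqs n \<and> (\<forall>c\<ge>m. f c = g c) \<and> (\<exists>c<m. f c \<noteq> 0)}"

lemma segment_top_refl:
  assumes "g \<in> seqs n" shows "(segment_top n m g, segment_top n m g) \<in> omega_succ n"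
  using assms by (auto simp: segment_top_def omega_succ_iff omega_pow_iff seqs_def)

lemma segment_le_top:
  assumes g: "g \<in> seqs n" and x: "x \<in> segment n m g" shows "(x, segment_top n m g) \<in> omega_succ n"
proof (cases "x = segment_top n m g")
  case True
  then show ?thesis using segment_top_refl[OF g] by simp
next
  case False
  then obtain f where f: "x = Some f" "f \<in> seqs n" "\<And>c. c \<ge> m \<Longrightarrow> f c = g c" using x by (auto simp: segment_def)
  have "m < n \<Longrightarrow> (f, g(m := Suc (g m))) \<in> omega_pow n"
    using f g by (auto simp: omega_pow_iff seqs_def intro!: exI[of _ m])
  then show ?thesis using f by (auto simp: segment_top_def omega_succ_iff)
qed

lemma segment_gt:
  assumes m: "m \<le> n" and g: "g \<in> seqs n" "\<And>i. i < m \<Longrightarrow> g i = 0" and x: "x \<in> segment n m g"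
  shows "(Some g, x) \<in> omega_succ n \<and> x \<noteq> Some g"
proof (cases "x = segment_top n m g")
  case True
  have "(g, g(m := Suc (g m))) \<in> omega_pow n" if "m < n"
    using g that by (auto simp: omega_pow_iff seqs_def intro!: exI[of _ m])
  moreover have "g(m := Suc (g m)) \<noteq> g" by (metis fun_upd_same n_not_Suc_n)
  ultimately show ?thesis using True g by (auto simp: segment_top_def omega_succ_iff)
next
  case False
  then obtain f where f: "x = Some f" "f \<in> seqs n" "\<And>c. c \<ge> m \<Longrightarrow> f c = g c" "\<exists>c<m. f c \<noteq> 0"
    using x by (auto simp: segment_def)
  have "f \<noteq> g" using f(4) g(2) by auto
  moreover have "(f, g) \<notin> omega_pow n"
  proof
    assume "(f, g) \<in> omega_pow n"
    then obtain b where b: "f b < g b" using \<open>f \<noteq> g\<close> by (auto simp: omega_pow_iff)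
    show False using b g(2)[of b] f(3)[of b] by (cases "b < m") auto
  qed
  ultimately have "(g, f) \<in> omega_pow n" using omega_pow_total[OF g(1) f(2)] by blast
  then show ?thesis using f(1) \<open>f \<noteq> g\<close> by (auto simp: omega_succ_iff)
qed

text \<open>The interval is cut at the multiples of \<open>\<omega>\<^sup>m\<close>. An element with
  a nonzero coefficient below \<open>m\<close> lies inside the part numbered by its
  \<open>m\<close>-th coefficient; one without is a right end point, and its part is numbered by
  that coefficient minus one.\<close>

lemma segment_Suc:
  assumes m: "m < n" and g: "g \<in> seqs n" "\<And>i. i < Suc m \<Longrightarrow> g i = 0"
  shows "segment n (Suc m) g = insert (segment_top n (Suc m) g) (\<Union>i. segment n m (g(m := i)))"
proof -
  have "(f \<in> seqs n \<and> (\<forall>c\<ge>Suc m. f c = g c) \<and> (\<exists>c<Suc m. f c \<noteq> 0)) \<longleftrightarrow>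
      (\<exists>i. f = g(m := Suc i) \<or> (f \<in> seqs n \<and> (\<forall>c\<ge>m. f c = (g(m := i)) c) \<and> (\<exists>c<m. f c \<noteq> 0)))" for f
  proof
    assume f: "f \<in> seqs n \<and> (\<forall>c\<ge>Suc m. f c = g c) \<and> (\<exists>c<Suc m. f c \<noteq> 0)"
    show "\<exists>i. f = g(m := Suc i) \<or> (f \<in> seqs n \<and> (\<forall>c\<ge>m. f c = (g(m := i)) c) \<and> (\<exists>c<m. f c \<noteq> 0))"
    proof (cases "\<exists>c<m. f c \<noteq> 0")
      case True
      have "f c = (g(m := f m)) c" if "c \<ge> m" for c using f that by (cases "c = m") auto
      then show ?thesis using f True by (intro exI[of _ "f m"]) blast
    next
      case False
      then have "f m \<noteq> 0" using f less_Suc_eq by auto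
      then have fm: "f m = Suc (f m - 1)" by simp
      have "f c = (g(m := Suc (f m - 1))) c" for c
      proof (cases c m rule: linorder_cases)
        case less
        then show ?thesis using False g(2)[of c] by simp
      next
        case equal
        then show ?thesis using fm by simp
      next
        case greater
        then show ?thesis using f by simp
      qed
      then have "f = g(m := Suc (f m - 1))" by (rule ext)
      then show ?thesis by blast
    qed
  next
    assume "\<exists>i. f = g(m := Suc i) \<or> (f \<in> seqs n \<and> (\<forall>c\<ge>m. f c = (g(m := i)) c) \<and> (\<exists>c<m. f c \<noteq> 0))"
    then obtain i where "f = g(m := Suc i) \<or> (f \<in> seqs n \<and> (\<forall>c\<ge>m. f c = (g(m := i)) c) \<and> (\<exists>c<m. f c \<noteq> 0))" ..
    then show "f \<in> seqs n \<and> (\<forall>c\<ge>Suc m. f c = g c) \<and> (\<exists>c<Suc m. f c \<noteq> 0)"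
    proof
      assume "f = g(m := Suc i)"
      then show ?thesis using g(1) m by (auto simp: seqs_def)
    next
      assume f: "f \<in> seqs n \<and> (\<forall>c\<ge>m. f c = (g(m := i)) c) \<and> (\<exists>c<m. f c \<noteq> 0)"
      then have "f c = g c" if "c \<ge> Suc m" for c using that by auto
      then show ?thesis using f less_SucI by blast
    qed
  qed
  then show ?thesis using m unfolding segment_def segment_top_def by auto
qed

text \<open>The segments starting at \<open>g(m := i)\<close> are consecutive: the top of the
  \<open>i\<close>-th is at most the left end point of any later one, and that end point is
  excluded.\<close>

lemma segment_omega_interval:
  "m \<le> n \<Longrightarrow> g \<in> seqs n \<Longrightarrow> (\<And>i. i < m \<Longrightarrow> g i = 0) \<Longrightarrow>
   omega_succ.omega_interval n m (segment_top n m g) (segment n m g)"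
proof (induction m arbitrary: g)
  case 0
  then show ?case using segment_top_refl by (simp add: segment_def)
next
  case (Suc m)
  have mn: "m < n" "m \<le> n" using Suc.prems(1) by auto
  note g = Suc.prems(2,3)
  let ?p = "segment_top n (Suc m) g" and ?Y = "\<lambda>i. segment n m (g(m := i))"
  have gi: "g(m := i) \<in> seqs n" for i using g(1) mn by (auto simp: seqs_def)
  have gz: "(g(m := i)) j = 0" if "j < m" for i j using g(2)[of j] that by simp
  note eq = segment_Suc[OF mn(1) g]
  have ne: "?p \<notin> ?Y i" for i
  proof
    assume p: "?p \<in> ?Y i"
    then have s: "Suc m < n" using mn(1) by (auto simp: segment_top_def segment_def split: if_splits)
    have "f (Suc m) = g (Suc m)" if "Some f \<in> ?Y i" for f
      using that mn(1) by (auto simp: segment_def segment_top_def dest!: spec[of _ "Suc m"])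
    from this[of "g(Suc m := Suc (g (Suc m)))"] show False using p s by (simp add: segment_top_def)
  qed
  have "x \<in> ?Y i \<Longrightarrow> (x, ?p) \<in> omega_succ n \<and> x \<noteq> ?p" for x i
    using segment_le_top[OF g(1), of x "Suc m"] eq ne by blast
  moreover have "(x, y) \<in> omega_succ n \<and> x \<noteq> y" if ij: "i < j" and x: "x \<in> ?Y i" and y: "y \<in> ?Y j" for x y i j
  proof -
    have "(x, segment_top n m (g(m := i))) \<in> omega_succ n" using segment_le_top[OF gi x] .
    moreover have "(segment_top n m (g(m := i)), Some (g(m := j))) \<in> omega_succ n"
    proof (cases "Suc i = j")
      case True
      then show ?thesis using mn(1) gi by (auto simp: segment_top_def omega_succ_iff omega_pow_iff)
    next
      case False
      then have "\<exists>b<n. (g(m := Suc i)) b < (g(m := j)) b \<and> (\<forall>c>b. (g(m := Suc i)) c = (g(m := j)) c)"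
        using mn(1) ij by (intro exI[of _ m]) auto
      then show ?thesis using mn(1) gi by (simp add: segment_top_def omega_succ_iff omega_pow_iff)
    qed
    ultimately have "(x, Some (g(m := j))) \<in> omega_succ n" by (rule omega_succ.trans)
    moreover have gt: "(Some (g(m := j)), y) \<in> omega_succ n \<and> y \<noteq> Some (g(m := j))"
      using segment_gt[OF mn(2) gi gz y] by blast
    ultimately show ?thesis using omega_succ.trans omega_succ.antisym by blast
  qed
  moreover have "omega_succ.omega_interval n m (segment_top n m (g(m := i))) (?Y i)" for i
    using Suc.IH[OF mn(2) gi gz] .
  ultimately show ?case
    unfolding omega_succ.omega_interval.simps omega_succ.less_def
    using eq segment_top_refl[OF g(1)] by (intro exI[of _ ?Y] exI[of _ "\<lambda>i. segment_top n m (g(m := i))"]) simp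
qed

text \<open>For \<open>m = n\<close> and the ordinal zero the segment is
  \<open>(0, \<omega>\<^sup>n]\<close>, with the added element \<open>None\<close> as its
  top.\<close>

lemma ord_interval_one_segment: "ord_interval_one (omega_pow n) = segment n n (zero_seq n)"
proof -
  have "f = zero_seq n \<longleftrightarrow> \<not> (\<exists>c<n. f c \<noteq> 0)" if "f \<in> seqs n" for f
    using that by (auto simp: seqs_def zero_seq_def fun_eq_iff)
  moreover have "(\<forall>c\<ge>n. f c = zero_seq n c) \<longleftrightarrow> f \<in> seqs n" for f
    by (auto simp: seqs_def zero_seq_def)
  moreover have "zero_seq n c = 0" if "c < n" for c using that by (simp add: zero_seq_def)
  ultimately show ?thesis
    unfolding ord_interval_one_omega Field_omega_succ segment_def segment_top_def by auto
qed

theorem theorem3p1: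
  fixes \<alpha> :: nat
  shows "small_index_property
           (topspace (interval_topology (ord_exp natLeq (natLeq_on \<alpha>))))
           (clopens (interval_topology (ord_exp natLeq (natLeq_on \<alpha>))))"
proof -
  have S: "omega_succ.omega_interval \<alpha> \<alpha> (segment_top \<alpha> \<alpha> (zero_seq \<alpha>)) (ord_interval_one (omega_pow \<alpha>))"
    unfolding ord_interval_one_segment
    by (rule segment_omega_interval) (auto simp: seqs_def zero_seq_def)
  show ?thesis
    unfolding interval_topology_def omega_succ.topspace_order[OF S]
    by (rule omega_succ.omega_interval_small_index[OF S])
qed

end
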